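(* Let $\Omega\subset\mathbb{R}^n$ be an open and bounded domain with Lipschitz boundary, let $s\in(0,1)$, and let $G$ be a Young function with $g=G'$ satisfying $$\int_1^\infty\left(\frac{t}{G(t)}\right)^{\frac{s}{n-s}}dt=\infty,\qquad \int_0^1\left(\frac{t}{G(t)}\right)^{\frac{s}{n-s}}dt<\infty.$$ Let $\alpha>0$ and let $u_\alpha\in W^s_0L^G(\Omega)$ be a solution of the minimization problem $\min\{\mathcal{F}(u):u\in W^s_0L^G(\Omega),\ \mathcal{J}(u)=\alpha\}$. Then there exists $\lambda_\alpha>0$ such that $$\iint_{\mathbb{R}^n\times\mathbb{R}^n} g(|D_su_\alpha|)\frac{D_su_\alpha}{|D_su_\alpha|}D_sv\,d\mu=\lambda_\alpha\int_\Omega g(|u_\alpha|)\frac{u_\alpha}{|u_\alpha|}v\,dx\qquad\text{for any } v\in W^s_0L^G(\Omega).$$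
   Context: A Young function is a map $G:[0,\infty)\to[0,\infty)$ of the form $G(t)=\int_0^t g(\tau)\,d\tau$, where $g:[0,\infty)\to[0,\infty)$ is right continuous, nondecreasing on $(0,\infty)$, $g(0)=0$, $g(t)>0$ for $t>0$, and $\lim_{t\to\infty}g(t)=\infty$; "$g=G'$" refers to this $g$. No $\Delta_2$ (doubling) condition is assumed. Its complementary function is $\tilde G(t)=\sup\{tw-G(w):w>0\}$. The expression $g(|t|)\frac{t}{|t|}$ is $0$ at $t=0$. For a measure space $(X,\nu)$, $K^G(X,\nu)$ is the set of measurable $u$ with $\int_X G(|u|)\,d\nu<\infty$; $L^G(X,\nu)$ is its linear hull, normed by $\|u\|_G=\inf\{\lambda>0:\int_X G(|u|/\lambda)\,d\nu\le1\}$; $E^G(X,\nu)$ is the closure in $L^G(X,\nu)$ of the bounded measurable functions (supported on sets of finite measure if $\nu(X)=\infty$). On $\Omega$ one uses Lebesgue measure. One has $(E^{\tilde G})'=L^G$. Set $D_su(x,y)=\frac{u(x)-u(y)}{|x-y|^s}$ and $d\mu=\frac{dx\,dy}{|x-y|^n}$ on $\mathbb{R}^n\times\mathbb{R}^n$. $W^sL^G(\Omega)$ is the space of measurable functions $u$ on $\mathbb{R}^n$ with $u|_\Omega\in L^G(\Omega)$ and $D_su\in L^G(\mathbb{R}^n\times\mathbb{R}^n,d\mu)$, with norm $\|u\|_{s,G}=\|u\|_G+[u]_{s,G}$, where $[u]_{s,G}=\inf\{\lambda>0:\iint G(|D_su|/\lambda)\,d\mu\le1\}$. Via $u\mapsto(u,D_su)$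 it is regarded as a subspace of $L^G(\Omega)\times L^G(\mathbb{R}^n\times\mathbb{R}^n,d\mu)$, the dual of $E^{\tilde G}(\Omega)\times E^{\tilde G}(\mathbb{R}^n\times\mathbb{R}^n,d\mu)$; weak* refers to this duality. $W^s_0L^G(\Omega)$ is the weak* closure of $C_c^\infty(\Omega)$ (functions extended by zero outside $\Omega$) in $W^sL^G(\Omega)$. $\mathcal{F}(u)=\iint_{\mathbb{R}^n\times\mathbb{R}^n}G(|D_su|)\,d\mu$ and $\mathcal{J}(u)=\int_\Omega G(|u|)\,dx$. *)

theory Defs
  imports "HOL-Analysis.Analysis"
begin

section \<open>Young functions\<close>

text \<open>
  Functions on the half-line are total functions on the reals whose values at negative arguments
  are never used.
\<close>

definition young_function :: "(real \<Rightarrow> real) \<Rightarrow> (real \<Rightarrow> real) \<Rightarrow> bool" where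
  "young_function G g \<longleftrightarrow>
     (\<forall>t\<ge>0. continuous (at_right t) g) \<and>
     mono_on {0<..} g \<and>
     g 0 = 0 \<and>
     (\<forall>t>0. g t > 0) \<and>
     filterlim g at_top at_top \<and>
     (\<forall>t\<ge>0. (g has_integral G t) {0..t})"

text \<open>
  For a Young function the supremum below is that of a nonempty set which is bounded above,
  because g tends to infinity.
\<close>

definition compl_young :: "(real \<Rightarrow> real) \<Rightarrow> real \<Rightarrow> real" where
  "compl_young G t = (SUP w\<in>{0<..}. t * w - G w)"

section \<open>Orlicz spaces\<close>

text \<open>
  Elements of the spaces are functions, not classes of functions modulo null sets. They are total
  on the type, but only their values on the space of the measure matter.
\<close>

definition orlicz_K :: "(real \<Rightarrow> real) \<Rightarrow> 'a measure \<Rightarrow> ('a \<Rightarrow> real) set" where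
  "orlicz_K G M = {u \<in> borel_measurable M. (\<integral>\<^sup>+x. ennreal (G \<bar>u x\<bar>) \<partial>M) < \<infinity>}"

definition orlicz_L :: "(real \<Rightarrow> real) \<Rightarrow> 'a measure \<Rightarrow> ('a \<Rightarrow> real) set" where
  "orlicz_L G M = {u. \<exists>F c. finite F \<and> F \<subseteq> orlicz_K G M \<and>
                         (\<forall>x\<in>space M. u x = (\<Sum>f\<in>F. c f * f x))}"

definition luxemburg_norm :: "(real \<Rightarrow> real) \<Rightarrow> 'a measure \<Rightarrow> ('a \<Rightarrow> real) \<Rightarrow> real" where
  "luxemburg_norm G M u =
     Inf {l. l > 0 \<and> (\<integral>\<^sup>+x. ennreal (G (\<bar>u x\<bar> / l)) \<partial>M) \<le> 1}"

text \<open>When M is finite, the condition on the support holds automatically.\<close>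

definition bounded_fin_supp :: "'a measure \<Rightarrow> ('a \<Rightarrow> real) set" where
  "bounded_fin_supp M = {u \<in> borel_measurable M.
     (\<exists>B. \<forall>x\<in>space M. \<bar>u x\<bar> \<le> B) \<and> emeasure M {x \<in> space M. u x \<noteq> 0} < \<infinity>}"

definition orlicz_E :: "(real \<Rightarrow> real) \<Rightarrow> 'a measure \<Rightarrow> ('a \<Rightarrow> real) set" where
  "orlicz_E G M = {u \<in> orlicz_L G M.
     \<forall>e>0. \<exists>w\<in>bounded_fin_supp M. luxemburg_norm G M (\<lambda>x. u x - w x) < e}"

section \<open>Fractional Orlicz--Sobolev spaces\<close>

text \<open>On the diagonal, a null set, the two quotients below have the value 0.\<close>

definition frac_D :: "real \<Rightarrow> ('a::euclidean_space \<Rightarrow> real) \<Rightarrow> 'a \<times> 'a \<Rightarrow> real" where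
  "frac_D s u = (\<lambda>(x, y). (u x - u y) / norm (x - y) powr s)"

definition frac_mu :: "('a::euclidean_space \<times> 'a) measure" where
  "frac_mu = density lebesgue (\<lambda>(x, y). ennreal (1 / norm (x - y) ^ DIM('a)))"

definition frac_WL :: "real \<Rightarrow> (real \<Rightarrow> real) \<Rightarrow> 'a::euclidean_space set \<Rightarrow> ('a \<Rightarrow> real) set" where
  "frac_WL s G \<Omega> = {u \<in> borel_measurable lebesgue.
     u \<in> orlicz_L G (lebesgue_on \<Omega>) \<and> frac_D s u \<in> orlicz_L G frac_mu}"

text \<open>
  The weak* topology of the pairs (u, U) as functionals on the predual consisting of the pairs
  (v, V): the coarsest topology for which all evaluations on the predual are continuous.
\<close>

definition weak_star_topology ::
    "(real \<Rightarrow> real) \<Rightarrow> 'a::euclidean_space set \<Rightarrow> (('a \<Rightarrow> real) \<times> ('a \<times> 'a \<Rightarrow> real)) topology" where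
  "weak_star_topology G \<Omega> =
     (let E = orlicz_E (compl_young G) (lebesgue_on \<Omega>) \<times> orlicz_E (compl_young G) frac_mu
      in pullback_topology
           (orlicz_L G (lebesgue_on \<Omega>) \<times> orlicz_L G frac_mu)
           (\<lambda>(u, U). \<lambda>(v, V)\<in>E.
              (LINT x|lebesgue_on \<Omega>. u x * v x) + (LINT z|frac_mu. U z * V z))
           (product_topology (\<lambda>_. euclideanreal) E))"

definition frac_WL_weak_star ::
    "real \<Rightarrow> (real \<Rightarrow> real) \<Rightarrow> 'a::euclidean_space set \<Rightarrow> ('a \<Rightarrow> real) topology" where
  "frac_WL_weak_star s G \<Omega> =
     pullback_topology (frac_WL s G \<Omega>) (\<lambda>u. (u, frac_D s u)) (weak_star_topology G \<Omega>)"

primrec Ck :: "nat \<Rightarrow> ('a::euclidean_space \<Rightarrow> real) \<Rightarrow> bool" where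
  "Ck 0 f \<longleftrightarrow> continuous_on UNIV f"
| "Ck (Suc k) f \<longleftrightarrow> (\<forall>x. f differentiable (at x)) \<and>
     (\<forall>b\<in>Basis. Ck k (\<lambda>x. frechet_derivative f (at x) b))"

definition Cc_infinity :: "'a::euclidean_space set \<Rightarrow> ('a \<Rightarrow> real) set" where
  "Cc_infinity \<Omega> = {f. (\<forall>k. Ck k f) \<and>
     compact (closure {x. f x \<noteq> 0}) \<and> closure {x. f x \<noteq> 0} \<subseteq> \<Omega>}"

definition frac_WL0 :: "real \<Rightarrow> (real \<Rightarrow> real) \<Rightarrow> 'a::euclidean_space set \<Rightarrow> ('a \<Rightarrow> real) set" where
  "frac_WL0 s G \<Omega> = frac_WL_weak_star s G \<Omega> closure_of Cc_infinity \<Omega>"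

definition energy_F :: "real \<Rightarrow> (real \<Rightarrow> real) \<Rightarrow> ('a::euclidean_space \<Rightarrow> real) \<Rightarrow> ennreal" where
  "energy_F s G u = (\<integral>\<^sup>+z. ennreal (G \<bar>frac_D s u z\<bar>) \<partial>frac_mu)"

definition energy_J :: "(real \<Rightarrow> real) \<Rightarrow> 'a::euclidean_space set \<Rightarrow> ('a \<Rightarrow> real) \<Rightarrow> ennreal" where
  "energy_J G \<Omega> u = (\<integral>\<^sup>+x. ennreal (G \<bar>u x\<bar>) \<partial>lebesgue_on \<Omega>)"

section \<open>Lipschitz domains\<close>

text \<open>
  Near each boundary point p the set is the strict epigraph of a Lipschitz function. The direction
  of the last coordinate after a rotation is the unit vector e, and the remaining coordinates form
  the hyperplane orthogonal to e.
\<close>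

definition lipschitz_boundary :: "'a::euclidean_space set \<Rightarrow> bool" where
  "lipschitz_boundary \<Omega> \<longleftrightarrow>
     (\<forall>p\<in>frontier \<Omega>. \<exists>e r L \<gamma>. norm e = 1 \<and> r > 0 \<and> lipschitz_on L {y. y \<bullet> e = 0} \<gamma> \<and>
        (\<forall>y\<in>ball p r. y \<in> \<Omega> \<longleftrightarrow> y \<bullet> e > \<gamma> (y - (y \<bullet> e) *\<^sub>R e)))"

end

theory Submission
  imports Defs
begin

text \<open>
  Write \<open>F\<close> and \<open>J\<close> for the energy and the constraint functional, \<open>L v\<close> and \<open>p v\<close> for the two
  integrals of the Euler--Lagrange equation, tested with \<open>v\<close>.

  The constraint \<open>J = \<alpha>\<close> can be linearised at no cost. Since \<open>G\<close> is convex and \<open>p\<close> is integration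
  against a subgradient, \<open>J w \<ge> \<alpha> + p (w - u)\<close>; and a function \<open>w\<close> with \<open>J w \<ge> \<alpha>\<close> can be shrunk to
  the level \<open>\<alpha>\<close>, which does not raise \<open>F\<close>. So \<open>u\<close> minimizes the convex functional \<open>F\<close> on the half-space
  \<open>p w \<ge> p u\<close> (\<open>minimal_on_halfspace\<close>). For \<open>p\<close> to be finite, functions of finite energy must have all
  their multiples in the Orlicz class on the domain; this is elementary, because short distances
  in the difference quotient amplify the function by any given factor
  (\<open>frac_energy_imp_all_moments\<close>).

  Along segments from \<open>u\<close> to functions of finite energy, \<open>F\<close> has a one-sided derivative by
  Fatou's lemma (\<open>variation_nonneg\<close>). The jumps of \<open>g\<close> do not disturb it: the difference quotient of
  a function takes each nonzero value only on a null set, as an identity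
  \<open>u x - u y = t |x - y|\<^sup>s\<close> that holds for two values of \<open>y\<close> confines \<open>x\<close> to a null set
  (\<open>lebesgue_frac_D_level_null\<close>).

  Without a doubling condition, \<open>(1 + \<epsilon>) u\<close> may have infinite energy, and variations can be taken in
  both directions only along functions all of whose multiples have finite energy. On these,
  minimality yields \<open>L = \<kappa> p\<close> with some \<open>\<kappa> > 0\<close>, but for \<open>u\<close> itself only \<open>L u \<le> \<kappa> p u\<close>. Equality
  follows if such functions approach \<open>u\<close> with convergence of their energies and of \<open>p\<close>. This is
  where the boundary matters: near a Lipschitz boundary the domain can be deformed by a map \<open>\<Phi>\<close> that is
  nearly an isometry and pulls supports inward (\<open>exists_inward_deformation\<close>). The average of \<open>u\<close>
  over a small ball about \<open>\<Phi> x\<close> is a Lipschitz function of \<open>x\<close> with compact support in the domain, and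
  Jensen's inequality with the substitution by \<open>\<Phi>\<close> shows that its energy is at most slightly larger
  than that of \<open>u\<close> (\<open>avg_energy\<close>). As \<open>F f \<ge> F u + L (f - u)\<close>, upper bounds for energies and convergence
  of \<open>p\<close> are enough for \<open>L u = \<kappa> p u\<close> (\<open>L_nice_eq_L_u\<close>). A general direction is reached by adding a small
  multiple of it to a Lipschitz function with the right value of \<open>p\<close> (\<open>euler_lagrange\<close>).

  The averages are competitors because Lipschitz functions with compact support in the domain
  belong to the weak* closure of the smooth ones, by mollification (\<open>lipschitz_frac_WL0\<close>);
  conversely, members of the closure vanish outside the domain (\<open>frac_WL0_zero_outside\<close>), which
  gives the averages their compact support.
\<close>

section \<open>Young functions\<close>

text \<open>
  The properties that a Young function shares with its complementary function and on which the
  linear structure of Orlicz spaces rests.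
\<close>

definition gauge_fun :: "(real \<Rightarrow> real) \<Rightarrow> bool" where
  "gauge_fun \<Phi> \<longleftrightarrow> \<Phi> 0 = 0 \<and> mono_on {0..} \<Phi> \<and> convex_on {0..} \<Phi>"

lemma gauge_zero: "gauge_fun \<Phi> \<Longrightarrow> \<Phi> 0 = 0"
  by (simp add: gauge_fun_def)

lemma gauge_mono: "gauge_fun \<Phi> \<Longrightarrow> 0 \<le> a \<Longrightarrow> a \<le> b \<Longrightarrow> \<Phi> a \<le> \<Phi> b"
  by (auto simp: gauge_fun_def mono_on_def)

lemma gauge_nonneg: "gauge_fun \<Phi> \<Longrightarrow> 0 \<le> a \<Longrightarrow> 0 \<le> \<Phi> a"
  using gauge_mono[of \<Phi> 0 a] by (simp add: gauge_zero)

lemma gauge_convex: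
  assumes "gauge_fun \<Phi>" "0 \<le> a" "0 \<le> b" "0 \<le> t" "t \<le> 1"
  shows "\<Phi> ((1 - t) * a + t * b) \<le> (1 - t) * \<Phi> a + t * \<Phi> b"
  using assms convex_onD[of "{0..}" \<Phi> t a b] by (auto simp: gauge_fun_def)

lemma gauge_abs_convex:
  assumes "gauge_fun \<Phi>" "0 \<le> t" "t \<le> 1"
  shows "\<Phi> \<bar>(1 - t) * a + t * b\<bar> \<le> (1 - t) * \<Phi> \<bar>a\<bar> + t * \<Phi> \<bar>b\<bar>"
proof -
  have "\<bar>(1 - t) * a + t * b\<bar> \<le> (1 - t) * \<bar>a\<bar> + t * \<bar>b\<bar>"
    using assms by (metis abs_mult abs_of_nonneg abs_triangle_ineq diff_ge_0_iff_ge)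
  from gauge_mono[OF assms(1) _ this] gauge_convex[OF assms(1), of "\<bar>a\<bar>" "\<bar>b\<bar>" t] assms
  show ?thesis by simp
qed

lemma gauge_scale:
  assumes "gauge_fun \<Phi>" "0 \<le> a" "0 \<le> t" "t \<le> 1"
  shows "\<Phi> (t * a) \<le> t * \<Phi> a"
  using gauge_convex[OF assms(1), of 0 a t] assms by (simp add: gauge_zero)

lemma gauge_add:
  assumes "gauge_fun \<Phi>"
  shows "\<Phi> \<bar>a + b\<bar> \<le> \<Phi> \<bar>2 * a\<bar> + \<Phi> \<bar>2 * b\<bar>"
proof -
  have "\<Phi> \<bar>a + b\<bar> \<le> 1/2 * \<Phi> \<bar>2 * a\<bar> + 1/2 * \<Phi> \<bar>2 * b\<bar>"
    using gauge_abs_convex[OF assms, of "1/2" "2 * a" "2 * b"] by simp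
  moreover have "\<Phi> \<bar>2 * a\<bar> \<ge> 0" "\<Phi> \<bar>2 * b\<bar> \<ge> 0"
    using gauge_nonneg[OF assms] by auto
  ultimately show ?thesis by linarith
qed

lemma mono_on_abs_borel:
  fixes \<Phi> :: "real \<Rightarrow> real"
  assumes "mono_on {0..} \<Phi>"
  shows "(\<lambda>x. \<Phi> \<bar>x\<bar>) \<in> borel_measurable borel"
proof -
  have "mono (\<lambda>x. \<Phi> (max 0 x))"
    using assms by (auto simp: mono_def mono_on_def)
  then have [measurable]: "(\<lambda>x. \<Phi> (max 0 x)) \<in> borel_measurable borel"
    by (rule borel_measurable_mono)
  have "(\<lambda>x. \<Phi> (max 0 \<bar>x\<bar>)) \<in> borel_measurable borel" by measurable
  then show ?thesis by simp
qed

lemma gauge_measurable: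
  assumes "gauge_fun \<Phi>" "f \<in> borel_measurable M"
  shows "(\<lambda>x. \<Phi> \<bar>f x\<bar>) \<in> borel_measurable M"
  using measurable_compose[OF assms(2) mono_on_abs_borel[of \<Phi>]] assms(1)
  by (simp add: gauge_fun_def)

text \<open>
  The odd extension of \<open>g\<close>: the derivative of \<open>G |a|\<close> where \<open>g\<close> is continuous at \<open>|a|\<close>, and a
  subgradient at every \<open>a\<close>.
\<close>

definition young_deriv :: "(real \<Rightarrow> real) \<Rightarrow> real \<Rightarrow> real" where
  "young_deriv g a = g \<bar>a\<bar> * (a / \<bar>a\<bar>)"

locale young =
  fixes G g :: "real \<Rightarrow> real"
  assumes young: "young_function G g"
begin

lemma g_zero: "g 0 = 0" and g_pos: "t > 0 \<Longrightarrow> g t > 0"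
  using young by (auto simp: young_function_def)

lemma g_nonneg: "t \<ge> 0 \<Longrightarrow> g t \<ge> 0"
  using g_pos[of t] g_zero by (cases "t = 0") auto

lemma g_mono: "0 \<le> a \<Longrightarrow> a \<le> b \<Longrightarrow> g a \<le> g b"
  using young g_nonneg[of b] g_zero
  by (cases "a = 0") (auto simp: young_function_def mono_on_def)

lemma G_integral: "t \<ge> 0 \<Longrightarrow> (g has_integral G t) {0..t}"
  using young by (auto simp: young_function_def)

lemma G_zero: "G 0 = 0"
  using G_integral[of 0] has_integral_unique[OF has_integral_refl(2)[of g 0]] by simp

lemma G_diff:
  assumes "0 \<le> a" "a \<le> b"
  shows "(g has_integral (G b - G a)) {a..b}"
proof -
  have "g integrable_on {a..b}"
    using G_integral[of b] assms by (meson has_integral_integrable integrable_on_subinterval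
        atLeastatMost_subset_iff order_refl order_trans)
  then obtain I where I: "(g has_integral I) {a..b}" by blast
  from has_integral_combine[OF assms G_integral[OF assms(1)] I] G_integral[of b] assms
  have "G b = G a + I" by (meson has_integral_unique order_trans)
  with I show ?thesis by simp
qed

text \<open>
  On the interval between \<open>a\<close> and \<open>b\<close> the nondecreasing \<open>g\<close> lies on one side of the constant
  \<open>g a\<close>.
\<close>

lemma G_subgrad:
  assumes "a \<ge> 0" "b \<ge> 0"
  shows "G b \<ge> G a + g a * (b - a)"
proof (cases "a \<le> b")
  case True
  have "((\<lambda>_. g a) has_integral (b - a) *\<^sub>R g a) {a..b}"
    using has_integral_const_real[of "g a" a b] True by simp
  from has_integral_le[OF this G_diff[OF assms(1) True]] g_mono assms True
  show ?thesis by (auto simp: algebra_simps)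
next
  case False
  have "((\<lambda>_. g a) has_integral (a - b) *\<^sub>R g a) {b..a}"
    using has_integral_const_real[of "g a" b a] False by simp
  from has_integral_le[OF G_diff[OF assms(2)] this] g_mono assms False
  show ?thesis by (auto simp: algebra_simps)
qed

lemma G_mono: "0 \<le> a \<Longrightarrow> a \<le> b \<Longrightarrow> G a \<le> G b"
  using G_subgrad[of a b] g_nonneg[of a] by (smt (verit) mult_nonneg_nonneg)

lemma gauge_G: "gauge_fun G"
proof -
  have "convex_on {0..} G"
  proof (rule convex_onI)
    fix t a b :: real assume t: "0 < t" "t < 1" and ab: "a \<in> {0..}" "b \<in> {0..}"
    define c where "c = (1 - t) * a + t * b"
    have c: "c \<ge> 0" using t ab by (simp add: c_def)
    have "(1 - t) * G a \<ge> (1 - t) * (G c + g c * (a - c))"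
         "t * G b \<ge> t * (G c + g c * (b - c))"
      using t ab G_subgrad[OF c] by (auto intro!: mult_left_mono)
    moreover have "(1 - t) * (G c + g c * (a - c)) + t * (G c + g c * (b - c)) = G c"
      by (simp add: c_def algebra_simps)
    ultimately show "G ((1 - t) *\<^sub>R a + t *\<^sub>R b) \<le> (1 - t) * G a + t * G b"
      by (simp add: c_def)
  qed auto
  then show ?thesis
    using G_zero G_mono by (auto simp: gauge_fun_def mono_on_def)
qed

lemmas G_nonneg = gauge_nonneg[OF gauge_G]

lemma young_deriv_mult_self: "young_deriv g a * a = g \<bar>a\<bar> * \<bar>a\<bar>"
  by (cases "a \<ge> 0") (auto simp: young_deriv_def)

lemma abs_young_deriv: "\<bar>young_deriv g a\<bar> = g \<bar>a\<bar>"
  using g_nonneg[of "\<bar>a\<bar>"] g_zero by (cases "a = 0") (auto simp: young_deriv_def abs_mult)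

lemma G_abs_subgrad: "G \<bar>b\<bar> \<ge> G \<bar>a\<bar> + young_deriv g a * (b - a)"
proof -
  have "young_deriv g a * b \<le> g \<bar>a\<bar> * \<bar>b\<bar>"
    using abs_young_deriv[of a] by (metis abs_ge_self abs_mult)
  then have "young_deriv g a * (b - a) \<le> g \<bar>a\<bar> * (\<bar>b\<bar> - \<bar>a\<bar>)"
    using young_deriv_mult_self[of a] by (simp add: algebra_simps)
  with G_subgrad[of "\<bar>a\<bar>" "\<bar>b\<bar>"] show ?thesis by simp
qed

lemma g_self_le: "t \<ge> 0 \<Longrightarrow> g t * t \<le> G (2 * t)"
  using G_subgrad[of t "2 * t"] G_nonneg[of t] by simp

text \<open>
  Young's inequality without the complementary function: for \<open>b \<le> \<theta> a\<close> the first term bounds the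
  product; otherwise \<open>a < b / \<theta>\<close>, and monotonicity of \<open>g\<close> leads to a value of \<open>G\<close>. The free \<open>\<theta>\<close>
  allows the first term to be absorbed.
\<close>

lemma g_young:
  assumes "a \<ge> 0" "b \<ge> 0" "\<theta> > 0"
  shows "g a * b \<le> \<theta> * (g a * a) + \<theta> * G (2 / \<theta> * b)"
proof (cases "b \<le> \<theta> * a")
  case True
  then have "g a * b \<le> g a * (\<theta> * a)" using assms g_nonneg by (intro mult_left_mono) auto
  moreover have "G (2 / \<theta> * b) \<ge> 0" using assms by (intro G_nonneg) auto
  ultimately show ?thesis using assms by (simp add: mult.left_commute add_increasing2)
next
  case False
  then have "g a \<le> g (b / \<theta>)" using assms by (intro g_mono) (auto simp: field_simps)
  then have "g a * b \<le> g (b / \<theta>) * b" using assms by (intro mult_right_mono)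
  also have "\<dots> = \<theta> * (g (b / \<theta>) * (b / \<theta>))" using assms by simp
  also have "\<dots> \<le> \<theta> * G (2 * (b / \<theta>))"
    using assms by (intro mult_left_mono g_self_le) auto
  finally have *: "g a * b \<le> \<theta> * G (2 / \<theta> * b)" by simp
  have "0 \<le> \<theta> * (g a * a)" using assms g_nonneg by simp
  with * show ?thesis by linarith
qed

lemma young_deriv_young:
  assumes "\<theta> > 0"
  shows "\<bar>young_deriv g a * b\<bar> \<le> \<theta> * (g \<bar>a\<bar> * \<bar>a\<bar>) + \<theta> * G (2 / \<theta> * \<bar>b\<bar>)"
  using g_young[of "\<bar>a\<bar>" "\<bar>b\<bar>" \<theta>] assms by (simp add: abs_mult abs_young_deriv)

lemma G_pos: "t > 0 \<Longrightarrow> G t > 0"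
  using G_subgrad[of "t/2" t] g_pos[of "t/2"] G_nonneg[of "t/2"]
  by (smt (verit) field_sum_of_halves mult_pos_pos zero_less_divide_iff)

lemma G_linear_lower: "t \<ge> 0 \<Longrightarrow> t \<le> G t / g 1 + 1"
  using G_subgrad[of 1 t] G_nonneg[of 1] g_pos[of 1] by (simp add: field_simps)

lemma young_deriv_borel [measurable]: "young_deriv g \<in> borel_measurable borel"
proof -
  have [measurable]: "(\<lambda>x. g \<bar>x\<bar>) \<in> borel_measurable borel"
    using g_mono by (intro mono_on_abs_borel) (auto simp: mono_on_def)
  show ?thesis unfolding young_deriv_def by measurable
qed

lemma G_abs_borel [measurable]: "(\<lambda>x. G \<bar>x\<bar>) \<in> borel_measurable borel"
  using gauge_measurable[OF gauge_G, of "\<lambda>x. x"] by simp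

lemma countable_jumps: "countable {a. 0 < a \<and> \<not> isCont g a}"
proof -
  have "{a. 0 < a \<and> \<not> isCont g a} = {a\<in>{0<..}. \<not> continuous (at a within {0<..}) g}"
    by (auto simp: at_within_open[OF _ open_greaterThan])
  also have "countable \<dots>"
    using young by (intro mono_on_ctble_discont) (auto simp: young_function_def)
  finally show ?thesis .
qed

lemma isCont_g_zero: "(g \<longlongrightarrow> 0) (at_right 0)"
  using young g_zero by (auto simp: young_function_def continuous_within)

lemma G_abs_quotient:
  assumes e: "e > 0" 
  shows "(G \<bar>a + e * b\<bar> - G \<bar>a\<bar>) / e \<ge> young_deriv g a * b"
    and "(G \<bar>a + e * b\<bar> - G \<bar>a\<bar>) / e \<le> young_deriv g (a + e * b) * b"
proof -
  show "(G \<bar>a + e * b\<bar> - G \<bar>a\<bar>) / e \<ge> young_deriv g a * b"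
    using G_abs_subgrad[of a "a + e * b"] e by (simp add: field_simps)
  show "(G \<bar>a + e * b\<bar> - G \<bar>a\<bar>) / e \<le> young_deriv g (a + e * b) * b"
    using G_abs_subgrad[of "a + e * b" a] e by (simp add: field_simps)
qed

text \<open>
  At 0 this is the right continuity of \<open>g\<close> together with \<open>g 0 = 0\<close>.
\<close>

lemma young_deriv_isCont:
  assumes "a = 0 \<or> isCont g \<bar>a\<bar>"
  shows "isCont (young_deriv g) a"
proof (cases "a = 0")
  case True
  have "((\<lambda>x. g \<bar>x\<bar>) \<longlongrightarrow> 0) (at 0)"
  proof (rule filterlim_compose[OF isCont_g_zero])
    show "filterlim (\<lambda>x. \<bar>x::real\<bar>) (at_right 0) (at 0)"
      by (auto simp: filterlim_at eventually_at_filter intro!: tendsto_eq_intros)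
  qed
  then have "((\<lambda>x. young_deriv g x) \<longlongrightarrow> 0) (at 0)"
    by (rule Lim_null_comparison[rotated]) (simp add: abs_young_deriv)
  moreover have "young_deriv g 0 = 0" by (simp add: young_deriv_def)
  ultimately show ?thesis using True by (simp add: isCont_def)
next
  case False
  then have c: "isCont g \<bar>a\<bar>" using assms by simp
  have "isCont (\<lambda>x. g \<bar>x\<bar>) a"
    by (rule isCont_o2[where g = g]) (use c in \<open>auto intro: continuous_intros\<close>)
  then show ?thesis unfolding young_deriv_def using False by (intro continuous_intros) auto
qed

text \<open>The supporting lines at both ends of the step squeeze the difference quotient.\<close>

lemma G_abs_deriv:
  assumes "a = 0 \<or> isCont g \<bar>a\<bar>" and e: "\<And>n. e n > 0" "e \<longlonglongrightarrow> 0"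
  shows "(\<lambda>n. (G \<bar>a + e n * b\<bar> - G \<bar>a\<bar>) / e n) \<longlonglongrightarrow> young_deriv g a * b"
proof (rule tendsto_sandwich[where f = "\<lambda>n. young_deriv g a * b" and h = "\<lambda>n. young_deriv g (a + e n * b) * b"])
  have "(\<lambda>n. a + e n * b) \<longlonglongrightarrow> a" using e by (auto intro!: tendsto_eq_intros)
  then have "(\<lambda>n. young_deriv g (a + e n * b)) \<longlonglongrightarrow> young_deriv g a"
    using isCont_tendsto_compose[OF young_deriv_isCont[OF assms(1)]] by blast
  then show "(\<lambda>n. young_deriv g (a + e n * b) * b) \<longlonglongrightarrow> young_deriv g a * b"
    by (intro tendsto_intros)
  show "(\<lambda>n. young_deriv g a * b) \<longlonglongrightarrow> young_deriv g a * b" by simp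
  show "\<forall>\<^sub>F n in sequentially. young_deriv g a * b \<le> (G \<bar>a + e n * b\<bar> - G \<bar>a\<bar>) / e n"
       "\<forall>\<^sub>F n in sequentially. (G \<bar>a + e n * b\<bar> - G \<bar>a\<bar>) / e n \<le> young_deriv g (a + e n * b) * b"
    using G_abs_quotient[OF e(1)] by (auto intro!: always_eventually)
qed

lemma G_abs_continuous: "continuous_on UNIV (\<lambda>x. G \<bar>x\<bar>)"
proof -
  have "isCont (\<lambda>x. G \<bar>x\<bar>) a" for a
  proof -
    have "((\<lambda>x. G \<bar>x\<bar> - G \<bar>a\<bar>) \<longlongrightarrow> 0) (at a)"
    proof (rule Lim_null_comparison)
      show "\<forall>\<^sub>F x in at a. norm (G \<bar>x\<bar> - G \<bar>a\<bar>) \<le> g (\<bar>a\<bar> + 1) * \<bar>x - a\<bar>"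
        unfolding eventually_at
      proof (intro exI[of _ 1] conjI ballI impI)
        fix x assume "x \<noteq> a \<and> dist x a < 1"
        then have x: "\<bar>x\<bar> \<le> \<bar>a\<bar> + 1" by (auto simp: dist_real_def)
        have 1: "\<bar>young_deriv g y * (x - a)\<bar> \<le> g (\<bar>a\<bar> + 1) * \<bar>x - a\<bar>" if "\<bar>y\<bar> \<le> \<bar>a\<bar> + 1" for y
          unfolding abs_mult abs_young_deriv using that by (intro mult_right_mono g_mono) auto
        have "0 \<le> g (\<bar>a\<bar> + 1)" by (rule g_nonneg) simp
        then show "norm (G \<bar>x\<bar> - G \<bar>a\<bar>) \<le> g (\<bar>a\<bar> + 1) * \<bar>x - a\<bar>"
          using G_abs_subgrad[of a x] G_abs_subgrad[of x a] 1[OF x] 1[of a]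
          by (simp add: abs_mult algebra_simps) (smt (verit))
      qed auto
      show "((\<lambda>x. g (\<bar>a\<bar> + 1) * \<bar>x - a\<bar>) \<longlongrightarrow> 0) (at a)" by (auto intro!: tendsto_eq_intros)
    qed
    then show ?thesis unfolding isCont_def by (rule LIM_zero_cancel)
  qed
  then show ?thesis by (simp add: continuous_on_eq_continuous_at)
qed

text \<open>
  Choose \<open>T\<close> with \<open>g T > t\<close>: the supporting line of \<open>G\<close> at \<open>T\<close> outgrows \<open>t w\<close>.
\<close>

lemma compl_bdd: "bdd_above ((\<lambda>w. t * w - G w) ` {0<..})"
proof -
  have "filterlim g at_top at_top" using young by (auto simp: young_function_def)
  then obtain T where T: "T > 0" "g T > t"
    unfolding filterlim_at_top_dense
    using eventually_happens'[OF trivial_limit_at_top_linorder eventually_conj[OF eventually_gt_at_top[of 0]]] by meson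
  have "t * w - G w \<le> g T * T" if "w > 0" for w
  proof -
    have "G w \<ge> G T + g T * (w - T)" using T that by (intro G_subgrad) auto
    moreover have "t * w \<le> g T * w" using T that by simp
    moreover have "G T \<ge> 0" using T by (intro G_nonneg) auto
    ultimately show ?thesis by (simp add: algebra_simps)
  qed
  then show ?thesis by (auto intro!: bdd_aboveI2)
qed

lemma young_ineq:
  assumes "w \<ge> 0" shows "t * w \<le> G w + compl_young G t"
proof (cases "w = 0")
  case False
  then have "t * w - G w \<le> compl_young G t"
    unfolding compl_young_def using assms by (intro cSUP_upper compl_bdd) auto
  then show ?thesis by simp
next
  case True
  \<comment> \<open>the supremum runs over positive arguments, so the value at 0 is obtained as a limit\<close>
  have "isCont (\<lambda>w. t * w - G \<bar>w\<bar>) 0"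
    using G_abs_continuous by (intro continuous_intros) (simp add: continuous_on_eq_continuous_at)
  then have "((\<lambda>w. t * w - G \<bar>w\<bar>) \<longlongrightarrow> t * 0 - G \<bar>0\<bar>) (at_right 0)"
    unfolding isCont_def by (rule tendsto_within_subset) simp
  moreover have "\<forall>\<^sub>F w in at_right 0. t * w - G \<bar>w\<bar> \<le> compl_young G t"
    unfolding eventually_at_right_field compl_young_def
    by (intro exI[of _ 1]) (auto intro!: cSUP_upper2[OF compl_bdd])
  ultimately have "t * 0 - G \<bar>0\<bar> \<le> compl_young G t"
    by (rule tendsto_upperbound) simp
  then show ?thesis using True by (simp add: G_zero)
qed

lemma gauge_compl: "gauge_fun (compl_young G)"
  unfolding gauge_fun_def
proof (intro conjI)
  have "compl_young G 0 \<le> 0" unfolding compl_young_def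
    by (rule cSUP_least) (auto intro!: G_nonneg)
  then show "compl_young G 0 = 0" using young_ineq[of 0 0] by (simp add: G_zero)
  show "mono_on {0..} (compl_young G)"
  proof (rule mono_onI)
    fix a b :: real assume "a \<le> b"
    then show "compl_young G a \<le> compl_young G b"
      unfolding compl_young_def by (intro cSUP_mono compl_bdd) (auto intro!: bexI mult_right_mono)
  qed
  show "convex_on {0..} (compl_young G)"
  proof (rule convex_onI)
    fix t a b :: real assume t: "0 < t" "t < 1"
    show "compl_young G ((1 - t) *\<^sub>R a + t *\<^sub>R b) \<le> (1 - t) * compl_young G a + t * compl_young G b"
      unfolding compl_young_def[of _ "(1 - t) *\<^sub>R a + t *\<^sub>R b"]
    proof (rule cSUP_least)
      fix w :: real assume w: "w \<in> {0<..}"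
      have "(1 - t) * (a * w) \<le> (1 - t) * (G w + compl_young G a)"
           "t * (b * w) \<le> t * (G w + compl_young G b)"
        using t w by (auto intro!: mult_left_mono young_ineq)
      then show "((1 - t) *\<^sub>R a + t *\<^sub>R b) * w - G w \<le> (1 - t) * compl_young G a + t * compl_young G b"
        by (simp add: algebra_simps)
    qed auto
  qed auto
qed

end

section \<open>Orlicz spaces\<close>

lemma integrable_nonneg_iff:
  fixes f :: "'a \<Rightarrow> real"
  assumes "f \<in> borel_measurable M" "\<And>x. 0 \<le> f x"
  shows "integrable M f \<longleftrightarrow> (\<integral>\<^sup>+x. ennreal (f x) \<partial>M) < \<infinity>"
  using assms by (simp add: integrable_iff_bounded)

text \<open>The linear hull of the Orlicz class, described by a single scaled function.\<close>

definition orlicz_scaled :: "(real \<Rightarrow> real) \<Rightarrow> 'a measure \<Rightarrow> ('a \<Rightarrow> real) \<Rightarrow> bool" where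
  "orlicz_scaled \<Phi> M u \<longleftrightarrow> u \<in> borel_measurable M \<and> (\<exists>l>0. integrable M (\<lambda>x. \<Phi> \<bar>u x / l\<bar>))"

text \<open>
  The scale \<open>c\<close> is so large that twice each summand, divided by \<open>c\<close>, is below the given scaled
  function; convexity handles the sum.
\<close>

lemma orlicz_scaled_lincomb:
  assumes "gauge_fun \<Phi>" "orlicz_scaled \<Phi> M u" "orlicz_scaled \<Phi> M v"
  shows "orlicz_scaled \<Phi> M (\<lambda>x. a * u x + b * v x)"
proof -
  obtain l where l: "l > 0" "u \<in> borel_measurable M" "integrable M (\<lambda>x. \<Phi> \<bar>u x / l\<bar>)"
    using assms(2) by (auto simp: orlicz_scaled_def)
  obtain m where m: "m > 0" "v \<in> borel_measurable M" "integrable M (\<lambda>x. \<Phi> \<bar>v x / m\<bar>)"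
    using assms(3) by (auto simp: orlicz_scaled_def)
  have [measurable]: "u \<in> borel_measurable M" "v \<in> borel_measurable M" by fact+
  define c where "c = 2 * (\<bar>a\<bar> * l + \<bar>b\<bar> * m + 1)"
  have c: "c > 0" "2 * \<bar>a\<bar> * l \<le> c" "2 * \<bar>b\<bar> * m \<le> c" using l m by (auto simp: c_def intro!: add_nonneg_pos add_nonneg_nonneg)
  have "\<Phi> \<bar>(a * u x + b * v x) / c\<bar> \<le> \<Phi> \<bar>u x / l\<bar> + \<Phi> \<bar>v x / m\<bar>" for x
  proof -
    have "\<Phi> \<bar>(a * u x + b * v x) / c\<bar> \<le> \<Phi> \<bar>2 * (a * u x / c)\<bar> + \<Phi> \<bar>2 * (b * v x / c)\<bar>"
      using gauge_add[OF assms(1), of "a * u x / c" "b * v x / c"] by (simp add: add_divide_distrib)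
    also have "\<dots> \<le> \<Phi> \<bar>u x / l\<bar> + \<Phi> \<bar>v x / m\<bar>"
    proof (intro add_mono gauge_mono[OF assms(1)])
      have "(2 * \<bar>a\<bar> * l) * \<bar>u x\<bar> \<le> c * \<bar>u x\<bar>" "(2 * \<bar>b\<bar> * m) * \<bar>v x\<bar> \<le> c * \<bar>v x\<bar>" 
        using c by (auto intro!: mult_right_mono)
      then show "\<bar>2 * (a * u x / c)\<bar> \<le> \<bar>u x / l\<bar>" "\<bar>2 * (b * v x / c)\<bar> \<le> \<bar>v x / m\<bar>"
        using l m c by (auto simp: abs_mult field_simps)
    qed auto
    finally show ?thesis .
  qed
  then have "integrable M (\<lambda>x. \<Phi> \<bar>(a * u x + b * v x) / c\<bar>)"
    by (intro Bochner_Integration.integrable_bound[OF Bochner_Integration.integrable_add[OF l(3) m(3)]] gauge_measurable[OF assms(1)])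
       (auto simp: gauge_nonneg[OF assms(1)])
  then show ?thesis using c by (auto simp: orlicz_scaled_def)
qed

lemma orlicz_L_scaled:
  assumes "gauge_fun \<Phi>" "u \<in> orlicz_L \<Phi> M"
  obtains l where "l > 0" "u \<in> borel_measurable M" "integrable M (\<lambda>x. \<Phi> \<bar>u x / l\<bar>)"
proof -
  have K: "orlicz_scaled \<Phi> M f" if "f \<in> orlicz_K \<Phi> M" for f
  proof -
    have f: "f \<in> borel_measurable M" "(\<integral>\<^sup>+x. ennreal (\<Phi> \<bar>f x\<bar>) \<partial>M) < \<infinity>"
      using that by (auto simp: orlicz_K_def)
    then have "integrable M (\<lambda>x. \<Phi> \<bar>f x\<bar>)"
      using assms(1) by (subst integrable_nonneg_iff) (auto intro: gauge_measurable gauge_nonneg)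
    then show ?thesis using f by (auto simp: orlicz_scaled_def intro!: exI[of _ 1])
  qed
  from assms(2) obtain F c where F: "finite F" "F \<subseteq> orlicz_K \<Phi> M"
    and u: "\<And>x. x \<in> space M \<Longrightarrow> u x = (\<Sum>f\<in>F. c f * f x)"
    by (auto simp: orlicz_L_def)
  have "orlicz_scaled \<Phi> M (\<lambda>x. \<Sum>f\<in>F. c f * f x)"
    using F
  proof (induction F rule: finite_induct)
    case empty
    then show ?case by (auto simp: orlicz_scaled_def gauge_zero[OF assms(1)] gt_ex)
  next
    case (insert f F)
    have "orlicz_scaled \<Phi> M (\<lambda>x. c f * f x + 1 * (\<Sum>f\<in>F. c f * f x))"
      using insert by (intro orlicz_scaled_lincomb[OF assms(1) K]) auto
    then show ?case using insert by simp
  qed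
  moreover have "integrable M (\<lambda>x. \<Phi> \<bar>(\<Sum>f\<in>F. c f * f x) / l\<bar>) \<longleftrightarrow> integrable M (\<lambda>x. \<Phi> \<bar>u x / l\<bar>)" for l
    by (rule Bochner_Integration.integrable_cong) (auto simp: u)
  moreover have "u \<in> borel_measurable M \<longleftrightarrow> (\<lambda>x. \<Sum>f\<in>F. c f * f x) \<in> borel_measurable M"
    by (rule measurable_cong) (simp add: u)
  ultimately show thesis using that by (auto simp: orlicz_scaled_def)
qed

lemma orlicz_LI:
  assumes "gauge_fun \<Phi>" "u \<in> borel_measurable M" "l > 0" "integrable M (\<lambda>x. \<Phi> \<bar>u x / l\<bar>)"
  shows "u \<in> orlicz_L \<Phi> M"
proof -
  have "(\<integral>\<^sup>+x. ennreal (\<Phi> \<bar>u x / l\<bar>) \<partial>M) < \<infinity>"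
    using assms(4) by (subst integrable_nonneg_iff[symmetric])
      (auto simp: gauge_nonneg[OF assms(1)])
  then have "(\<lambda>x. u x / l) \<in> orlicz_K \<Phi> M"
    using assms by (auto simp: orlicz_K_def)
  then show ?thesis
    unfolding orlicz_L_def using assms(3)
    by (auto intro!: exI[of _ "{\<lambda>x. u x / l}"] exI[of _ "\<lambda>_. l"])
qed

lemma orlicz_L_measurable:
  assumes "gauge_fun \<Phi>" "u \<in> orlicz_L \<Phi> M"
  shows "u \<in> borel_measurable M"
  using orlicz_L_scaled[OF assms] by blast

lemma orlicz_L_linear:
  assumes "gauge_fun \<Phi>" "u \<in> orlicz_L \<Phi> M" "v \<in> orlicz_L \<Phi> M"
  shows "(\<lambda>x. a * u x + b * v x) \<in> orlicz_L \<Phi> M"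
proof -
  have scaled: "orlicz_scaled \<Phi> M w" if "w \<in> orlicz_L \<Phi> M" for w
    by (rule orlicz_L_scaled[OF assms(1) that]) (auto simp: orlicz_scaled_def)
  obtain l where "l > 0" "(\<lambda>x. a * u x + b * v x) \<in> borel_measurable M"
      "integrable M (\<lambda>x. \<Phi> \<bar>(a * u x + b * v x) / l\<bar>)"
    using orlicz_scaled_lincomb[OF assms(1) scaled scaled, OF assms(2,3), of a b] by (auto simp: orlicz_scaled_def)
  then show ?thesis by (intro orlicz_LI[OF assms(1)])
qed

text \<open>Such a function approximates itself, with Luxemburg norm 0 of the difference.\<close>

lemma bounded_fin_supp_orlicz_E:
  assumes "gauge_fun \<Phi>" "w \<in> bounded_fin_supp M"
  shows "w \<in> orlicz_E \<Phi> M"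
proof -
  from assms(2) obtain B where w[measurable]: "w \<in> borel_measurable M" and B: "\<And>x. x \<in> space M \<Longrightarrow> \<bar>w x\<bar> \<le> B"
    and fin: "emeasure M {x \<in> space M. w x \<noteq> 0} < \<infinity>"
    by (auto simp: bounded_fin_supp_def)
  have "integrable M (\<lambda>x. indicator {x \<in> space M. w x \<noteq> 0} x * \<Phi> \<bar>B\<bar>)"
    using fin by (intro integrable_mult_left integrable_real_indicator) auto
  then have "integrable M (\<lambda>x. \<Phi> \<bar>w x / 1\<bar>)"
  proof (rule Bochner_Integration.integrable_bound)
    show "(\<lambda>x. \<Phi> \<bar>w x / 1\<bar>) \<in> borel_measurable M"
      by (intro gauge_measurable[OF assms(1)]) auto
    show "AE x in M. norm (\<Phi> \<bar>w x / 1\<bar>) \<le> norm (indicator {x \<in> space M. w x \<noteq> 0} x * \<Phi> \<bar>B\<bar>)"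
    proof (rule AE_I2)
      fix x assume x: "x \<in> space M"
      then have "\<Phi> \<bar>w x\<bar> \<le> \<Phi> \<bar>B\<bar>" using B[OF x] by (intro gauge_mono[OF assms(1)]) auto
      then show "norm (\<Phi> \<bar>w x / 1\<bar>) \<le> norm (indicator {x \<in> space M. w x \<noteq> 0} x * \<Phi> \<bar>B\<bar>)"
        using gauge_nonneg[OF assms(1)] gauge_zero[OF assms(1)] x by (auto simp: indicator_def)
    qed
  qed
  then have "w \<in> orlicz_L \<Phi> M" by (intro orlicz_LI[OF assms(1), of _ _ 1]) auto
  moreover have "luxemburg_norm \<Phi> M (\<lambda>x. w x - w x) = 0"
  proof -
    have "{l. l > 0 \<and> (\<integral>\<^sup>+x. ennreal (\<Phi> (\<bar>w x - w x\<bar> / l)) \<partial>M) \<le> 1} = {0<..}"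
      by (auto simp: gauge_zero[OF assms(1)])
    then show ?thesis by (simp add: luxemburg_norm_def)
  qed
  ultimately show ?thesis using assms(2) unfolding orlicz_E_def by force
qed

lemma (in young) integrable_mult_orlicz:
  assumes "u \<in> orlicz_L G M" "a \<in> orlicz_L (compl_young G) M"
  shows "integrable M (\<lambda>x. u x * a x)"
proof -
  obtain l where l: "l > 0" "u \<in> borel_measurable M" "integrable M (\<lambda>x. G \<bar>u x / l\<bar>)"
    using orlicz_L_scaled[OF gauge_G assms(1)] .
  obtain m where m: "m > 0" "a \<in> borel_measurable M" "integrable M (\<lambda>x. compl_young G \<bar>a x / m\<bar>)"
    using orlicz_L_scaled[OF gauge_compl assms(2)] .
  have [measurable]: "u \<in> borel_measurable M" "a \<in> borel_measurable M" by fact+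
  have "integrable M (\<lambda>x. (u x / l) * (a x / m))"
  proof (rule Bochner_Integration.integrable_bound[OF Bochner_Integration.integrable_add[OF l(3) m(3)]])
    show "AE x in M. norm (u x / l * (a x / m)) \<le> norm (G \<bar>u x / l\<bar> + compl_young G \<bar>a x / m\<bar>)"
    proof (rule AE_I2)
      fix x
      have "\<bar>a x / m\<bar> * \<bar>u x / l\<bar> \<le> G \<bar>u x / l\<bar> + compl_young G \<bar>a x / m\<bar>"
        by (rule young_ineq) simp
      then show "norm (u x / l * (a x / m)) \<le> norm (G \<bar>u x / l\<bar> + compl_young G \<bar>a x / m\<bar>)"
        by (simp only: abs_mult real_norm_def mult.commute[of "\<bar>u x / l\<bar>"])
    qed
  qed auto
  then have "integrable M (\<lambda>x. (l * m) * ((u x / l) * (a x / m)))" by (rule integrable_mult_right)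
  then show ?thesis using l m by simp
qed

section \<open>The measure of the Gagliardo seminorm\<close>

lemma borel_imp_lebesgue: "f \<in> borel_measurable borel \<Longrightarrow> f \<in> borel_measurable lebesgue"
  by (simp add: measurable_completion)

lemma frac_kernel_measurable [measurable]:
  "(\<lambda>(x, y). ennreal (1 / norm (x - y) ^ DIM('a::euclidean_space))) \<in> borel_measurable (borel :: ('a \<times> 'a) measure)"
  unfolding borel_prod[symmetric] by measurable

lemma sets_frac_mu [simp, measurable_cong]: "sets (frac_mu :: ('a::euclidean_space \<times> 'a) measure) = sets lebesgue"
  and space_frac_mu [simp]: "space (frac_mu :: ('a::euclidean_space \<times> 'a) measure) = UNIV"
  by (simp_all add: frac_mu_def)

text \<open>
  Borel measurability allows the completion to be dropped, so that Tonelli's theorem applies.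
  Functions that are only Lebesgue measurable are first replaced by a Borel representative.
\<close>

lemma nn_integral_frac_mu:
  fixes f :: "'a::euclidean_space \<times> 'a \<Rightarrow> ennreal"
  assumes f[measurable]: "f \<in> borel_measurable borel"
  shows "(\<integral>\<^sup>+z. f z \<partial>frac_mu) = (\<integral>\<^sup>+x. \<integral>\<^sup>+y. ennreal (1 / norm (x - y) ^ DIM('a)) * f (x, y) \<partial>lborel \<partial>lborel)"
proof -
  define h where "h = (\<lambda>(x::'a, y). ennreal (1 / norm (x - y) ^ DIM('a)))"
  have [measurable]: "h \<in> borel_measurable borel" unfolding h_def by measurable
  have "(\<integral>\<^sup>+z. f z \<partial>frac_mu) = (\<integral>\<^sup>+z. h z * f z \<partial>lebesgue)"
    unfolding frac_mu_def h_def[symmetric] by (subst nn_integral_density) (auto intro: borel_imp_lebesgue)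
  also have "\<dots> = (\<integral>\<^sup>+z. h z * f z \<partial>(lborel \<Otimes>\<^sub>M lborel))"
    by (simp add: nn_integral_completion lborel_prod)
  also have "\<dots> = (\<integral>\<^sup>+x. \<integral>\<^sup>+y. h (x, y) * f (x, y) \<partial>lborel \<partial>lborel)"
    by (rule lborel.nn_integral_fst[symmetric]) (simp add: borel_prod[symmetric, THEN sym] lborel_prod)
  finally show ?thesis by (simp add: h_def)
qed

lemma AE_frac_muI:
  assumes "AE z in lebesgue. P z" shows "AE z in frac_mu. P z"
  unfolding frac_mu_def using assms by (subst AE_density) (auto intro: AE_mp borel_imp_lebesgue[OF frac_kernel_measurable])

lemma AE_pair_lebesgueI:
  assumes "AE x in lebesgue. P (x :: 'a::euclidean_space)"
  shows "AE z in lebesgue. P (fst z) \<and> P (snd (z :: 'a \<times> 'a))"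
proof -
  obtain N where N: "N \<in> null_sets lborel" "{x. \<not> P x} \<subseteq> N"
    using assms unfolding eventually_ae_filter by (auto simp: null_sets_completion_iff2)
  then have [measurable]: "N \<in> sets borel" and N0: "emeasure lborel N = 0" by auto
  have "emeasure (lborel \<Otimes>\<^sub>M lborel) (N \<times> UNIV) = 0" "emeasure (lborel \<Otimes>\<^sub>M lborel) (UNIV \<times> N) = 0"
    using N0 by (subst lborel.emeasure_pair_measure_Times; simp)+
  then have "N \<times> UNIV \<in> null_sets lborel" "UNIV \<times> N \<in> null_sets lborel"
    by (auto simp: lborel_prod[symmetric] null_sets_def)
  then have "N \<times> UNIV \<union> UNIV \<times> N \<in> null_sets lebesgue"
    by (auto intro!: null_sets_completionI)
  then show ?thesis by (rule AE_I') (use N in auto)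
qed

lemma frac_D_borel [measurable]:
  assumes [measurable]: "u \<in> borel_measurable borel"
  shows "frac_D s u \<in> borel_measurable (borel :: ('a::euclidean_space \<times> 'a) measure)"
  unfolding frac_D_def borel_prod[symmetric] by measurable

lemma frac_D_cong_AE:
  assumes "AE x in lebesgue. u x = v x"
  shows "AE z in frac_mu. frac_D s u z = frac_D s v z"
  by (rule AE_frac_muI, rule AE_mp[OF AE_pair_lebesgueI[OF assms]])
     (auto simp: frac_D_def)

lemma borel_representative:
  fixes u :: "'a::euclidean_space \<Rightarrow> real"
  assumes "u \<in> borel_measurable lebesgue"
  obtains v where "v \<in> borel_measurable borel" "AE x in lebesgue. u x = v x"
  using completion_ex_borel_measurable_real[OF assms] by (auto dest: AE_completion)

lemma frac_D_linear: "frac_D s (\<lambda>x. a * u x + b * v x) z = a * frac_D s u z + b * frac_D s v z"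
  by (cases z) (simp add: frac_D_def diff_divide_distrib add_divide_distrib algebra_simps)

lemma (in young) frac_WL_linear:
  assumes "u \<in> frac_WL s G \<Omega>" "v \<in> frac_WL s G \<Omega>"
  shows "(\<lambda>x. a * u x + b * v x) \<in> frac_WL s G \<Omega>"
proof -
  have "frac_D s (\<lambda>x. a * u x + b * v x) = (\<lambda>z. a * frac_D s u z + b * frac_D s v z)"
    by (rule ext) (rule frac_D_linear)
  then show ?thesis using assms by (auto simp: frac_WL_def intro!: orlicz_L_linear gauge_G)
qed

section \<open>Level sets of the difference quotient\<close>

lemma powr_increment_less:
  fixes a b d s :: real
  assumes "0 \<le> b" "b < a" "0 < d" "0 < s" "s < 1"
  shows "(a + d) powr s - a powr s < (b + d) powr s - b powr s"
proof -
  define f where "f = (\<lambda>x. (x + d) powr s - x powr s)"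
  have "f a < f b"
  proof (rule DERIV_neg_imp_decreasing_open[OF assms(2)])
    fix x assume x: "b < x" "x < a"
    then have x0: "x > 0" using assms by simp
    show "\<exists>y. (f has_real_derivative y) (at x) \<and> y < 0"
    proof (intro exI conjI)
      show "(f has_real_derivative (s * (x + d) powr (s - 1) - s * x powr (s - 1))) (at x)"
        unfolding f_def using x0 assms by (auto intro!: derivative_eq_intros)
      have "(x + d) powr (s - 1) < x powr (s - 1)"
        using x0 assms by (intro powr_less_mono2_neg) auto
      then show "s * (x + d) powr (s - 1) - s * x powr (s - 1) < 0" using assms by simp
    qed
  next
    show "continuous_on {b..a} f"
      unfolding f_def using assms by (intro continuous_intros continuous_on_powr') auto
  qed
  then show ?thesis by (simp add: f_def)
qed

text \<open>
  From \<open>c x\<close> to \<open>x\<close> the distance to the origin grows by \<open>d = (1 - c) |x|\<close>, and the distance to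
  \<open>-e\<close> grows by at most \<open>d\<close>, from a larger initial value. As \<open>t\<^sup>s\<close> is strictly concave, the power
  of the second distance grows less.
\<close>

lemma norm_powr_diff_star:
  fixes x e :: "'a::euclidean_space"
  assumes s: "0 < s" "s < 1" and c: "0 \<le> c" "c < 1" and le: "norm x \<le> norm (x + e)" and e: "e \<noteq> 0" and x: "x \<noteq> 0"
  shows "norm (x + e) powr s - norm x powr s < norm (c *\<^sub>R x + e) powr s - norm (c *\<^sub>R x) powr s"
proof -
  have "(norm x)\<^sup>2 \<le> (norm (x + e))\<^sup>2" using le by (intro power_mono) auto
  then have "0 \<le> 2 * (x \<bullet> e) + e \<bullet> e"
    by (simp add: power2_norm_eq_inner inner_add_left inner_add_right inner_commute)
  moreover have "e \<bullet> e > 0" using e by simp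
  ultimately have "0 < 2 * c * (x \<bullet> e) + e \<bullet> e"
  proof -
    assume h: "0 \<le> 2 * (x \<bullet> e) + e \<bullet> e" "e \<bullet> e > 0"
    have "0 \<le> c * (2 * (x \<bullet> e) + e \<bullet> e)" using h c by simp
    moreover have "c * (e \<bullet> e) < e \<bullet> e" using h c by simp
    ultimately show ?thesis by (simp add: algebra_simps)
  qed
  then have "(norm (c *\<^sub>R x))\<^sup>2 < (norm (c *\<^sub>R x + e))\<^sup>2"
    unfolding power2_norm_eq_inner by (simp add: inner_add_left inner_add_right inner_commute)
  then have lt: "norm (c *\<^sub>R x) < norm (c *\<^sub>R x + e)"
    by (rule power_less_imp_less_base) simp
  define d where "d = (1 - c) * norm x"
  have d: "d > 0" using x c by (simp add: d_def)
  have xe: "x + e = (c *\<^sub>R x + e) + (1 - c) *\<^sub>R x" by (simp add: algebra_simps)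
  have "norm ((c *\<^sub>R x + e) + (1 - c) *\<^sub>R x) \<le> norm (c *\<^sub>R x + e) + d"
    using c by (intro norm_triangle_mono) (auto simp: d_def)
  then have "norm (x + e) \<le> norm (c *\<^sub>R x + e) + d"
    by (metis xe)
  then have "norm (x + e) powr s \<le> (norm (c *\<^sub>R x + e) + d) powr s"
    using s by (intro powr_mono2) auto
  moreover have "norm (c *\<^sub>R x) + d = norm x" using c by (simp add: d_def algebra_simps)
  moreover have "(norm (c *\<^sub>R x + e) + d) powr s - norm (c *\<^sub>R x + e) powr s < (norm (c *\<^sub>R x) + d) powr s - norm (c *\<^sub>R x) powr s"
    using lt d s by (intro powr_increment_less) auto
  ultimately show ?thesis by simp
qed

text \<open>
  The points that are closer to \<open>y\<close> are met by each ray from \<open>y\<close> at most once, and the others by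
  each ray from \<open>y'\<close>.
\<close>

lemma negligible_powr_dist_diff_level:
  fixes y y' :: "'a::euclidean_space"
  assumes s: "0 < s" "s < 1" and "y \<noteq> y'"
  shows "negligible {x. norm (x - y) powr s - norm (x - y') powr s = c}"
proof -
  have half: "negligible {x. norm (x - b) powr s - norm (x - a) powr s = c \<and> norm (x - a) \<le> norm (x - b)}" (is "negligible ?S")
    if ab: "a \<noteq> b" for a b :: 'a and c
  proof -
    have cl: "closed ?S"
    proof -
      have "continuous_on UNIV (\<lambda>x. norm (x - b) powr s - norm (x - a) powr s)"
        using s by (intro continuous_intros continuous_on_powr') auto
      then show ?thesis
        by (intro closed_Collect_conj closed_Collect_eq closed_Collect_le) (auto intro!: continuous_intros)
    qed
    have star: "a + k *\<^sub>R x \<notin> ?S" if "0 \<le> k" "k < 1" "a + x \<in> ?S" "x \<noteq> 0" for k x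
    proof -
      have "norm (x + (a - b)) powr s - norm x powr s < norm (k *\<^sub>R x + (a - b)) powr s - norm (k *\<^sub>R x) powr s"
        using that ab by (intro norm_powr_diff_star s) (auto simp: algebra_simps)
      then show ?thesis using that by (auto simp: algebra_simps)
    qed
    show ?thesis
    proof (cases "a \<in> ?S")
      case True
      have "?S \<subseteq> {a}"
      proof
        fix x assume "x \<in> ?S"
        then show "x \<in> {a}" using star[of 0 "x - a"] True by auto
      qed
      then show ?thesis by (rule negligible_subset[rotated]) simp
    next
      case False
      show ?thesis
      proof (rule starlike_negligible_strong[OF cl, of a])
        fix k :: real and x :: 'a assume "0 \<le> k" "k < 1" and x: "a + x \<in> ?S"
        then show "a + k *\<^sub>R x \<notin> ?S" using star[of k x] False by (cases "x = 0") auto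
      qed
    qed
  qed
  have "negligible ({x. norm (x - y') powr s - norm (x - y) powr s = - c \<and> norm (x - y) \<le> norm (x - y')} \<union>
     {x. norm (x - y) powr s - norm (x - y') powr s = c \<and> norm (x - y') \<le> norm (x - y)})"
    using assms by (intro negligible_Un half) auto
  then show ?thesis by (rule negligible_subset) auto
qed

text \<open>
  Let \<open>A\<close> be the level set. The fibres over \<open>y \<noteq> y'\<close> have a null intersection: the difference of
  the two defining equations does not contain \<open>u x\<close> and restricts \<open>x\<close> to a set as in the previous
  lemma. Integration over \<open>y\<close> and \<open>y'\<close> shows that the square of the measure of the fibre over \<open>x\<close>
  has integral 0.
\<close>

lemma lebesgue_frac_D_level_null:
  fixes u :: "'a::euclidean_space \<Rightarrow> real"
  assumes s: "0 < s" "s < 1" and u[measurable]: "u \<in> borel_measurable borel" and t: "t > 0"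
  shows "AE z in lebesgue. frac_D s u z \<noteq> t"
proof -
  define A where "A = {z :: 'a \<times> 'a. frac_D s u z = t}"
  have A[measurable]: "A \<in> sets borel" unfolding A_def by measurable
  have [measurable]: "A \<in> sets (borel \<Otimes>\<^sub>M borel)"
    unfolding borel_prod by (rule A)
  have [measurable]: "A \<in> sets (lborel \<Otimes>\<^sub>M lborel)"
    unfolding lborel_prod using A by simp
  have fiber: "(\<integral>\<^sup>+x. indicator A (x, y) * indicator A (x, y') \<partial>lborel) = (0::ennreal)" if "y \<noteq> y'" for y y'
  proof -
    have "{x. (x, y) \<in> A \<and> (x, y') \<in> A} \<subseteq>
        {x. norm (x - y) powr s - norm (x - y') powr s = (u y' - u y) / t}"
    proof safe
      fix x assume "(x, y) \<in> A" "(x, y') \<in> A"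
      then have e: "(u x - u y) / norm (x - y) powr s = t" "(u x - u y') / norm (x - y') powr s = t"
        by (auto simp: A_def frac_D_def)
      then have "norm (x - y) powr s \<noteq> 0" "norm (x - y') powr s \<noteq> 0" using t by auto
      then have "u x - u y = t * norm (x - y) powr s" "u x - u y' = t * norm (x - y') powr s"
        using e by (auto simp: field_simps)
      then show "norm (x - y) powr s - norm (x - y') powr s = (u y' - u y) / t"
        using t by (simp add: field_simps)
    qed
    then have "negligible {x. (x, y) \<in> A \<and> (x, y') \<in> A}"
      using negligible_subset negligible_powr_dist_diff_level[OF s that] by blast
    then have "AE x in lebesgue. x \<notin> {x. (x, y) \<in> A \<and> (x, y') \<in> A}"
      unfolding negligible_iff_null_sets by (rule AE_not_in)
    then have "AE x in lborel. \<not> ((x, y) \<in> A \<and> (x, y') \<in> A)"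
      by (subst (asm) AE_completion_iff) (auto)
    then show ?thesis
      by (subst nn_integral_0_iff_AE) (auto elim!: AE_mp simp: indicator_def)
  qed
  have "(\<integral>\<^sup>+x. (\<integral>\<^sup>+y. indicator A (x, y) \<partial>lborel) * (\<integral>\<^sup>+y. indicator A (x, y) \<partial>lborel) \<partial>lborel)
     = (\<integral>\<^sup>+x. \<integral>\<^sup>+y. \<integral>\<^sup>+y'. indicator A (x, y) * indicator A (x, y') \<partial>lborel \<partial>lborel \<partial>lborel)"
    by (simp add: nn_integral_cmult nn_integral_multc)
  also have "\<dots> = (\<integral>\<^sup>+y. \<integral>\<^sup>+x. \<integral>\<^sup>+y'. indicator A (x, y) * indicator A (x, y') \<partial>lborel \<partial>lborel \<partial>lborel)"
    by (rule lborel_pair.Fubini') measurable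
  also have "\<dots> = (\<integral>\<^sup>+y. \<integral>\<^sup>+y'. \<integral>\<^sup>+x. indicator A (x, y) * indicator A (x, y') \<partial>lborel \<partial>lborel \<partial>lborel)"
    by (intro nn_integral_cong lborel_pair.Fubini') measurable
  also have "\<dots> = (\<integral>\<^sup>+y. \<integral>\<^sup>+y'. 0 \<partial>(lborel :: 'a measure) \<partial>(lborel :: 'a measure))"
  proof (rule nn_integral_cong, rule nn_integral_cong_AE)
    fix y :: 'a
    show "AE y' in lborel. (\<integral>\<^sup>+x. indicator A (x, y) * indicator A (x, y') \<partial>lborel) = (0::ennreal)"
      using AE_lborel_singleton[of y] by eventually_elim (auto intro: fiber)
  qed
  finally have "(\<integral>\<^sup>+x. (\<integral>\<^sup>+y. indicator A (x, y) \<partial>lborel) * (\<integral>\<^sup>+y. indicator A (x, y) \<partial>lborel) \<partial>lborel) = (0::ennreal)"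
    by simp
  then have "AE x in lborel. (\<integral>\<^sup>+y. indicator A (x, y) \<partial>lborel) = (0::ennreal)"
    by (subst (asm) nn_integral_0_iff_AE) auto
  then have "(\<integral>\<^sup>+x. \<integral>\<^sup>+y. indicator A (x, y) \<partial>lborel \<partial>lborel) = (0::ennreal)"
    by (subst nn_integral_0_iff_AE) auto
  then have "emeasure (lborel \<Otimes>\<^sub>M lborel) A = 0"
    by (subst lborel.emeasure_pair_measure) auto
  then have "A \<in> null_sets lborel" by (auto simp: lborel_prod)
  then have "A \<in> null_sets lebesgue" by (rule null_sets_completionI)
  from AE_not_in[OF this] show ?thesis by (simp add: A_def)
qed

text \<open>
  Applied to the jumps of \<open>g\<close>, this confines the energy density to points where it is
  differentiable.
\<close>

lemma AE_frac_D_not_countable: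
  fixes u :: "'a::euclidean_space \<Rightarrow> real"
  assumes s: "0 < s" "s < 1" and u: "u \<in> borel_measurable lebesgue" and T: "countable T" "\<And>t. t \<in> T \<Longrightarrow> t > 0"
  shows "AE z in frac_mu. \<bar>frac_D s u z\<bar> \<notin> T"
proof -
  obtain v where v: "v \<in> borel_measurable borel" and uv: "AE x in lebesgue. u x = v x"
    using borel_representative[OF u] .
  have "AE z in lebesgue. frac_D s v z \<noteq> t \<and> frac_D s (\<lambda>x. - v x) z \<noteq> t" if "t \<in> T" for t
    using lebesgue_frac_D_level_null[OF s v T(2)[OF that]]
      lebesgue_frac_D_level_null[OF s _ T(2)[OF that], of "\<lambda>x. - v x"] v by auto
  then have "AE z in lebesgue. \<forall>t\<in>T. frac_D s v z \<noteq> t \<and> frac_D s (\<lambda>x. - v x) z \<noteq> t"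
    using T(1) by (subst AE_ball_countable) auto
  then have "AE z in lebesgue. \<bar>frac_D s v z\<bar> \<notin> T"
  proof eventually_elim
    case (elim z)
    have "frac_D s (\<lambda>x. - v x) z = - frac_D s v z"
      by (cases z) (simp add: frac_D_def minus_divide_left)
    then show ?case using elim by (auto simp: abs_if split: if_splits)
  qed
  from AE_frac_muI[OF this] frac_D_cong_AE[OF uv, of s] show ?thesis
    by eventually_elim simp
qed

section \<open>Integrability of functions of finite energy\<close>

lemma measure_tail_small:
  fixes v :: "'a::euclidean_space \<Rightarrow> real"
  assumes [measurable]: "v \<in> borel_measurable borel" and B: "bounded B" "B \<in> sets borel" and e: "e > 0"
  obtains m :: nat where "measure lborel {y \<in> B. \<bar>v y\<bar> > real m} < e"
proof -
  define A where "A m = {y \<in> B. \<bar>v y\<bar> > real m}" for m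
  have [measurable]: "B \<in> sets borel" by fact
  have "emeasure lborel B < \<infinity>" using emeasure_bounded_finite[OF B(1)] .
  moreover have "emeasure lborel (A m) \<le> emeasure lborel B" for m
    by (rule emeasure_mono) (auto simp: A_def)
  ultimately have fin: "emeasure lborel (A m) \<noteq> \<infinity>" for m
    by (metis leD infinity_ennreal_def)
  have "(\<lambda>m. emeasure lborel (A m)) \<longlonglongrightarrow> emeasure lborel (\<Inter>m. A m)"
    by (rule Lim_emeasure_decseq) (use fin in \<open>auto simp: A_def decseq_def\<close>)
  moreover have "(\<Inter>m. A m) = {}"
    by (auto simp: A_def) (metis linorder_not_less reals_Archimedean2 less_imp_le)
  ultimately have "(\<lambda>m. emeasure lborel (A m)) \<longlonglongrightarrow> 0" by simp
  then have "\<forall>\<^sub>F m in sequentially. emeasure lborel (A m) < ennreal e"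
    using e by (intro order_tendstoD) auto
  then obtain m where m: "emeasure lborel (A m) < ennreal e" by (auto simp: eventually_sequentially)
  then have "measure lborel (A m) < e"
    using fin[of m] e by (subst (asm) emeasure_eq_ennreal_measure) (auto simp: ennreal_less_iff)
  then show thesis using that by (simp add: A_def)
qed

text \<open>
  Where \<open>|v y| \<le> m\<close>, the numerator of the quotient is at least \<open>|v x| / 2\<close> and the distance is
  less than \<open>r\<close>. So a small \<open>r\<close> multiplies \<open>v x\<close> by a large factor.
\<close>

lemma (in young) frac_D_ball_lower:
  fixes v :: "'a::euclidean_space \<Rightarrow> real"
  assumes v[measurable]: "v \<in> borel_measurable borel" and s: "s > 0" and r: "r > 0" and l: "l > 0"
    and m: "m \<ge> 0" "2 * m < \<bar>v x\<bar>" and c: "measure lborel {y \<in> ball x r. \<bar>v y\<bar> \<le> m} \<ge> c" "c \<ge> 0"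
  shows "ennreal (c / r ^ DIM('a) * G (\<bar>v x\<bar> / (2 * r powr s * l)))
    \<le> (\<integral>\<^sup>+y. ennreal (1 / norm (x - y) ^ DIM('a)) * ennreal (G \<bar>frac_D s v (x, y) / l\<bar>) \<partial>lborel)"
proof -
  let ?S = "{y \<in> ball x r. \<bar>v y\<bar> \<le> m}"
  define k where "k = G (\<bar>v x\<bar> / (2 * r powr s * l))"
  have k: "k \<ge> 0" unfolding k_def using l r by (intro G_nonneg) auto
  have fin: "emeasure lborel ?S \<noteq> \<infinity>"
  proof -
    have "emeasure lborel ?S \<le> emeasure lborel (ball x r)" by (rule emeasure_mono) auto
    also have "\<dots> < \<infinity>" by (rule emeasure_bounded_finite) simp
    finally show ?thesis by simp
  qed
  have "ennreal (c / r ^ DIM('a) * k) = ennreal (k / r ^ DIM('a)) * ennreal c"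
    using k r c by (subst ennreal_mult[symmetric]) (auto simp: field_simps)
  also have "\<dots> \<le> ennreal (k / r ^ DIM('a)) * emeasure lborel ?S"
    using c fin by (intro mult_left_mono) (auto simp: emeasure_eq_ennreal_measure)
  also have "\<dots> = (\<integral>\<^sup>+y. ennreal (k / r ^ DIM('a)) * indicator ?S y \<partial>lborel)"
    by (subst nn_integral_cmult_indicator) auto
  also have "\<dots> \<le> (\<integral>\<^sup>+y. ennreal (1 / norm (x - y) ^ DIM('a)) * ennreal (G \<bar>frac_D s v (x, y) / l\<bar>) \<partial>lborel)"
  proof (rule nn_integral_mono)
    fix y
    show "ennreal (k / r ^ DIM('a)) * indicator ?S y \<le> ennreal (1 / norm (x - y) ^ DIM('a)) * ennreal (G \<bar>frac_D s v (x, y) / l\<bar>)"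
    proof (cases "y \<in> ?S")
      case True
      then have xy: "x \<noteq> y" using m by auto
      have d: "norm (x - y) > 0" "norm (x - y) < r" using True xy by (auto simp: dist_norm)
      have "\<bar>v x\<bar> / 2 \<le> \<bar>v x - v y\<bar>" using True m abs_triangle_ineq2[of "v x" "v y"] by simp
      moreover have "norm (x - y) powr s \<le> r powr s" using d s by (intro powr_mono2) auto
      ultimately have "(\<bar>v x\<bar> / 2) / r powr s \<le> \<bar>v x - v y\<bar> / norm (x - y) powr s"
        using d by (intro frac_le) auto
      then have "\<bar>v x\<bar> / (2 * r powr s * l) \<le> \<bar>frac_D s v (x, y) / l\<bar>"
        using l by (simp add: frac_D_def divide_right_mono flip: divide_divide_eq_left)
      then have "k \<le> G \<bar>frac_D s v (x, y) / l\<bar>"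
        unfolding k_def using l by (intro G_mono) auto
      moreover have "1 / r ^ DIM('a) \<le> 1 / norm (x - y) ^ DIM('a)"
        using d by (intro frac_le power_mono) auto
      ultimately have "(1 / r ^ DIM('a)) * k \<le> (1 / norm (x - y) ^ DIM('a)) * G \<bar>frac_D s v (x, y) / l\<bar>"
        using k d by (intro mult_mono) auto
      then show ?thesis using True k d by (auto simp: ennreal_mult[symmetric] G_nonneg intro!: ennreal_leI)
    qed auto
  qed
  finally show ?thesis by (simp add: k_def)
qed

text \<open>
  Finite energy at one scale \<open>l\<close> controls every multiple of \<open>v\<close> on a bounded set. The values of
  \<open>v\<close> exceed a large \<open>m\<close> on so small a set that \<open>|v y| \<le> m\<close> for half of the points \<open>y\<close> at distance
  less than \<open>r\<close> from any given point. Hence points with \<open>|v x| > 2 m\<close> are controlled by the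
  energy, and at the other points \<open>v\<close> is bounded.
\<close>

lemma (in young) frac_energy_imp_all_moments:
  fixes v :: "'a::euclidean_space \<Rightarrow> real"
  assumes v[measurable]: "v \<in> borel_measurable borel" and s: "s > 0" and l: "l > 0" 
    and I: "(\<integral>\<^sup>+z. ennreal (G \<bar>frac_D s v z / l\<bar>) \<partial>frac_mu) < \<infinity>"
    and \<Omega>: "bounded \<Omega>" and [measurable]: "\<Omega> \<in> sets borel"
  shows "(\<integral>\<^sup>+x. ennreal (G \<bar>K * v x\<bar>) * indicator \<Omega> x \<partial>lborel) < \<infinity>"
proof -
  define k where "k = \<bar>K\<bar> + 1"
  have k: "k > 0" "\<bar>K\<bar> \<le> k" by (auto simp: k_def)
  \<comment> \<open>with this radius the factor \<open>1 / (2 r\<^sup>s l)\<close> is \<open>k\<close>\<close>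
  define r where "r = (1 / (2 * k * l)) powr (1 / s)"
  have r: "r > 0" "r powr s = 1 / (2 * k * l)" using k l s by (auto simp: r_def powr_powr)
  define b where "b = measure lborel (ball (0::'a) r)"
  have b: "b > 0" using r by (simp add: b_def content_ball_pos)
  obtain R where R: "\<Omega> \<subseteq> ball 0 R" using bounded_subset_ballD[OF \<Omega>, of 0] by auto
  obtain m where m: "measure lborel {y \<in> ball 0 (R + r). \<bar>v y\<bar> > real m} < b / 2"
    using measure_tail_small[OF v, of "ball 0 (R + r)" "b / 2"] b by auto
  define c where "c = (b / 2) / r ^ DIM('a)"
  have c: "c > 0" using b r by (simp add: c_def)
  let ?\<Omega> = "\<lambda>x. indicator (\<Omega> \<inter> {x. 2 * real m < \<bar>v x\<bar>}) x :: ennreal"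
  have low: "ennreal (c * G \<bar>k * v x\<bar>) * ?\<Omega> x
      \<le> (\<integral>\<^sup>+y. ennreal (1 / norm (x - y) ^ DIM('a)) * ennreal (G \<bar>frac_D s v (x, y) / l\<bar>) \<partial>lborel)" for x
  proof (cases "x \<in> \<Omega> \<and> 2 * real m < \<bar>v x\<bar>")
    case True
    let ?S = "{y \<in> ball x r. \<bar>v y\<bar> \<le> real m}" and ?A = "{y \<in> ball 0 (R + r). \<bar>v y\<bar> > real m}"
    have fin: "X \<in> fmeasurable lborel" if "X \<subseteq> ball a q" "X \<in> sets borel" for X :: "'a set" and a q
      using that emeasure_bounded_finite[OF bounded_subset[OF bounded_ball that(1)]] by (auto simp: fmeasurable_def)
    have "ball x r \<subseteq> ?S \<union> ?A"
    proof
      fix y assume y: "y \<in> ball x r"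
      have "norm y \<le> norm x + norm (y - x)" by (metis add.commute diff_add_cancel norm_triangle_ineq)
      moreover have "norm x < R" using True R by auto
      ultimately have "y \<in> ball 0 (R + r)" using y by (auto simp: dist_norm norm_minus_commute)
      then show "y \<in> ?S \<union> ?A" using y by auto
    qed
    then have "measure lborel (ball x r) \<le> measure lborel (?S \<union> ?A)"
      by (intro measure_mono_fmeasurable fmeasurable.Un fin[of ?S x r] fin[of ?A 0 "R + r"]) auto
    also have "\<dots> \<le> measure lborel ?S + measure lborel ?A"
      by (intro measure_Un_le) auto
    finally have "b / 2 \<le> measure lborel ?S"
      using m r by (simp add: b_def content_ball)
    from frac_D_ball_lower[OF v s r(1) l _ _ this] True b
    have "ennreal (c * G (\<bar>v x\<bar> / (2 * r powr s * l))) \<le> (\<integral>\<^sup>+y. ennreal (1 / norm (x - y) ^ DIM('a)) * ennreal (G \<bar>frac_D s v (x, y) / l\<bar>) \<partial>lborel)"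
      by (simp add: c_def)
    moreover have "\<bar>v x\<bar> / (2 * r powr s * l) = \<bar>k * v x\<bar>"
      using r k l by (simp add: abs_mult)
    ultimately show ?thesis using True by simp
  qed auto
  have "(\<integral>\<^sup>+x. ennreal (c * G \<bar>k * v x\<bar>) * ?\<Omega> x \<partial>lborel) \<le> (\<integral>\<^sup>+z. ennreal (G \<bar>frac_D s v z / l\<bar>) \<partial>frac_mu)"
  proof (subst nn_integral_frac_mu)
    show "(\<lambda>z. ennreal (G \<bar>frac_D s v z / l\<bar>)) \<in> borel_measurable borel" by measurable
  qed (intro nn_integral_mono low)
  also note I
  finally have 1: "(\<integral>\<^sup>+x. ennreal (c * G \<bar>k * v x\<bar>) * ?\<Omega> x \<partial>lborel) < \<infinity>" .
  have [measurable]: "(\<lambda>x. G \<bar>k * v x\<bar>) \<in> borel_measurable borel"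
    by (intro gauge_measurable[OF gauge_G]) simp
  have "(\<integral>\<^sup>+x. ennreal (c * G \<bar>k * v x\<bar>) * ?\<Omega> x \<partial>lborel) = ennreal c * (\<integral>\<^sup>+x. ennreal (G \<bar>k * v x\<bar>) * ?\<Omega> x \<partial>lborel)"
    using c by (subst nn_integral_cmult[symmetric]) (auto simp: ennreal_mult' mult.assoc)
  with 1 c have 1: "(\<integral>\<^sup>+x. ennreal (G \<bar>k * v x\<bar>) * ?\<Omega> x \<partial>lborel) < \<infinity>"
    by (auto simp: ennreal_mult_less_top)
  have "(\<integral>\<^sup>+x. ennreal (G \<bar>K * v x\<bar>) * indicator \<Omega> x \<partial>lborel)
    \<le> (\<integral>\<^sup>+x. ennreal (G \<bar>k * v x\<bar>) * ?\<Omega> x + ennreal (G (k * (2 * real m))) * indicator \<Omega> x \<partial>lborel)"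
  proof (rule nn_integral_mono)
    fix x
    have K: "\<bar>K * v x\<bar> \<le> k * \<bar>v x\<bar>" using k by (simp add: abs_mult mult_right_mono)
    have "G \<bar>K * v x\<bar> \<le> G \<bar>k * v x\<bar>" using K k by (intro G_mono) (auto simp: abs_mult)
    moreover have "G \<bar>K * v x\<bar> \<le> G (k * (2 * real m))" if "\<bar>v x\<bar> \<le> 2 * real m"
      using K k that by (intro G_mono) (auto intro: order_trans mult_left_mono)
    ultimately show "ennreal (G \<bar>K * v x\<bar>) * indicator \<Omega> x \<le> ennreal (G \<bar>k * v x\<bar>) * ?\<Omega> x + ennreal (G (k * (2 * real m))) * indicator \<Omega> x"
      by (auto simp: indicator_def not_less intro: ennreal_leI add_increasing2)
  qed
  also have "\<dots> = (\<integral>\<^sup>+x. ennreal (G \<bar>k * v x\<bar>) * ?\<Omega> x \<partial>lborel) + ennreal (G (k * (2 * real m))) * emeasure lborel \<Omega>"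
    by (subst nn_integral_add) (auto simp: nn_integral_cmult_indicator)
  also have "\<dots> < \<infinity>"
    using 1 emeasure_bounded_finite[OF \<Omega>] by (auto simp: ennreal_mult_less_top)
  finally show ?thesis .
qed

lemma nn_integral_lebesgue_on_borel:
  assumes "\<Omega> \<in> sets borel" "f \<in> borel_measurable borel"
  shows "(\<integral>\<^sup>+x. f x \<partial>lebesgue_on \<Omega>) = (\<integral>\<^sup>+x. f x * indicator \<Omega> x \<partial>lborel)"
  using assms by (subst nn_integral_restrict_space) (auto simp: nn_integral_completion)

lemma AE_lebesgue_onI:
  assumes "AE x in lebesgue. P x" "\<Omega> \<in> sets lebesgue"
  shows "AE x in lebesgue_on \<Omega>. P x"
  using assms by (subst AE_restrict_space_iff) (auto intro: AE_mp)

lemma (in young) frac_WL_all_moments: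
  assumes "v \<in> frac_WL s G \<Omega>" "s > 0" "bounded \<Omega>" "\<Omega> \<in> sets borel"
  shows "integrable (lebesgue_on \<Omega>) (\<lambda>x. G \<bar>K * v x\<bar>)"
proof -
  have v: "v \<in> borel_measurable lebesgue" "frac_D s v \<in> orlicz_L G frac_mu"
    using assms by (auto simp: frac_WL_def)
  obtain l where l: "l > 0" "integrable frac_mu (\<lambda>x. G \<bar>frac_D s v x / l\<bar>)"
    using orlicz_L_scaled[OF gauge_G v(2)] .
  obtain w where w: "w \<in> borel_measurable borel" and vw: "AE x in lebesgue. v x = w x"
    using borel_representative[OF v(1)] .
  have "(\<integral>\<^sup>+z. ennreal (G \<bar>frac_D s w z / l\<bar>) \<partial>frac_mu) = (\<integral>\<^sup>+z. ennreal (G \<bar>frac_D s v z / l\<bar>) \<partial>frac_mu)"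
    using frac_D_cong_AE[OF vw, of s] by (intro nn_integral_cong_AE) auto
  also have "\<dots> < \<infinity>"
    using l(2) by (subst integrable_nonneg_iff[symmetric]) (auto simp: G_nonneg)
  finally have "(\<integral>\<^sup>+x. ennreal (G \<bar>K * w x\<bar>) * indicator \<Omega> x \<partial>lborel) < \<infinity>"
    by (intro frac_energy_imp_all_moments[OF w assms(2) l(1) _ assms(3,4)])
  then have fin: "(\<integral>\<^sup>+x. ennreal (G \<bar>K * w x\<bar>) \<partial>lebesgue_on \<Omega>) < \<infinity>"
    using w gauge_measurable[OF gauge_G, of "\<lambda>x. K * w x" borel] assms(4)
    by (subst nn_integral_lebesgue_on_borel) auto
  have *: "AE x in lebesgue_on \<Omega>. v x = w x"
    using vw assms(4) by (intro AE_lebesgue_onI) auto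
  have mv: "v \<in> borel_measurable (lebesgue_on \<Omega>)" using v(1) by (rule measurable_restrict_space1)
  show ?thesis
  proof (subst integrable_nonneg_iff)
    show "(\<lambda>x. G \<bar>K * v x\<bar>) \<in> borel_measurable (lebesgue_on \<Omega>)"
      using mv by (intro gauge_measurable[OF gauge_G]) auto
    have "(\<integral>\<^sup>+x. ennreal (G \<bar>K * v x\<bar>) \<partial>lebesgue_on \<Omega>) = (\<integral>\<^sup>+x. ennreal (G \<bar>K * w x\<bar>) \<partial>lebesgue_on \<Omega>)"
      using * by (intro nn_integral_cong_AE) auto
    with fin show "(\<integral>\<^sup>+x. ennreal (G \<bar>K * v x\<bar>) \<partial>lebesgue_on \<Omega>) < \<infinity>" by simp
  qed (auto simp: G_nonneg)
qed

section \<open>Averages along an expanding map\<close>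

lemma emeasure_vimage_expanding_ball:
  fixes \<Phi> :: "'a::euclidean_space \<Rightarrow> 'a"
  assumes L: "L > 0" "\<And>x y. norm (x - y) \<le> L * norm (\<Phi> x - \<Phi> y)" and "surj \<Phi>" and "continuous_on UNIV \<Phi>" and r: "r > 0"
  shows "emeasure lborel (\<Phi> -` ball c r) \<le> ennreal (L ^ DIM('a)) * emeasure lborel (ball c r)"
proof -
  obtain z where z: "\<Phi> z = c" using \<open>surj \<Phi>\<close> by (metis surjD)
  have "\<Phi> -` ball c r \<subseteq> ball z (L * r)"
  proof
    fix x assume "x \<in> \<Phi> -` ball c r"
    then have "norm (\<Phi> z - \<Phi> x) < r" by (simp add: z dist_norm)
    then have "norm (z - x) < L * r" using L(2)[of z x] L(1)
      by (meson mult_less_cancel_left_pos order_le_less_trans)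
    then show "x \<in> ball z (L * r)" by (simp add: dist_norm)
  qed
  then have "emeasure lborel (\<Phi> -` ball c r) \<le> emeasure lborel (ball z (L * r))"
    by (intro emeasure_mono) auto
  also have "\<dots> = ennreal (L ^ DIM('a)) * emeasure lborel (ball c r)"
    using L r by (simp add: emeasure_ball power_mult_distrib ennreal_mult[symmetric] mult_ac)
  finally show ?thesis .
qed

text \<open>
  Balls, supplied by Vitali's covering theorem, give the exact factor \<open>L\<^sup>n\<close>, which tends to 1 as
  \<open>L\<close> does; an estimate with cubes would lose a dimensional constant.
\<close>

lemma emeasure_vimage_expanding:
  fixes \<Phi> :: "'a::euclidean_space \<Rightarrow> 'a"
  assumes L: "L > 0" "\<And>x y. norm (x - y) \<le> L * norm (\<Phi> x - \<Phi> y)" and surj: "surj \<Phi>" and cont: "continuous_on UNIV \<Phi>"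
    and S: "S \<in> sets borel"
  shows "emeasure lborel (\<Phi> -` S) \<le> ennreal (L ^ DIM('a)) * emeasure lborel S"
proof -
  have [measurable]: "\<Phi> \<in> borel_measurable borel" using cont by (rule borel_measurable_continuous_onI)
  have vim[measurable]: "\<Phi> -` X \<in> sets borel" if "X \<in> sets borel" for X
    using measurable_sets[of \<Phi> borel borel X] that by simp
  have op: "emeasure lborel (\<Phi> -` U) \<le> ennreal (L ^ DIM('a)) * emeasure lborel U" if U: "open U" for U
  proof -
    let ?K = "{(x, r::real). r > 0 \<and> ball x r \<subseteq> U}"
    obtain C where C: "countable C" "C \<subseteq> ?K"
      and disj: "pairwise (\<lambda>i j. disjnt (ball (fst i) (snd i)) (ball (fst j) (snd j))) C"
      and neg: "negligible (U - (\<Union>i\<in>C. ball (fst i) (snd i)))"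
    proof (rule Vitali_covering_theorem_balls[of U ?K fst snd])
      fix x and d :: real assume "x \<in> U" "0 < d"
      then obtain e where e: "e > 0" "ball x e \<subseteq> U" using U open_contains_ball by blast
      then show "\<exists>i. i \<in> ?K \<and> x \<in> ball (fst i) (snd i) \<and> snd i < d"
        using \<open>0 < d\<close> by (intro exI[of _ "(x, min e (d/2))"]) auto
    qed blast
    define B where "B i = ball (fst i) (snd i :: real)" for i :: "'a \<times> real"
    define N where "N = U - (\<Union>i\<in>C. B i)"
    have N: "negligible N" using neg by (simp add: N_def B_def)
    have [measurable]: "N \<in> sets borel" unfolding N_def B_def using U by (intro sets.Diff borel_open) auto
    have "negligible (inv \<Phi> ` N)"
    proof (rule negligible_locally_Lipschitz_image[OF _ N])
      fix x
      show "\<exists>T D. open T \<and> x \<in> T \<and> (\<forall>y\<in>N \<inter> T. norm (inv \<Phi> y - inv \<Phi> x) \<le> D * norm (y - x))"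
        using L(2)[of "inv \<Phi> _" "inv \<Phi> x"] surj
        by (intro exI[of _ UNIV] exI[of _ L]) (auto simp: surj_f_inv_f)
    qed simp
    moreover have "\<Phi> -` N \<subseteq> inv \<Phi> ` N"
    proof
      have "inj \<Phi>"
      proof (rule injI)
        fix x y assume "\<Phi> x = \<Phi> y" then show "x = y" using L(2)[of x y] by simp
      qed
      then show "x \<in> inv \<Phi> ` N" if "x \<in> \<Phi> -` N" for x
        using that by (auto simp: image_iff intro!: bexI[of _ "\<Phi> x"])
    qed
    ultimately have "negligible (\<Phi> -` N)" using negligible_subset by blast
    then have N0: "emeasure lborel (\<Phi> -` N) = 0"
      by (simp add: negligible_iff_null_sets null_sets_def) 
    have dB: "disjoint_family_on B C" using disj
      by (auto simp: disjoint_family_on_def pairwise_def disjnt_def B_def)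
    have dV: "disjoint_family_on (\<lambda>i. \<Phi> -` B i) C" using dB
      unfolding disjoint_family_on_def by blast
    have [measurable]: "B i \<in> sets borel" for i by (simp add: B_def)
    have [measurable]: "(\<Union>i\<in>C. \<Phi> -` B i) \<in> sets borel"
      using C by (intro sets.countable_UN') auto
    have "\<Phi> -` U \<subseteq> (\<Union>i\<in>C. \<Phi> -` B i) \<union> \<Phi> -` N" by (auto simp: N_def)
    then have "emeasure lborel (\<Phi> -` U) \<le> emeasure lborel ((\<Union>i\<in>C. \<Phi> -` B i) \<union> \<Phi> -` N)"
      using C by (intro emeasure_mono) auto
    also have "\<dots> \<le> emeasure lborel (\<Union>i\<in>C. \<Phi> -` B i) + emeasure lborel (\<Phi> -` N)"
      using C by (intro emeasure_subadditive) auto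
    also have "\<dots> = (\<integral>\<^sup>+i. emeasure lborel (\<Phi> -` B i) \<partial>count_space C)"
      using C dV by (simp add: N0 emeasure_UN_countable)
    also have "\<dots> \<le> (\<integral>\<^sup>+i. ennreal (L ^ DIM('a)) * emeasure lborel (B i) \<partial>count_space C)"
      using C by (intro nn_integral_mono) (auto simp: B_def intro!: emeasure_vimage_expanding_ball L surj cont)
    also have "\<dots> = ennreal (L ^ DIM('a)) * emeasure lborel (\<Union>i\<in>C. B i)"
      using C dB by (subst emeasure_UN_countable) (auto simp: nn_integral_cmult)
    also have "\<dots> \<le> ennreal (L ^ DIM('a)) * emeasure lborel U"
    proof (intro mult_left_mono emeasure_mono)
      have "B i \<subseteq> U" if "i \<in> C" for i
        using subsetD[OF C(2) that] by (cases i) (simp add: B_def)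
      then show "(\<Union>i\<in>C. B i) \<subseteq> U" by blast
    qed (use U in auto)
    finally show ?thesis .
  qed
  show ?thesis
  proof (rule ennreal_le_epsilon)
    fix e :: real assume e: "e > 0"
    define d where "d = e / L ^ DIM('a)"
    have d: "d > 0" using e L by (simp add: d_def)
    obtain U where U: "open U" "S \<subseteq> U" "emeasure lborel (U - S) < d"
      using outer_regular_lborel[OF S d] .
    have "emeasure lborel U = emeasure lborel (S \<union> (U - S))" using U by (simp add: Un_absorb1)
    also have "\<dots> \<le> emeasure lborel S + emeasure lborel (U - S)"
      using S U by (intro emeasure_subadditive) auto
    also have "\<dots> \<le> emeasure lborel S + d" using U by (intro add_left_mono) auto
    finally have le: "emeasure lborel U \<le> emeasure lborel S + d" .
    have "emeasure lborel (\<Phi> -` S) \<le> emeasure lborel (\<Phi> -` U)"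
      using U by (intro emeasure_mono) auto
    also have "\<dots> \<le> ennreal (L ^ DIM('a)) * emeasure lborel U" by (rule op) fact
    also have "\<dots> \<le> ennreal (L ^ DIM('a)) * (emeasure lborel S + d)" using le by (rule mult_left_mono) simp
    also have "\<dots> = ennreal (L ^ DIM('a)) * emeasure lborel S + e"
      using L d by (simp add: distrib_left ennreal_mult[symmetric] d_def)
    finally show "emeasure lborel (\<Phi> -` S) \<le> ennreal (L ^ DIM('a)) * emeasure lborel S + e" .
  qed
qed

lemma nn_integral_expanding:
  fixes \<Phi> :: "'a::euclidean_space \<Rightarrow> 'a"
  assumes L: "L > 0" "\<And>x y. norm (x - y) \<le> L * norm (\<Phi> x - \<Phi> y)" and surj: "surj \<Phi>" and cont: "continuous_on UNIV \<Phi>"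
    and f[measurable]: "f \<in> borel_measurable borel"
  shows "(\<integral>\<^sup>+x. f (\<Phi> x) \<partial>lborel) \<le> ennreal (L ^ DIM('a)) * (\<integral>\<^sup>+x. f x \<partial>lborel)"
proof -
  have [measurable]: "\<Phi> \<in> borel_measurable borel" using cont by (rule borel_measurable_continuous_onI)
  have "(\<integral>\<^sup>+x. f (\<Phi> x) \<partial>lborel) = (\<integral>\<^sup>+x. f x \<partial>distr lborel borel \<Phi>)"
    by (subst nn_integral_distr) auto
  also have "\<dots> \<le> (\<integral>\<^sup>+x. f x \<partial>scale_measure (ennreal (L ^ DIM('a))) lborel)"
  proof (rule nn_integral_mono_measure)
    have "emeasure (distr lborel borel \<Phi>) X \<le> emeasure (scale_measure (ennreal (L ^ DIM('a))) lborel) X" for X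
    proof (cases "X \<in> sets borel")
      case True
      then show ?thesis
        using emeasure_vimage_expanding[OF L surj cont True] by (simp add: emeasure_distr)
    qed (simp add: emeasure_notin_sets)
    then show "distr lborel borel \<Phi> \<le> scale_measure (ennreal (L ^ DIM('a))) lborel"
      unfolding le_measure_iff by (simp add: le_fun_def space_scale_measure)
  qed simp
  also have "\<dots> = ennreal (L ^ DIM('a)) * (\<integral>\<^sup>+x. f x \<partial>lborel)"
    by (rule nn_integral_scale_measure) simp
  finally show ?thesis .
qed

text \<open>
  The supporting line of \<open>G\<close> at the modulus of the mean is integrated against \<open>\<rho>\<close>.
\<close>

lemma (in young) jensen_average:
  assumes [measurable]: "\<rho> \<in> borel_measurable M" "X \<in> borel_measurable M" and \<rho>: "\<And>w. \<rho> w \<ge> 0" "integrable M \<rho>" "(\<integral>w. \<rho> w \<partial>M) = 1"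
    and X: "integrable M (\<lambda>w. \<rho> w * X w)"
  shows "ennreal (G \<bar>\<integral>w. \<rho> w * X w \<partial>M\<bar>) \<le> (\<integral>\<^sup>+w. ennreal (\<rho> w * G \<bar>X w\<bar>) \<partial>M)"
proof (cases "(\<integral>\<^sup>+w. ennreal (\<rho> w * G \<bar>X w\<bar>) \<partial>M) < \<infinity>")
  case True
  have [measurable]: "(\<lambda>w. G \<bar>X w\<bar>) \<in> borel_measurable M" by (intro gauge_measurable[OF gauge_G]) simp
  have nn: "\<rho> w * G \<bar>X w\<bar> \<ge> 0" for w using \<rho> G_nonneg by simp
  have int: "integrable M (\<lambda>w. \<rho> w * G \<bar>X w\<bar>)"
    using True nn by (subst integrable_nonneg_iff) auto
  define a where "a = \<bar>\<integral>w. \<rho> w * X w \<partial>M\<bar>"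
  have a: "a \<ge> 0" by (simp add: a_def)
  have iX: "integrable M (\<lambda>w. \<rho> w * \<bar>X w\<bar>)"
    using integrable_abs[OF X] \<rho> by (simp add: abs_mult)
  have "a \<le> (\<integral>w. \<rho> w * \<bar>X w\<bar> \<partial>M)"
    using integral_abs_bound[of M "\<lambda>w. \<rho> w * X w"] \<rho> by (simp add: a_def abs_mult)
  then have "g a * a \<le> g a * (\<integral>w. \<rho> w * \<bar>X w\<bar> \<partial>M)"
    using a g_nonneg by (intro mult_left_mono) auto
  then have "G a \<le> (G a - g a * a) * (\<integral>w. \<rho> w \<partial>M) + g a * (\<integral>w. \<rho> w * \<bar>X w\<bar> \<partial>M)"
    using \<rho> by simp
  also have "\<dots> = (\<integral>w. (G a - g a * a) * \<rho> w + g a * (\<rho> w * \<bar>X w\<bar>) \<partial>M)"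
    using \<rho> iX by simp
  also have "\<dots> \<le> (\<integral>w. \<rho> w * G \<bar>X w\<bar> \<partial>M)"
  proof (rule integral_mono)
    fix w
    have "\<rho> w * (G a + g a * (\<bar>X w\<bar> - a)) \<le> \<rho> w * G \<bar>X w\<bar>"
      using \<rho> a by (intro mult_left_mono G_subgrad) auto
    then show "(G a - g a * a) * \<rho> w + g a * (\<rho> w * \<bar>X w\<bar>) \<le> \<rho> w * G \<bar>X w\<bar>"
      by (simp add: algebra_simps)
  qed (use \<rho> iX int in auto)
  finally have "ennreal (G a) \<le> ennreal (\<integral>w. \<rho> w * G \<bar>X w\<bar> \<partial>M)" by (rule ennreal_leI)
  also have "\<dots> = (\<integral>\<^sup>+w. ennreal (\<rho> w * G \<bar>X w\<bar>) \<partial>M)"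
    using nn by (intro nn_integral_eq_integral[symmetric] int) auto
  finally show ?thesis by (simp add: a_def)
qed (simp add: not_less top_unique)

lemma exists_lipschitz_kernel:
  assumes "\<eta> > 0"
  obtains \<rho> :: "'a::euclidean_space \<Rightarrow> real" and B where
    "\<And>w. 0 \<le> \<rho> w" "\<And>w. \<rho> w \<le> B" "\<And>w. norm w \<ge> \<eta> \<Longrightarrow> \<rho> w = 0" "\<And>v w. \<bar>\<rho> v - \<rho> w\<bar> \<le> B * norm (v - w)"
    "continuous_on UNIV \<rho>" "integrable lborel \<rho>" "(\<integral>w. \<rho> w \<partial>lborel) = 1" "B \<ge> 0"
proof -
  define t where "t = (\<lambda>w::'a. max 0 (\<eta> - norm w))"
  have cont: "continuous_on UNIV t" unfolding t_def by (intro continuous_intros)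
  then have [measurable]: "t \<in> borel_measurable borel" by (rule borel_measurable_continuous_onI)
  have int: "integrable lborel t"
  proof (rule Bochner_Integration.integrable_bound)
    show "integrable lborel (\<lambda>w. \<eta> * indicator (ball (0::'a) \<eta>) w :: real)"
      using emeasure_bounded_finite[OF bounded_ball, of "0::'a" \<eta>] by (intro integrable_mult_right integrable_real_indicator) auto
  qed (use assms in \<open>auto simp: t_def indicator_def\<close>)
  define N where "N = (\<integral>w. t w \<partial>lborel)"
  have "N \<noteq> 0"
  proof
    assume "N = 0"
    then have "AE w in lborel. t w = 0"
      unfolding N_def by (subst (asm) integral_nonneg_eq_0_iff_AE[OF int]) (auto simp: t_def)
    then have "AE w in lborel. w \<notin> ball (0::'a) \<eta>"
      by eventually_elim (auto simp: t_def max_def split: if_splits)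
    then have "ball (0::'a) \<eta> \<in> null_sets lborel"
      by (subst AE_iff_null_sets) auto
    then have "emeasure lborel (ball (0::'a) \<eta>) = 0" by auto
    then show False using content_ball_pos[OF assms, of "0::'a"] by (simp add: measure_def)
  qed
  moreover have "N \<ge> 0" unfolding N_def by (intro integral_nonneg_AE) (auto simp: t_def)
  ultimately have N: "N > 0" by simp
  define B where "B = max 1 \<eta> / N"
  show thesis
  proof (rule that[of "\<lambda>w. t w / N" B])
    show "0 \<le> B" using N by (auto simp: B_def)
    show "0 \<le> t w / N" for w using N by (auto simp: t_def)
    show "t w / N \<le> B" for w
    proof -
      have "t w \<le> max 1 \<eta>" using assms norm_ge_zero[of w] unfolding t_def by linarith
      then show ?thesis using N unfolding B_def by (intro divide_right_mono) auto
    qed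
    show "t w / N = 0" if "norm w \<ge> \<eta>" for w using that by (simp add: t_def)
    show "\<bar>t v / N - t w / N\<bar> \<le> B * norm (v - w)" for v w
    proof -
      have "\<bar>t v - t w\<bar> \<le> \<bar>norm v - norm w\<bar>" by (auto simp: t_def)
      also have "\<dots> \<le> 1 * norm (v - w)" using norm_triangle_ineq3[of v w] by simp
      also have "\<dots> \<le> max 1 \<eta> * norm (v - w)" by (intro mult_right_mono) auto
      finally have "\<bar>t v - t w\<bar> / N \<le> (max 1 \<eta> * norm (v - w)) / N" using N by (intro divide_right_mono) auto
      then show ?thesis using N by (simp add: B_def flip: diff_divide_distrib)
    qed
    show "continuous_on UNIV (\<lambda>w. t w / N)" using N by (intro continuous_intros cont) auto
    show "integrable lborel (\<lambda>w. t w / N)" using int by simp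
    show "(\<integral>w. t w / N \<partial>lborel) = 1" using N by (simp add: N_def)
  qed
qed

text \<open>
  The map \<open>\<Phi>\<close> distorts distances by factors between \<open>1 / L\<close> and \<open>M\<close>, and the average of a function
  is taken about \<open>\<Phi> x\<close> with density \<open>\<rho>\<close>. The constant \<open>B\<close> bounds both the values and the slope of
  \<open>\<rho>\<close>.
\<close>

locale averaging = young G g for G g :: "real \<Rightarrow> real" +
  fixes \<Phi> :: "'a::euclidean_space \<Rightarrow> 'a" and \<rho> :: "'a \<Rightarrow> real" and L M B :: real
  assumes L: "L > 0" "\<And>x y. norm (x - y) \<le> L * norm (\<Phi> x - \<Phi> y)"
    and M: "M > 0" "\<And>x y. norm (\<Phi> x - \<Phi> y) \<le> M * norm (x - y)"
    and surj: "surj \<Phi>"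
    and kernel: "\<And>w. 0 \<le> \<rho> w" "\<And>w. \<rho> w \<le> B" "\<And>v w. \<bar>\<rho> v - \<rho> w\<bar> \<le> B * norm (v - w)" "B \<ge> 0"
      "continuous_on UNIV \<rho>" "integrable lborel \<rho>" "(\<integral>w. \<rho> w \<partial>lborel) = 1"
begin

definition avg :: "('a \<Rightarrow> real) \<Rightarrow> 'a \<Rightarrow> real" where
  "avg u x = (\<integral>w. \<rho> w * u (\<Phi> x + w) \<partial>lborel)"

lemma \<Phi>_continuous: "continuous_on UNIV \<Phi>"
proof -
  have "M-lipschitz_on UNIV \<Phi>"
    using M by (intro lipschitz_onI) (auto simp: dist_norm)
  then show ?thesis by (rule lipschitz_on_continuous_on)
qed

lemma \<Phi>_measurable [measurable]: "\<Phi> \<in> borel_measurable borel"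
  using \<Phi>_continuous by (rule borel_measurable_continuous_onI)

lemma \<rho>_measurable [measurable]: "\<rho> \<in> borel_measurable borel"
  using kernel(5) by (rule borel_measurable_continuous_onI)

lemma \<Phi>_inj: "\<Phi> x = \<Phi> y \<longleftrightarrow> x = y"
  using L(2)[of x y] by auto

lemma nn_integral_\<rho>: "(\<integral>\<^sup>+w. ennreal (\<rho> w) \<partial>lborel) = 1"
  using nn_integral_eq_integral[OF kernel(6)] kernel by simp

lemma nn_integral_\<Phi>:
  assumes "f \<in> borel_measurable borel"
  shows "(\<integral>\<^sup>+x. f (\<Phi> x + w) \<partial>lborel) \<le> ennreal (L ^ DIM('a)) * (\<integral>\<^sup>+x. f x \<partial>lborel)"
proof (rule nn_integral_expanding[OF L(1) _ _ _ assms, of "\<lambda>x. \<Phi> x + w"])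
  show "surj (\<lambda>x. \<Phi> x + w)"
    using surj by (metis (no_types, lifting) diff_add_cancel surj_def)
qed (use L in \<open>auto intro!: continuous_intros \<Phi>_continuous\<close>)

lemma integrable_translate:
  assumes "integrable lborel (u :: 'a \<Rightarrow> real)"
  shows "integrable lborel (\<lambda>w. u (a + w))" "(\<integral>w. u (a + w) \<partial>lborel) = (\<integral>w. u w \<partial>lborel)"
proof -
  have [measurable]: "u \<in> borel_measurable borel" using assms by auto
  have "integrable (distr lborel borel ((+) a)) u" using assms by (simp add: lborel_distr_plus)
  then show "integrable lborel (\<lambda>w. u (a + w))" by (subst (asm) integrable_distr_eq) auto
  have "(\<integral>w. u w \<partial>distr lborel borel ((+) a)) = (\<integral>w. u (a + w) \<partial>lborel)"
    by (subst integral_distr) auto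
  then show "(\<integral>w. u (a + w) \<partial>lborel) = (\<integral>w. u w \<partial>lborel)" by (simp add: lborel_distr_plus)
qed

lemma integrable_avg:
  assumes "integrable lborel u"
  shows "integrable lborel (\<lambda>w. \<rho> w * u (a + w))"
proof (rule Bochner_Integration.integrable_bound)
  show "integrable lborel (\<lambda>w. B * u (a + w))"
    using integrable_translate[OF assms] by simp
  show "(\<lambda>w. \<rho> w * u (a + w)) \<in> borel_measurable lborel"
    using assms by (measurable; simp)
  show "AE w in lborel. norm (\<rho> w * u (a + w)) \<le> norm (B * u (a + w))"
    using kernel by (auto simp: abs_mult intro!: mult_right_mono)
qed

text \<open>
  After Jensen's inequality, the difference quotient at \<open>(x, y)\<close> is compared with the one at
  \<open>(\<Phi> x + w, \<Phi> y + w)\<close>. The denominators account for \<open>M\<^sup>-\<^sup>s\<close> on the left and for \<open>M\<^sup>n\<close> on the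
  right, and the substitution by \<open>\<Phi>\<close> costs \<open>L\<^sup>n\<close> in each variable.
\<close>

lemma avg_energy:
  assumes u: "integrable lborel u" and um[measurable]: "u \<in> borel_measurable borel" and s: "s > 0"
  shows "(\<integral>\<^sup>+z. ennreal (G \<bar>M powr (-s) * frac_D s (avg u) z\<bar>) \<partial>frac_mu)
    \<le> ennreal (M ^ DIM('a) * L ^ DIM('a) * L ^ DIM('a)) * (\<integral>\<^sup>+z. ennreal (G \<bar>frac_D s u z\<bar>) \<partial>frac_mu)"
proof -
  let ?n = "DIM('a)"
  have avg_meas[measurable]: "avg u \<in> borel_measurable borel"
    unfolding avg_def by (rule lborel.borel_measurable_lebesgue_integral) measurable
  define \<kappa> where "\<kappa> x y = 1 / norm (x - y) ^ ?n" for x y :: 'a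
  define H where "H a b = ennreal (\<kappa> a b * G \<bar>frac_D s u (a, b)\<bar>)" for a b
  have [measurable]: "(\<lambda>(x, y). \<kappa> x y) \<in> borel_measurable (borel \<Otimes>\<^sub>M borel)" unfolding \<kappa>_def by measurable
  have D[measurable]: "frac_D s u \<in> borel_measurable (borel \<Otimes>\<^sub>M borel)" 
    using frac_D_borel[OF um, of s] by (simp add: borel_prod)
  have H[measurable]: "(\<lambda>(x, y). H x y) \<in> borel_measurable (borel \<Otimes>\<^sub>M borel)" unfolding H_def by measurable
  have point: "ennreal (\<kappa> x y) * ennreal (G \<bar>M powr (-s) * frac_D s (avg u) (x, y)\<bar>)
      \<le> (\<integral>\<^sup>+w. ennreal (\<rho> w) * (ennreal (M ^ ?n) * H (\<Phi> x + w) (\<Phi> y + w)) \<partial>lborel)" for x y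
  proof (cases "x = y")
    case False
    define X where "X w = M powr (-s) * ((u (\<Phi> x + w) - u (\<Phi> y + w)) / norm (x - y) powr s)" for w
    have "(\<lambda>w. M powr (-s) / norm (x - y) powr s * (\<rho> w * u (\<Phi> x + w) - \<rho> w * u (\<Phi> y + w))) = (\<lambda>w. \<rho> w * X w)"
      by (auto simp: X_def field_simps)
    moreover have "integrable lborel (\<lambda>w. M powr (-s) / norm (x - y) powr s * (\<rho> w * u (\<Phi> x + w) - \<rho> w * u (\<Phi> y + w)))"
      using integrable_avg[OF u] by (intro integrable_mult_right Bochner_Integration.integrable_diff)
    ultimately have intX: "integrable lborel (\<lambda>w. \<rho> w * X w)" by simp
    have eq: "M powr (-s) * frac_D s (avg u) (x, y) = (\<integral>w. \<rho> w * X w \<partial>lborel)"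
    proof -
      have "(\<integral>w. \<rho> w * X w \<partial>lborel) = (\<integral>w. M powr (-s) / norm (x - y) powr s * (\<rho> w * u (\<Phi> x + w) - \<rho> w * u (\<Phi> y + w)) \<partial>lborel)"
        by (intro Bochner_Integration.integral_cong) (auto simp: X_def field_simps)
      also have "\<dots> = M powr (-s) / norm (x - y) powr s * (avg u x - avg u y)"
        using integrable_avg[OF u] by (simp add: avg_def)
      finally show ?thesis by (simp add: frac_D_def)
    qed
    have Xm[measurable]: "X \<in> borel_measurable borel" unfolding X_def by measurable
    have "ennreal (G \<bar>M powr (-s) * frac_D s (avg u) (x, y)\<bar>) \<le> (\<integral>\<^sup>+w. ennreal (\<rho> w * G \<bar>X w\<bar>) \<partial>lborel)"
      unfolding eq by (rule jensen_average) (use kernel intX in auto)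
    then have "ennreal (\<kappa> x y) * ennreal (G \<bar>M powr (-s) * frac_D s (avg u) (x, y)\<bar>)
       \<le> ennreal (\<kappa> x y) * (\<integral>\<^sup>+w. ennreal (\<rho> w * G \<bar>X w\<bar>) \<partial>lborel)"
      by (rule mult_left_mono) simp
    also have "\<dots> = (\<integral>\<^sup>+w. ennreal (\<kappa> x y) * ennreal (\<rho> w * G \<bar>X w\<bar>) \<partial>lborel)"
      by (rule nn_integral_cmult[symmetric]) simp
    also have "\<dots> \<le> (\<integral>\<^sup>+w. ennreal (\<rho> w) * (ennreal (M ^ ?n) * H (\<Phi> x + w) (\<Phi> y + w)) \<partial>lborel)"
    proof (rule nn_integral_mono)
      fix w
      have d: "norm (x - y) > 0" "norm (\<Phi> x - \<Phi> y) > 0" using False by (auto simp: \<Phi>_inj)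
      have "norm (\<Phi> x - \<Phi> y) powr s \<le> (M * norm (x - y)) powr s" using M s by (intro powr_mono2) auto
      then have "1 / (M powr s * norm (x - y) powr s) \<le> 1 / norm (\<Phi> x - \<Phi> y) powr s"
        using d M by (intro divide_left_mono) (auto simp: powr_mult)
      then have "\<bar>u (\<Phi> x + w) - u (\<Phi> y + w)\<bar> * (1 / (M powr s * norm (x - y) powr s)) \<le> \<bar>u (\<Phi> x + w) - u (\<Phi> y + w)\<bar> * (1 / norm (\<Phi> x - \<Phi> y) powr s)"
        by (rule mult_left_mono) simp
      then have "\<bar>X w\<bar> \<le> \<bar>frac_D s u (\<Phi> x + w, \<Phi> y + w)\<bar>"
        by (simp add: X_def frac_D_def abs_mult powr_minus field_simps)
      then have G: "G \<bar>X w\<bar> \<le> G \<bar>frac_D s u (\<Phi> x + w, \<Phi> y + w)\<bar>" by (intro G_mono) auto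
      have "norm (\<Phi> x - \<Phi> y) ^ ?n \<le> (M * norm (x - y)) ^ ?n" using M by (intro power_mono) auto
      then have "\<kappa> x y \<le> M ^ ?n * \<kappa> (\<Phi> x + w) (\<Phi> y + w)"
        using d M by (simp add: \<kappa>_def field_simps power_mult_distrib)
      then have "\<kappa> x y * G \<bar>X w\<bar> \<le> (M ^ ?n * \<kappa> (\<Phi> x + w) (\<Phi> y + w)) * G \<bar>frac_D s u (\<Phi> x + w, \<Phi> y + w)\<bar>"
        using G by (intro mult_mono) (auto simp: G_nonneg \<kappa>_def M less_imp_le)
      then have "\<rho> w * (\<kappa> x y * G \<bar>X w\<bar>) \<le> \<rho> w * ((M ^ ?n * \<kappa> (\<Phi> x + w) (\<Phi> y + w)) * G \<bar>frac_D s u (\<Phi> x + w, \<Phi> y + w)\<bar>)"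
        using kernel by (intro mult_left_mono)
      moreover have "\<kappa> a b \<ge> 0" for a b by (simp add: \<kappa>_def)
      ultimately show "ennreal (\<kappa> x y) * ennreal (\<rho> w * G \<bar>X w\<bar>) \<le> ennreal (\<rho> w) * (ennreal (M ^ ?n) * H (\<Phi> x + w) (\<Phi> y + w))"
        unfolding H_def using kernel M
        by (simp add: ennreal_mult[symmetric] G_nonneg mult_ac ennreal_leI)
    qed
    finally show ?thesis .
  qed (simp add: \<kappa>_def zero_power)
  have "(\<integral>\<^sup>+z. ennreal (G \<bar>M powr (-s) * frac_D s (avg u) z\<bar>) \<partial>frac_mu)
     = (\<integral>\<^sup>+x. \<integral>\<^sup>+y. ennreal (\<kappa> x y) * ennreal (G \<bar>M powr (-s) * frac_D s (avg u) (x, y)\<bar>) \<partial>lborel \<partial>lborel)"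
    unfolding \<kappa>_def by (rule nn_integral_frac_mu) measurable
  also have "\<dots> \<le> (\<integral>\<^sup>+x. \<integral>\<^sup>+y. \<integral>\<^sup>+w. ennreal (\<rho> w) * (ennreal (M ^ ?n) * H (\<Phi> x + w) (\<Phi> y + w)) \<partial>lborel \<partial>lborel \<partial>lborel)"
    by (intro nn_integral_mono point)
  also have "\<dots> = (\<integral>\<^sup>+x. \<integral>\<^sup>+w. \<integral>\<^sup>+y. ennreal (\<rho> w) * (ennreal (M ^ ?n) * H (\<Phi> x + w) (\<Phi> y + w)) \<partial>lborel \<partial>lborel \<partial>lborel)"
    by (rule nn_integral_cong, rule lborel_pair.Fubini') measurable
  also have "\<dots> = (\<integral>\<^sup>+w. \<integral>\<^sup>+x. \<integral>\<^sup>+y. ennreal (\<rho> w) * (ennreal (M ^ ?n) * H (\<Phi> x + w) (\<Phi> y + w)) \<partial>lborel \<partial>lborel \<partial>lborel)"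
    by (rule lborel_pair.Fubini') measurable
  also have "\<dots> = (\<integral>\<^sup>+w. ennreal (\<rho> w) * (ennreal (M ^ ?n) * (\<integral>\<^sup>+x. \<integral>\<^sup>+y. H (\<Phi> x + w) (\<Phi> y + w) \<partial>lborel \<partial>lborel)) \<partial>lborel)"
    by (simp add: nn_integral_cmult)
  also have "\<dots> \<le> (\<integral>\<^sup>+w. ennreal (\<rho> w) * (ennreal (M ^ ?n) * (ennreal (L ^ ?n) * (ennreal (L ^ ?n) * (\<integral>\<^sup>+x. \<integral>\<^sup>+y. H x y \<partial>lborel \<partial>lborel)))) \<partial>lborel)"
  proof (intro nn_integral_mono mult_left_mono)
    fix w :: 'a
    have "(\<integral>\<^sup>+x. \<integral>\<^sup>+y. H (\<Phi> x + w) (\<Phi> y + w) \<partial>lborel \<partial>lborel) \<le> (\<integral>\<^sup>+x. ennreal (L ^ ?n) * (\<integral>\<^sup>+y. H (\<Phi> x + w) y \<partial>lborel) \<partial>lborel)"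
      by (intro nn_integral_mono nn_integral_\<Phi>) measurable
    also have "\<dots> = ennreal (L ^ ?n) * (\<integral>\<^sup>+x. \<integral>\<^sup>+y. H (\<Phi> x + w) y \<partial>lborel \<partial>lborel)"
      by (rule nn_integral_cmult) measurable
    also have "\<dots> \<le> ennreal (L ^ ?n) * (ennreal (L ^ ?n) * (\<integral>\<^sup>+x. \<integral>\<^sup>+y. H x y \<partial>lborel \<partial>lborel))"
      by (intro mult_left_mono nn_integral_\<Phi>[where f = "\<lambda>a. \<integral>\<^sup>+y. H a y \<partial>lborel"]) auto
    finally show "(\<integral>\<^sup>+x. \<integral>\<^sup>+y. H (\<Phi> x + w) (\<Phi> y + w) \<partial>lborel \<partial>lborel) \<le> ennreal (L ^ ?n) * (ennreal (L ^ ?n) * (\<integral>\<^sup>+x. \<integral>\<^sup>+y. H x y \<partial>lborel \<partial>lborel))" .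
  qed auto
  also have "\<dots> = (ennreal (M ^ ?n) * (ennreal (L ^ ?n) * (ennreal (L ^ ?n) * (\<integral>\<^sup>+x. \<integral>\<^sup>+y. H x y \<partial>lborel \<partial>lborel))))"
    by (subst nn_integral_multc) (simp_all add: nn_integral_\<rho>)
  also have "(\<integral>\<^sup>+x. \<integral>\<^sup>+y. H x y \<partial>lborel \<partial>lborel) = (\<integral>\<^sup>+z. ennreal (G \<bar>frac_D s u z\<bar>) \<partial>frac_mu)"
  proof (subst nn_integral_frac_mu)
    show "(\<lambda>z. ennreal (G \<bar>frac_D s u z\<bar>)) \<in> borel_measurable borel" by measurable
  next
    show "(\<integral>\<^sup>+x. \<integral>\<^sup>+y. H x y \<partial>lborel \<partial>lborel) = (\<integral>\<^sup>+x. \<integral>\<^sup>+y. ennreal (1 / norm (x - y) ^ DIM('a)) * ennreal (G \<bar>frac_D s u (x, y)\<bar>) \<partial>lborel \<partial>lborel)"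
      unfolding H_def \<kappa>_def by (intro nn_integral_cong ennreal_mult) (auto simp: G_nonneg)
  qed
  finally show ?thesis using L M by (simp add: ennreal_mult mult.assoc)
qed

lemma avg_modular:
  assumes u: "integrable lborel u" and um[measurable]: "u \<in> borel_measurable borel"
  shows "(\<integral>\<^sup>+x. ennreal (G \<bar>K * avg u x\<bar>) \<partial>lborel) \<le> ennreal (L ^ DIM('a)) * (\<integral>\<^sup>+x. ennreal (G \<bar>K * u x\<bar>) \<partial>lborel)"
proof -
  have "ennreal (G \<bar>K * avg u x\<bar>) \<le> (\<integral>\<^sup>+w. ennreal (\<rho> w) * ennreal (G \<bar>K * u (\<Phi> x + w)\<bar>) \<partial>lborel)" for x
  proof -
    have i: "integrable lborel (\<lambda>w. K * (\<rho> w * u (\<Phi> x + w)))"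
      using integrable_avg[OF u] by simp
    have "K * avg u x = (\<integral>w. \<rho> w * (K * u (\<Phi> x + w)) \<partial>lborel)"
      unfolding avg_def by (subst integral_mult_right_zero[symmetric]) (simp add: mult_ac)
    moreover have "ennreal (G \<bar>\<integral>w. \<rho> w * (K * u (\<Phi> x + w)) \<partial>lborel\<bar>) \<le> (\<integral>\<^sup>+w. ennreal (\<rho> w * G \<bar>K * u (\<Phi> x + w)\<bar>) \<partial>lborel)"
      using i kernel by (intro jensen_average) (auto simp: mult.left_commute[of K])
    ultimately show ?thesis
      using kernel by (simp add: ennreal_mult G_nonneg)
  qed
  then have "(\<integral>\<^sup>+x. ennreal (G \<bar>K * avg u x\<bar>) \<partial>lborel) \<le> (\<integral>\<^sup>+x. \<integral>\<^sup>+w. ennreal (\<rho> w) * ennreal (G \<bar>K * u (\<Phi> x + w)\<bar>) \<partial>lborel \<partial>lborel)"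
    by (rule nn_integral_mono)
  also have "\<dots> = (\<integral>\<^sup>+w. \<integral>\<^sup>+x. ennreal (\<rho> w) * ennreal (G \<bar>K * u (\<Phi> x + w)\<bar>) \<partial>lborel \<partial>lborel)"
    by (rule lborel_pair.Fubini') measurable
  also have "\<dots> = (\<integral>\<^sup>+w. ennreal (\<rho> w) * (\<integral>\<^sup>+x. ennreal (G \<bar>K * u (\<Phi> x + w)\<bar>) \<partial>lborel) \<partial>lborel)"
    by (simp add: nn_integral_cmult)
  also have "\<dots> \<le> (\<integral>\<^sup>+w. ennreal (\<rho> w) * (ennreal (L ^ DIM('a)) * (\<integral>\<^sup>+x. ennreal (G \<bar>K * u x\<bar>) \<partial>lborel)) \<partial>lborel)"
    by (intro nn_integral_mono mult_left_mono nn_integral_\<Phi>[where f = "\<lambda>x. ennreal (G \<bar>K * u x\<bar>)"]) auto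
  also have "\<dots> = ennreal (L ^ DIM('a)) * (\<integral>\<^sup>+x. ennreal (G \<bar>K * u x\<bar>) \<partial>lborel)"
    by (subst nn_integral_multc) (simp_all add: nn_integral_\<rho>)
  finally show ?thesis .
qed

text \<open>
  Moving \<open>x\<close> moves the kernel and leaves \<open>u\<close> in place, which transfers the Lipschitz bound of the
  kernel to the average.
\<close>

lemma avg_lipschitz:
  assumes u: "integrable lborel u"
  shows "\<bar>avg u x - avg u y\<bar> \<le> B * M * (\<integral>w. \<bar>u w\<bar> \<partial>lborel) * norm (x - y)"
proof -
  have um[measurable]: "u \<in> borel_measurable borel" using u by auto
  have avg_eq: "avg u x = (\<integral>w. \<rho> (w - \<Phi> x) * u w \<partial>lborel)" "integrable lborel (\<lambda>w. \<rho> (w - \<Phi> x) * u w)" for x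
  proof -
    have i: "integrable lborel (\<lambda>w. \<rho> w * u (\<Phi> x + w))" by (rule integrable_avg[OF u])
    from integrable_translate[OF this, of "- \<Phi> x"]
    show "avg u x = (\<integral>w. \<rho> (w - \<Phi> x) * u w \<partial>lborel)" "integrable lborel (\<lambda>w. \<rho> (w - \<Phi> x) * u w)"
      by (simp_all add: avg_def)
  qed
  have "\<bar>avg u x - avg u y\<bar> = \<bar>\<integral>w. (\<rho> (w - \<Phi> x) - \<rho> (w - \<Phi> y)) * u w \<partial>lborel\<bar>"
    using avg_eq by (simp add: algebra_simps)
  also have "\<dots> \<le> (\<integral>w. (B * norm (\<Phi> x - \<Phi> y)) * \<bar>u w\<bar> \<partial>lborel)"
  proof (rule integral_abs_bound_integral)
    show "integrable lborel (\<lambda>w. (\<rho> (w - \<Phi> x) - \<rho> (w - \<Phi> y)) * u w)"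
      using avg_eq(2) by (simp add: left_diff_distrib)
    show "integrable lborel (\<lambda>w. B * norm (\<Phi> x - \<Phi> y) * \<bar>u w\<bar>)" using u by simp
    fix w
    have "\<bar>\<rho> (w - \<Phi> x) - \<rho> (w - \<Phi> y)\<bar> \<le> B * norm (\<Phi> x - \<Phi> y)"
      using kernel(3)[of "w - \<Phi> x" "w - \<Phi> y"] by (simp add: norm_minus_commute)
    then show "\<bar>(\<rho> (w - \<Phi> x) - \<rho> (w - \<Phi> y)) * u w\<bar> \<le> B * norm (\<Phi> x - \<Phi> y) * \<bar>u w\<bar>"
      by (simp add: abs_mult mult_right_mono)
  qed
  also have "\<dots> = (B * (\<integral>w. \<bar>u w\<bar> \<partial>lborel)) * norm (\<Phi> x - \<Phi> y)" by simp
  also have "\<dots> \<le> (B * (\<integral>w. \<bar>u w\<bar> \<partial>lborel)) * (M * norm (x - y))"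
    using M kernel by (intro mult_left_mono) auto
  finally show ?thesis by (simp add: mult_ac)
qed

lemma avg_zero:
  assumes "\<And>w. norm w \<ge> \<eta> \<Longrightarrow> \<rho> w = 0" "\<And>z. norm (z - \<Phi> x) \<le> \<eta> \<Longrightarrow> u z = 0"
  shows "avg u x = 0"
proof -
  have "\<rho> w * u (\<Phi> x + w) = 0" for w
    using assms(1)[of w] assms(2)[of "\<Phi> x + w"] by (cases "norm w \<ge> \<eta>") auto
  then show ?thesis unfolding avg_def by (simp only: Bochner_Integration.integral_zero)
qed

end

section \<open>Inward deformation of a Lipschitz domain\<close>

text \<open>
  A step \<open>- \<tau> e + w\<close> from outside an epigraph stays outside if \<open>w\<close> is small relative to \<open>\<tau>\<close>: the
  height falls by at least \<open>\<tau> - |w|\<close>, and the boundary function changes by at most \<open>2 L |w|\<close>.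
\<close>

lemma epigraph_complement_cone:
  fixes e :: "'a::euclidean_space"
  assumes e: "norm e = 1" and \<gamma>: "L-lipschitz_on {y. y \<bullet> e = 0} \<gamma>"
    and chart: "\<And>y. y \<in> ball p r \<Longrightarrow> y \<in> \<Omega> \<longleftrightarrow> y \<bullet> e > \<gamma> (y - (y \<bullet> e) *\<^sub>R e)"
    and y: "y \<in> ball p r" "y \<notin> \<Omega>" and w: "(1 + 2 * L) * norm w \<le> \<tau>"
    and q: "y - \<tau> *\<^sub>R e + w \<in> ball p r"
  shows "y - \<tau> *\<^sub>R e + w \<notin> \<Omega>"
proof -
  define P where "P z = z - (z \<bullet> e) *\<^sub>R e" for z :: 'a
  have ee: "e \<bullet> e = 1" using e by (simp add: dot_square_norm)
  have P0: "P z \<bullet> e = 0" for z by (simp add: P_def inner_diff_left ee)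
  let ?q = "y - \<tau> *\<^sub>R e + w"
  have L: "L \<ge> 0" using \<gamma> lipschitz_on_nonneg by blast
  have we: "\<bar>w \<bullet> e\<bar> \<le> norm w" using Cauchy_Schwarz_ineq2[of w e] e by simp
  have "P ?q - P y = P w" by (simp add: P_def inner_diff_left inner_add_left ee algebra_simps)
  moreover have "norm (P w) \<le> 2 * norm w"
    using norm_triangle_ineq4[of w "(w \<bullet> e) *\<^sub>R e"] we e by (simp add: P_def)
  ultimately have "norm (P y - P ?q) \<le> 2 * norm w" by (metis norm_minus_commute)
  then have "L * norm (P y - P ?q) \<le> L * (2 * norm w)" using L by (rule mult_left_mono)
  moreover have "dist (\<gamma> (P y)) (\<gamma> (P ?q)) \<le> L * dist (P y) (P ?q)"
    by (rule lipschitz_onD[OF \<gamma>]) (auto simp: P0)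
  ultimately have "\<gamma> (P y) \<le> \<gamma> (P ?q) + L * (2 * norm w)" by (simp add: dist_norm)
  moreover have "y \<bullet> e \<le> \<gamma> (P y)" using chart[OF y(1)] y(2) by (simp add: P_def)
  moreover have "?q \<bullet> e = y \<bullet> e - \<tau> + w \<bullet> e" by (simp add: inner_diff_left inner_add_left ee)
  moreover have "norm w + L * (2 * norm w) \<le> \<tau>" using w by (simp add: algebra_simps)
  ultimately have "?q \<bullet> e \<le> \<gamma> (P ?q)" using we by linarith
  then show ?thesis using chart[OF q] by (simp add: P_def)
qed

text \<open>
  If \<open>u\<close> vanishes outside \<open>\<Omega>\<close>, averages of \<open>u\<close> about \<open>\<Phi> x\<close> vanish within \<open>\<eta>\<close> of the complement.
  The map \<open>\<Phi>\<close> adds up small outward pushes \<open>- t \<psi>\<^sub>p(x) e\<^sub>p\<close>, one for each chart of a finite cover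
  of the frontier. Charts may overlap with quite different directions \<open>e\<^sub>p\<close>, but each push
  separately maps the complement into itself where it acts, so the pushes can be carried out one
  after the other. Near the frontier one of them is bounded below and absorbs the errors of size
  \<open>\<eta>\<close>.
\<close>

lemma exists_inward_deformation:
  fixes \<Omega> :: "'a::euclidean_space set"
  assumes \<Omega>: "open \<Omega>" "bounded \<Omega>" and lip: "lipschitz_boundary \<Omega>" and \<epsilon>: "\<epsilon> > 0"
  obtains \<Phi> :: "'a \<Rightarrow> 'a" and \<eta> where "\<eta> > 0" "\<eta> \<le> \<epsilon>" "\<And>x. norm (\<Phi> x - x) \<le> \<epsilon>"
    "\<And>x y. norm ((\<Phi> x - x) - (\<Phi> y - y)) \<le> \<epsilon> * norm (x - y)"
    "\<And>x y z. y \<notin> \<Omega> \<Longrightarrow> norm (x - y) \<le> \<eta> \<Longrightarrow> norm (z - \<Phi> x) \<le> \<eta> \<Longrightarrow> z \<notin> \<Omega>"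
proof -
  have "\<exists>e r L \<gamma>. norm e = 1 \<and> r > 0 \<and> L-lipschitz_on {y. y \<bullet> e = 0} \<gamma> \<and>
        (\<forall>y\<in>ball p r. y \<in> \<Omega> \<longleftrightarrow> y \<bullet> e > \<gamma> (y - (y \<bullet> e) *\<^sub>R e))" if "p \<in> frontier \<Omega>" for p
    using lip that unfolding lipschitz_boundary_def by blast
  then obtain e :: "'a \<Rightarrow> 'a" and r L :: "'a \<Rightarrow> real" and \<gamma> where
    chart: "\<And>p. p \<in> frontier \<Omega> \<Longrightarrow> norm (e p) = 1 \<and> r p > 0 \<and> (L p)-lipschitz_on {y. y \<bullet> e p = 0} (\<gamma> p) \<and>
        (\<forall>y\<in>ball p (r p). y \<in> \<Omega> \<longleftrightarrow> y \<bullet> e p > \<gamma> p (y - (y \<bullet> e p) *\<^sub>R e p))"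
    by metis
  have "compact (frontier \<Omega>)" using \<Omega> by (simp add: compact_frontier_bounded)
  moreover have "frontier \<Omega> \<subseteq> (\<Union>p\<in>frontier \<Omega>. ball p (r p / 4))" using chart by force
  ultimately obtain D where D: "D \<subseteq> frontier \<Omega>" "finite D" "frontier \<Omega> \<subseteq> (\<Union>p\<in>D. ball p (r p / 4))"
    using compactE_image[of "frontier \<Omega>" "frontier \<Omega>" "\<lambda>p. ball p (r p / 4)"] open_ball by blast
  \<comment> \<open>a common lower bound for the radii of the charts and the openings of their cones\<close>
  define m where "m = Min (insert 1 (r ` D \<union> (\<lambda>p. 1 / (1 + 2 * L p)) ` D))"
  have L0: "L p \<ge> 0" if "p \<in> D" for p using chart[of p] D that lipschitz_on_nonneg by blast
  have m: "m > 0" unfolding m_def using D chart L0 by (subst Min_gr_iff) (auto intro!: add_pos_nonneg)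
  have mr: "m \<le> r p" "m \<le> 1 / (1 + 2 * L p)" if "p \<in> D" for p unfolding m_def using that D by auto
  define \<psi> where "\<psi> p x = max 0 (r p / 2 - norm (x - p))" for p x :: 'a
  define S where "S = 1 + real (card D) + (\<Sum>p\<in>D. r p)"
  have r0: "r p > 0" if "p \<in> D" for p using chart D that by auto
  have S: "S \<ge> 1" "S \<ge> real (card D)" "(\<Sum>p\<in>D. r p) \<le> S" unfolding S_def using r0 by (auto intro!: sum_nonneg add_nonneg_nonneg simp: less_imp_le)
  define t where "t = min \<epsilon> (m / 16) / S"
  have t: "t > 0" "t * S \<le> \<epsilon>" "t * S \<le> m / 16" using \<epsilon> m S by (auto simp: t_def)
  define \<eta> where "\<eta> = min (min \<epsilon> (m / 64)) (m * (m / 8) * t / 2)"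
  have \<eta>: "\<eta> > 0" "\<eta> \<le> \<epsilon>" "\<eta> \<le> m / 64" "2 * \<eta> \<le> m * (m / 8) * t" using \<epsilon> m t by (auto simp: \<eta>_def)
  define X where "X F x = t *\<^sub>R (\<Sum>p\<in>F. \<psi> p x *\<^sub>R e p)" for F x
  define \<Phi> where "\<Phi> x = x - X D x" for x
  have \<psi>: "0 \<le> \<psi> p x" "\<psi> p x \<le> r p" if "p \<in> D" for p x
    using r0[OF that] norm_ge_zero[of "x - p"] unfolding \<psi>_def by linarith+
  have e1: "norm (e p) = 1" if "p \<in> D" for p using chart D that by auto
  have X_bound: "norm (X F x) \<le> t * S" if "F \<subseteq> D" for F x
  proof -
    have "norm (\<Sum>p\<in>F. \<psi> p x *\<^sub>R e p) \<le> (\<Sum>p\<in>F. r p)"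
      using that \<psi> e1 by (intro sum_norm_le) (auto dest!: subsetD)
    also have "\<dots> \<le> (\<Sum>p\<in>D. r p)" using that D r0 by (intro sum_mono2) (auto simp: less_imp_le)
    also have "\<dots> \<le> S" by (rule S)
    finally show ?thesis using t by (simp add: X_def)
  qed
  show thesis
  proof (rule that[of \<eta> \<Phi>])
    show "norm (\<Phi> x - x) \<le> \<epsilon>" for x using X_bound[of D x] t by (simp add: \<Phi>_def)
    show "norm ((\<Phi> x - x) - (\<Phi> y - y)) \<le> \<epsilon> * norm (x - y)" for x y
    proof -
      have "(\<Phi> x - x) - (\<Phi> y - y) = t *\<^sub>R (\<Sum>p\<in>D. (\<psi> p y - \<psi> p x) *\<^sub>R e p)"
        by (simp add: \<Phi>_def X_def scaleR_diff_left sum_subtractf algebra_simps)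
      moreover have "norm (\<Sum>p\<in>D. (\<psi> p y - \<psi> p x) *\<^sub>R e p) \<le> (\<Sum>p\<in>D. norm (x - y))"
      proof (rule sum_norm_le)
        fix p assume "p \<in> D"
        moreover have "\<bar>\<psi> p y - \<psi> p x\<bar> \<le> norm (x - y)"
          using norm_triangle_ineq3[of "y - p" "x - p"] unfolding \<psi>_def by (simp add: norm_minus_commute)
        ultimately show "norm ((\<psi> p y - \<psi> p x) *\<^sub>R e p) \<le> norm (x - y)" using e1 by simp
      qed
      ultimately have "norm ((\<Phi> x - x) - (\<Phi> y - y)) \<le> t * (real (card D) * norm (x - y))"
        using t by (simp add: mult_left_mono)
      also have "\<dots> \<le> t * (S * norm (x - y))" using S t by (intro mult_left_mono mult_right_mono) auto
      also have "\<dots> \<le> \<epsilon> * norm (x - y)" using t by (simp add: mult_right_mono flip: mult.assoc)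
      finally show ?thesis .
    qed
    fix x y z assume y: "y \<notin> \<Omega>" "norm (x - y) \<le> \<eta>" and z: "norm (z - \<Phi> x) \<le> \<eta>"
    show "z \<notin> \<Omega>"
    proof
      assume "z \<in> \<Omega>"
      then have "closed_segment y z \<inter> frontier \<Omega> \<noteq> {}"
        using y by (intro connected_Int_frontier) auto
      then obtain f where f: "f \<in> closed_segment y z" "f \<in> frontier \<Omega>" by blast
      then obtain p where p: "p \<in> D" "f \<in> ball p (r p / 4)" using D by blast
      have zx: "norm (z - x) \<le> \<eta> + t * S"
        using norm_triangle_ineq[of "z - \<Phi> x" "\<Phi> x - x"] z X_bound[of D x] by (simp add: \<Phi>_def)
      have "f \<in> cball x (\<eta> + t * S)"
      proof (rule subsetD[OF closed_segment_subset f(1)])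
        have "0 \<le> t * S" using t S by simp
        then show "y \<in> cball x (\<eta> + t * S)" using y(2) by (simp add: dist_norm)
        show "z \<in> cball x (\<eta> + t * S)" using zx by (simp add: dist_norm norm_minus_commute)
      qed (rule convex_cball)
      then have "norm (x - f) \<le> m / 8" using \<eta> t m by (simp add: dist_norm)
      then have "norm (x - p) \<le> m / 8 + r p / 4"
        using norm_triangle_ineq[of "x - f" "f - p"] p(2) by (simp add: dist_norm norm_minus_commute)
      then have \<psi>p: "m / 8 \<le> \<psi> p x" using mr(1)[OF p(1)] m by (simp add: \<psi>_def)
      have close: "v \<in> ball q (r q)" if "q \<in> D" "\<psi> q x > 0" "norm (v - x) \<le> m / 8" for q v
      proof -
        have "norm (x - q) < r q / 2" using that by (auto simp: \<psi>_def max_def split: if_splits)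
        moreover have "norm (v - q) \<le> norm (v - x) + norm (x - q)" using norm_triangle_ineq[of "v - x" "x - q"] by simp
        ultimately show ?thesis using that mr(1)[of q] m by (simp add: dist_norm norm_minus_commute)
      qed
      \<comment> \<open>the step from \<open>y\<close> to \<open>z\<close> consists of the pushes at \<open>x\<close> and the error \<open>w\<close>, which is added to the push of the chart \<open>p\<close>\<close>
      define w where "w = (x - y) + (z - \<Phi> x)"
      have w: "norm w \<le> 2 * \<eta>" using norm_triangle_ineq[of "x - y" "z - \<Phi> x"] y z by (simp add: w_def)
      have near: "norm (y - X F x - c *\<^sub>R w - x) \<le> m / 8" if "F \<subseteq> D" "c = 0 \<or> c = -1" for F and c :: real
      proof -
        have "y - X F x - c *\<^sub>R w - x = (y - x) - X F x - c *\<^sub>R w" by simp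
        also have "norm \<dots> \<le> norm (y - x) + norm (X F x) + norm (c *\<^sub>R w)"
          using norm_triangle_ineq4[of "y - x - X F x" "c *\<^sub>R w"] norm_triangle_ineq4[of "y - x" "X F x"] by linarith
        also have "\<dots> \<le> \<eta> + t * S + 2 * \<eta>"
          using X_bound[OF that(1), of x] y w that(2) \<eta> by (auto simp: norm_minus_commute)
        also have "\<dots> \<le> m / 8" using \<eta> t m by simp
        finally show ?thesis .
      qed
      have "y - X (insert p F) x + w \<notin> \<Omega>" if "F \<subseteq> D - {p}" for F
      proof -
        have "finite F" using that D finite_subset by blast
        then show ?thesis using that
        proof (induction F rule: finite_induct)
          case empty
          have "(1 + 2 * L p) * norm w \<le> t * \<psi> p x"
          proof -
            have "(1 + 2 * L p) * m \<le> 1" using mr(2)[OF p(1)] L0[OF p(1)] by (simp add: field_simps)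
            then have le: "(1 + 2 * L p) * m * (m / 8 * t) \<le> 1 * (m / 8 * t)" using m t by (intro mult_right_mono) auto
            have "(1 + 2 * L p) * norm w \<le> (1 + 2 * L p) * (m * (m / 8) * t)"
              using w \<eta>(4) L0[OF p(1)] by (intro mult_left_mono) auto
            also have "\<dots> = (1 + 2 * L p) * m * (m / 8 * t)" by simp
            also note le
            also have "1 * (m / 8 * t) \<le> t * \<psi> p x" using \<psi>p t by (simp add: mult.commute)
            finally show ?thesis .
          qed
          moreover have "y - (t * \<psi> p x) *\<^sub>R e p + w \<in> ball p (r p)"
            using near[of "{p}" "-1"] p \<psi>p m by (intro close) (auto simp: X_def)
          moreover have "y \<in> ball p (r p)" using near[of "{}" 0] p \<psi>p m by (intro close) (auto simp: X_def)
          ultimately have "y - (t * \<psi> p x) *\<^sub>R e p + w \<notin> \<Omega>"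
            using chart[of p] D p y(1) epigraph_complement_cone[of "e p" "L p" "\<gamma> p" p "r p" \<Omega> y w "t * \<psi> p x"] by blast
          then show ?case by (simp add: X_def)
        next
          case (insert q F)
          let ?y = "y - X (insert p F) x + w"
          have q: "q \<in> D" "q \<noteq> p" and F: "insert p F \<subseteq> D" "insert p (insert q F) \<subseteq> D" using insert p by auto
          have eq: "y - X (insert p (insert q F)) x + w = ?y - (t * \<psi> q x) *\<^sub>R e q + 0"
          proof -
            have "(\<Sum>p\<in>insert p (insert q F). \<psi> p x *\<^sub>R e p) = \<psi> q x *\<^sub>R e q + (\<Sum>p\<in>insert p F. \<psi> p x *\<^sub>R e p)"
              using insert(1,2) q by (subst insert_commute, subst sum.insert) auto
            then show ?thesis unfolding X_def by (simp only: scaleR_add_right scaleR_scaleR) simp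
          qed
          show ?case
          proof (cases "\<psi> q x = 0")
            case True
            then show ?thesis using insert unfolding eq by auto
          next
            case False
            then have pos: "\<psi> q x > 0" using \<psi>[OF q(1), of x] by simp
            have 1: "?y \<in> ball q (r q)" using near[OF F(1), of "-1"] q pos by (intro close) auto
            have 2: "?y - (t * \<psi> q x) *\<^sub>R e q + 0 \<in> ball q (r q)"
              unfolding eq[symmetric] using near[OF F(2), of "-1"] q pos by (intro close) auto
            have 3: "?y \<notin> \<Omega>" using insert by auto
            show ?thesis unfolding eq
              using chart[of q] D q 1 2 3 t pos
                epigraph_complement_cone[of "e q" "L q" "\<gamma> q" q "r q" \<Omega> ?y 0 "t * \<psi> q x"] by auto
          qed
        qed
      qed
      from this[of "D - {p}"] p have "y - X D x + w \<notin> \<Omega>" by (simp add: insert_absorb)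
      moreover have "y - X D x + w = z" by (simp add: w_def \<Phi>_def)
      ultimately show False using \<open>z \<in> \<Omega>\<close> by simp
    qed
  qed (use \<eta> in auto)
qed

section \<open>The weak* closure of the test functions\<close>

definition predual :: "(real \<Rightarrow> real) \<Rightarrow> 'a::euclidean_space set \<Rightarrow> (('a \<Rightarrow> real) \<times> ('a \<times> 'a \<Rightarrow> real)) set" where
  "predual G \<Omega> = orlicz_E (compl_young G) (lebesgue_on \<Omega>) \<times> orlicz_E (compl_young G) frac_mu"

definition pairing :: "real \<Rightarrow> 'a::euclidean_space set \<Rightarrow> ('a \<Rightarrow> real) \<Rightarrow> ('a \<Rightarrow> real) \<times> ('a \<times> 'a \<Rightarrow> real) \<Rightarrow> real" where
  "pairing s \<Omega> u p = (LINT x|lebesgue_on \<Omega>. u x * fst p x) + (LINT z|frac_mu. frac_D s u z * snd p z)"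

lemma topspace_frac_WL_weak_star: "topspace (frac_WL_weak_star s G \<Omega>) = frac_WL s G \<Omega>"
  unfolding frac_WL_weak_star_def weak_star_topology_def Let_def topspace_pullback_topology
  by (auto simp: frac_WL_def)

lemma openin_frac_WL_weak_star:
  "openin (frac_WL_weak_star s G \<Omega>) S \<longleftrightarrow>
     (\<exists>U. openin (product_topology (\<lambda>_. euclideanreal) (predual G \<Omega>)) U \<and>
        S = {u \<in> frac_WL s G \<Omega>. restrict (pairing s \<Omega> u) (predual G \<Omega>) \<in> U})"
proof -
  have *: "(\<lambda>(v, V)\<in>predual G \<Omega>. (LINT x|lebesgue_on \<Omega>. u x * v x) + (LINT z|frac_mu. frac_D s u z * V z))
      = restrict (pairing s \<Omega> u) (predual G \<Omega>)" for u
    by (auto simp: pairing_def restrict_def)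
  have L: "u \<in> orlicz_L G (lebesgue_on \<Omega>)" "frac_D s u \<in> orlicz_L G frac_mu" if "u \<in> frac_WL s G \<Omega>" for u
    using that by (auto simp: frac_WL_def)
  show ?thesis
    unfolding frac_WL_weak_star_def weak_star_topology_def Let_def openin_pullback_topology predual_def[symmetric]
  proof (intro iffI; elim exE conjE)
    fix U V assume V: "openin (product_topology (\<lambda>_. euclideanreal) (predual G \<Omega>)) V"
      and U: "U = (\<lambda>(u, U). \<lambda>(v, V)\<in>predual G \<Omega>. (LINT x|lebesgue_on \<Omega>. u x * v x) + (LINT z|frac_mu. U z * V z)) -` V \<inter> orlicz_L G (lebesgue_on \<Omega>) \<times> orlicz_L G frac_mu"
      and S: "S = (\<lambda>u. (u, frac_D s u)) -` U \<inter> frac_WL s G \<Omega>"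
    have "S = {u \<in> frac_WL s G \<Omega>. restrict (pairing s \<Omega> u) (predual G \<Omega>) \<in> V}"
      unfolding S U using L by (auto simp: *)
    then show "\<exists>U. openin (product_topology (\<lambda>_. euclideanreal) (predual G \<Omega>)) U \<and>
        S = {u \<in> frac_WL s G \<Omega>. restrict (pairing s \<Omega> u) (predual G \<Omega>) \<in> U}" using V by blast
  next
    fix V assume V: "openin (product_topology (\<lambda>_. euclideanreal) (predual G \<Omega>)) V"
      and S: "S = {u \<in> frac_WL s G \<Omega>. restrict (pairing s \<Omega> u) (predual G \<Omega>) \<in> V}"
    show "\<exists>U. (\<exists>W. openin (product_topology (\<lambda>_. euclideanreal) (predual G \<Omega>)) W \<and>
       U = (\<lambda>(u, U). \<lambda>(v, V)\<in>predual G \<Omega>. (LINT x|lebesgue_on \<Omega>. u x * v x) + (LINT z|frac_mu. U z * V z)) -` W \<inter> orlicz_L G (lebesgue_on \<Omega>) \<times> orlicz_L G frac_mu) \<and>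
       S = (\<lambda>u. (u, frac_D s u)) -` U \<inter> frac_WL s G \<Omega>"
      using V L unfolding S by (intro exI conjI refl) (auto simp: *)
  qed
qed

text \<open>
  A basic open set of the weak* topology restricts the pairing with finitely many elements of the
  predual.
\<close>

lemma frac_WL0_iff:
  "v \<in> frac_WL0 s G \<Omega> \<longleftrightarrow> v \<in> frac_WL s G \<Omega> \<and>
    (\<forall>F e. finite F \<longrightarrow> F \<subseteq> predual G \<Omega> \<longrightarrow> e > 0 \<longrightarrow>
      (\<exists>\<phi>\<in>Cc_infinity \<Omega> \<inter> frac_WL s G \<Omega>. \<forall>p\<in>F. \<bar>pairing s \<Omega> \<phi> p - pairing s \<Omega> v p\<bar> < e))"
  (is "?l \<longleftrightarrow> ?r")
proof
  assume l: ?l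
  then have v: "v \<in> frac_WL s G \<Omega>"
    and cl: "\<And>T. openin (frac_WL_weak_star s G \<Omega>) T \<Longrightarrow> v \<in> T \<Longrightarrow> \<exists>\<phi>\<in>Cc_infinity \<Omega>. \<phi> \<in> T"
    by (auto simp: frac_WL0_def in_closure_of topspace_frac_WL_weak_star)
  have "\<exists>\<phi>\<in>Cc_infinity \<Omega> \<inter> frac_WL s G \<Omega>. \<forall>p\<in>F. \<bar>pairing s \<Omega> \<phi> p - pairing s \<Omega> v p\<bar> < e"
    if F: "finite F" "F \<subseteq> predual G \<Omega>" "e > 0" for F e
  proof -
    let ?X = "\<lambda>p. if p \<in> F then ball (pairing s \<Omega> v p) e else UNIV"
    let ?U = "Pi\<^sub>E (predual G \<Omega>) ?X"
    have "openin (product_topology (\<lambda>_. euclideanreal) (predual G \<Omega>)) ?U"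
    proof (rule product_topology_basis)
      show "finite {p. ?X p \<noteq> topspace euclideanreal}"
        by (rule finite_subset[OF _ F(1)]) auto
    qed auto
    then have "openin (frac_WL_weak_star s G \<Omega>) {u \<in> frac_WL s G \<Omega>. restrict (pairing s \<Omega> u) (predual G \<Omega>) \<in> ?U}"
      unfolding openin_frac_WL_weak_star by blast
    from cl[OF this] v F(3) obtain \<phi> where \<phi>: "\<phi> \<in> Cc_infinity \<Omega>" "\<phi> \<in> frac_WL s G \<Omega>" 
      "restrict (pairing s \<Omega> \<phi>) (predual G \<Omega>) \<in> ?U"
      by (auto split: if_splits)
    have "pairing s \<Omega> \<phi> p \<in> ball (pairing s \<Omega> v p) e" if "p \<in> F" for p
      using PiE_mem[OF \<phi>(3), of p] that F(2) by auto
    then show ?thesis using \<phi> by (intro bexI[of _ \<phi>]) (auto simp: dist_real_def abs_minus_commute)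
  qed
  with v show ?r by blast
next
  assume r: ?r
  show ?l
    unfolding frac_WL0_def in_closure_of topspace_frac_WL_weak_star
  proof (intro conjI allI impI)
    fix T assume T: "v \<in> T \<and> openin (frac_WL_weak_star s G \<Omega>) T"
    then obtain U where U: "openin (product_topology (\<lambda>_. euclideanreal) (predual G \<Omega>)) U"
      and TU: "T = {u \<in> frac_WL s G \<Omega>. restrict (pairing s \<Omega> u) (predual G \<Omega>) \<in> U}"
      unfolding openin_frac_WL_weak_star by blast
    have "restrict (pairing s \<Omega> v) (predual G \<Omega>) \<in> U" using T TU by auto
    then obtain X where X: "finite {p \<in> predual G \<Omega>. X p \<noteq> UNIV}" "\<And>p. p \<in> predual G \<Omega> \<Longrightarrow> open (X p)"
      "restrict (pairing s \<Omega> v) (predual G \<Omega>) \<in> Pi\<^sub>E (predual G \<Omega>) X" "Pi\<^sub>E (predual G \<Omega>) X \<subseteq> U"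
      using U unfolding openin_product_topology_alt by auto
    define F where "F = {p \<in> predual G \<Omega>. X p \<noteq> UNIV}"
    have "\<exists>d>0. ball (pairing s \<Omega> v p) d \<subseteq> X p" if "p \<in> F" for p
      using X(2)[of p] PiE_mem[OF X(3), of p] that open_contains_ball by (auto simp: F_def)
    then obtain d where d: "\<And>p. p \<in> F \<Longrightarrow> d p > 0 \<and> ball (pairing s \<Omega> v p) (d p) \<subseteq> X p" by metis
    define e where "e = Min (insert 1 (d ` F))"
    have F: "finite F" using X(1) by (simp add: F_def)
    have e: "e > 0" "\<And>p. p \<in> F \<Longrightarrow> e \<le> d p" using F d by (auto simp: e_def)
    obtain \<phi> where \<phi>: "\<phi> \<in> Cc_infinity \<Omega>" "\<phi> \<in> frac_WL s G \<Omega>" "\<And>p. p \<in> F \<Longrightarrow> \<bar>pairing s \<Omega> \<phi> p - pairing s \<Omega> v p\<bar> < e"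
      using r[THEN conjunct2, rule_format, of F e] F e(1) by (auto simp: F_def)
    have "restrict (pairing s \<Omega> \<phi>) (predual G \<Omega>) \<in> Pi\<^sub>E (predual G \<Omega>) X"
    proof (rule PiE_I)
      fix p assume p: "p \<in> predual G \<Omega>"
      show "restrict (pairing s \<Omega> \<phi>) (predual G \<Omega>) p \<in> X p"
      proof (cases "p \<in> F")
        case True
        then have "pairing s \<Omega> \<phi> p \<in> ball (pairing s \<Omega> v p) (d p)"
          using \<phi>(3)[OF True] e(2)[OF True] by (auto simp: dist_real_def abs_minus_commute)
        then show ?thesis using d[OF True] p by auto
      qed (use p in \<open>auto simp: F_def\<close>)
    qed auto
    then show "\<exists>y. y \<in> Cc_infinity \<Omega> \<and> y \<in> T" using \<phi> X(4) TU by blast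
  qed (use r in blast)
qed

lemma frac_WL0_subset: "v \<in> frac_WL0 s G \<Omega> \<Longrightarrow> v \<in> frac_WL s G \<Omega>"
  by (simp add: frac_WL0_iff)

lemma frechet_derivative_lincomb:
  fixes f g :: "'a::euclidean_space \<Rightarrow> real"
  assumes "f differentiable (at x)" "g differentiable (at x)"
  shows "frechet_derivative (\<lambda>x. a * f x + b * g x) (at x) = (\<lambda>h. a * frechet_derivative f (at x) h + b * frechet_derivative g (at x) h)"
proof (rule frechet_derivative_at[symmetric])
  show "((\<lambda>x. a * f x + b * g x) has_derivative (\<lambda>h. a * frechet_derivative f (at x) h + b * frechet_derivative g (at x) h)) (at x)"
    using assms by (auto simp: frechet_derivative_works intro!: derivative_eq_intros)
qed

lemma Ck_lincomb:
  fixes f g :: "'a::euclidean_space \<Rightarrow> real"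
  assumes "Ck k f" "Ck k g"
  shows "Ck k (\<lambda>x. a * f x + b * g x)"
  using assms
proof (induction k arbitrary: f g)
  case 0
  then show ?case by (auto intro!: continuous_intros)
next
  case (Suc k)
  then show ?case by (auto simp: frechet_derivative_lincomb intro!: Suc.IH derivative_intros)
qed

lemma Ck_continuous: "Ck k f \<Longrightarrow> continuous_on UNIV f"
  by (cases k) (auto simp: continuous_on_eq_continuous_at intro: differentiable_imp_continuous_within)

lemma Ck_Suc_imp: "Ck (Suc k) f \<Longrightarrow> Ck k f"
proof (induction k arbitrary: f)
  case 0
  then show ?case using Ck_continuous[of "Suc 0"] by simp
qed auto

lemma Cc_infinity_lincomb:
  assumes "f \<in> Cc_infinity \<Omega>" "g \<in> Cc_infinity \<Omega>"
  shows "(\<lambda>x. a * f x + b * g x) \<in> Cc_infinity \<Omega>"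
proof -
  have "{x. a * f x + b * g x \<noteq> 0} \<subseteq> {x. f x \<noteq> 0} \<union> {x. g x \<noteq> 0}" by auto
  then have sub: "closure {x. a * f x + b * g x \<noteq> 0} \<subseteq> closure {x. f x \<noteq> 0} \<union> closure {x. g x \<noteq> 0}"
    using closure_mono[of "{x. a * f x + b * g x \<noteq> 0}" "{x. f x \<noteq> 0} \<union> {x. g x \<noteq> 0}"]
    by (simp only: closure_Un)
  then have "compact (closure {x. a * f x + b * g x \<noteq> 0})"
  proof -
    have "compact (closure {x. f x \<noteq> 0} \<union> closure {x. g x \<noteq> 0})"
      using assms by (intro compact_Un) (auto simp: Cc_infinity_def)
    then have "compact ((closure {x. f x \<noteq> 0} \<union> closure {x. g x \<noteq> 0}) \<inter> closure {x. a * f x + b * g x \<noteq> 0})"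
      by (rule compact_Int_closed) (rule closed_closure)
    moreover have "(closure {x. f x \<noteq> 0} \<union> closure {x. g x \<noteq> 0}) \<inter> closure {x. a * f x + b * g x \<noteq> 0} = closure {x. a * f x + b * g x \<noteq> 0}"
      using sub by blast
    ultimately show ?thesis by (simp only:)
  qed
  then show ?thesis using assms sub Ck_lincomb[of _ f g] by (auto simp: Cc_infinity_def)
qed

context young begin

lemma pairing_lincomb:
  assumes "u \<in> frac_WL s G \<Omega>" "v \<in> frac_WL s G \<Omega>" "p \<in> predual G \<Omega>"
  shows "pairing s \<Omega> (\<lambda>x. a * u x + b * v x) p = a * pairing s \<Omega> u p + b * pairing s \<Omega> v p"
proof -
  obtain q r where p: "p = (q, r)" "q \<in> orlicz_L (compl_young G) (lebesgue_on \<Omega>)" "r \<in> orlicz_L (compl_young G) frac_mu"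
    using assms(3) by (auto simp: predual_def orlicz_E_def)
  have i: "integrable (lebesgue_on \<Omega>) (\<lambda>x. u x * q x)" "integrable (lebesgue_on \<Omega>) (\<lambda>x. v x * q x)"
    "integrable frac_mu (\<lambda>z. frac_D s u z * r z)" "integrable frac_mu (\<lambda>z. frac_D s v z * r z)"
    using assms p by (auto intro!: integrable_mult_orlicz simp: frac_WL_def)
  show ?thesis
    using i by (simp add: pairing_def p frac_D_linear distrib_right distrib_left mult.assoc)
qed

lemma frac_WL0_lincomb:
  assumes u: "u \<in> frac_WL0 s G \<Omega>" and v: "v \<in> frac_WL0 s G \<Omega>"
  shows "(\<lambda>x. a * u x + b * v x) \<in> frac_WL0 s G \<Omega>"
  unfolding frac_WL0_iff
proof (intro conjI allI impI)
  note WL = u[THEN frac_WL0_subset] v[THEN frac_WL0_subset]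
  show "(\<lambda>x. a * u x + b * v x) \<in> frac_WL s G \<Omega>" by (intro frac_WL_linear WL)
  fix F and e :: real assume F: "finite F" "F \<subseteq> predual G \<Omega>" and e: "e > 0"
  define d where "d = e / (\<bar>a\<bar> + \<bar>b\<bar> + 1)"
  have d: "d > 0" using e by (simp add: d_def add_nonneg_pos)
  obtain \<phi> where \<phi>: "\<phi> \<in> Cc_infinity \<Omega>" "\<phi> \<in> frac_WL s G \<Omega>" "\<And>p. p \<in> F \<Longrightarrow> \<bar>pairing s \<Omega> \<phi> p - pairing s \<Omega> u p\<bar> < d"
    using u[unfolded frac_WL0_iff, THEN conjunct2, rule_format, OF F d] by auto
  obtain \<psi> where \<psi>: "\<psi> \<in> Cc_infinity \<Omega>" "\<psi> \<in> frac_WL s G \<Omega>" "\<And>p. p \<in> F \<Longrightarrow> \<bar>pairing s \<Omega> \<psi> p - pairing s \<Omega> v p\<bar> < d"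
    using v[unfolded frac_WL0_iff, THEN conjunct2, rule_format, OF F d] by auto
  show "\<exists>\<phi>\<in>Cc_infinity \<Omega> \<inter> frac_WL s G \<Omega>. \<forall>p\<in>F. \<bar>pairing s \<Omega> \<phi> p - pairing s \<Omega> (\<lambda>x. a * u x + b * v x) p\<bar> < e"
  proof (intro bexI[of _ "\<lambda>x. a * \<phi> x + b * \<psi> x"] ballI)
    fix p assume p: "p \<in> F"
    then have pE: "p \<in> predual G \<Omega>" using F by blast
    have "\<bar>pairing s \<Omega> (\<lambda>x. a * \<phi> x + b * \<psi> x) p - pairing s \<Omega> (\<lambda>x. a * u x + b * v x) p\<bar>
      = \<bar>a * (pairing s \<Omega> \<phi> p - pairing s \<Omega> u p) + b * (pairing s \<Omega> \<psi> p - pairing s \<Omega> v p)\<bar>"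
      by (simp add: pairing_lincomb[OF \<phi>(2) \<psi>(2) pE] pairing_lincomb[OF WL pE] algebra_simps)
    also have "\<dots> \<le> \<bar>a\<bar> * d + \<bar>b\<bar> * d"
      using \<phi>(3)[OF p] \<psi>(3)[OF p]
      by (intro order_trans[OF abs_triangle_ineq] add_mono) (auto simp: abs_mult intro!: mult_left_mono)
    also have "\<dots> < (\<bar>a\<bar> + \<bar>b\<bar> + 1) * d" using d by (simp add: algebra_simps)
    also have "\<dots> = e" by (simp add: d_def add_nonneg_pos)
    finally show "\<bar>pairing s \<Omega> (\<lambda>x. a * \<phi> x + b * \<psi> x) p - pairing s \<Omega> (\<lambda>x. a * u x + b * v x) p\<bar> < e" .
  qed (use \<phi> \<psi> Cc_infinity_lincomb frac_WL_linear in blast)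
qed

end

section \<open>Members of the closure vanish outside the domain\<close>

lemma density_frac_mu: "(frac_mu :: ('a::euclidean_space \<times> 'a) measure) = density lebesgue (\<lambda>z. ennreal (1 / norm (fst z - snd z) ^ DIM('a)))"
  unfolding frac_mu_def by (intro arg_cong2[where f = density]) (auto simp: fun_eq_iff)

lemma integral_frac_mu:
  fixes f :: "'a::euclidean_space \<times> 'a \<Rightarrow> real"
  assumes f[measurable]: "f \<in> borel_measurable borel"
  shows "(LINT z|frac_mu. f z) = (LINT z|(lborel \<Otimes>\<^sub>M lborel). 1 / norm (fst z - snd z) ^ DIM('a) * f z)"
    and "integrable frac_mu f \<longleftrightarrow> integrable (lborel \<Otimes>\<^sub>M lborel) (\<lambda>z. 1 / norm (fst z - snd z) ^ DIM('a) * f z)"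
proof -
  have k[measurable]: "(\<lambda>z::'a \<times> 'a. 1 / norm (fst z - snd z) ^ DIM('a)) \<in> borel_measurable borel"
    unfolding borel_prod[symmetric] by measurable
  note kl = borel_imp_lebesgue[OF k] borel_imp_lebesgue[OF f]
  have "(LINT z|frac_mu. f z) = (LINT z|lebesgue. 1 / norm (fst z - snd z) ^ DIM('a) * f z)"
    unfolding density_frac_mu by (subst integral_density) (use kl in auto)
  also have "\<dots> = (LINT z|lborel. 1 / norm (fst z - snd z) ^ DIM('a) * f z)"
    by (rule integral_completion) measurable
  finally show "(LINT z|frac_mu. f z) = (LINT z|(lborel \<Otimes>\<^sub>M lborel). 1 / norm (fst z - snd z) ^ DIM('a) * f z)"
    by (simp add: lborel_prod)
  have "integrable frac_mu f \<longleftrightarrow> integrable lebesgue (\<lambda>z. 1 / norm (fst z - snd z) ^ DIM('a) * f z)"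
    unfolding density_frac_mu by (subst integrable_density) (use kl in auto)
  also have "\<dots> \<longleftrightarrow> integrable lborel (\<lambda>z. 1 / norm (fst z - snd z) ^ DIM('a) * f z)"
    by (rule integrable_completion) measurable
  finally show "integrable frac_mu f \<longleftrightarrow> integrable (lborel \<Otimes>\<^sub>M lborel) (\<lambda>z. 1 / norm (fst z - snd z) ^ DIM('a) * f z)"
    by (simp add: lborel_prod)
qed

lemma integral_lebesgue_on_borel:
  fixes f :: "'a::euclidean_space \<Rightarrow> real"
  assumes "f \<in> borel_measurable borel" "\<Omega> \<in> sets borel"
  shows "(LINT x|lebesgue_on \<Omega>. f x) = (LINT x|lborel. indicator \<Omega> x * f x)"
    "integrable (lebesgue_on \<Omega>) f \<longleftrightarrow> integrable lborel (\<lambda>x. indicator \<Omega> x * f x)"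
  using assms
  by (simp_all add: integral_restrict_space integrable_restrict_space integral_completion integrable_completion)

lemma pairing_cong_AE:
  assumes "AE x in lebesgue. u x = v x" "\<Omega> \<in> sets lebesgue"
    "u \<in> borel_measurable lebesgue" "v \<in> borel_measurable lebesgue" 
    "frac_D s u \<in> borel_measurable lebesgue" "frac_D s v \<in> borel_measurable lebesgue" 
    "fst p \<in> borel_measurable (lebesgue_on \<Omega>)" "snd p \<in> borel_measurable lebesgue"
  shows "pairing s \<Omega> u p = pairing s \<Omega> v p"
proof -
  have m: "u \<in> borel_measurable (lebesgue_on \<Omega>)" "v \<in> borel_measurable (lebesgue_on \<Omega>)"
    using assms measurable_restrict_space1 by blast+
  have "(LINT x|lebesgue_on \<Omega>. u x * fst p x) = (LINT x|lebesgue_on \<Omega>. v x * fst p x)"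
    using AE_lebesgue_onI[OF assms(1,2)] m assms
    by (intro integral_cong_AE) auto
  moreover have "(LINT z|frac_mu. frac_D s u z * snd p z) = (LINT z|frac_mu. frac_D s v z * snd p z)"
    using frac_D_cong_AE[OF assms(1), of s] assms
    by (intro integral_cong_AE) (auto simp: measurable_cong_sets[OF sets_frac_mu refl])
  ultimately show ?thesis by (simp add: pairing_def)
qed

text \<open>
  A test pair that sees a function only through its values on a set \<open>C\<close> outside \<open>\<Omega>\<close>. The second
  component integrates the difference quotient over \<open>A \<times> C\<close> with \<open>A \<subseteq> \<Omega>\<close>; the first component
  subtracts the contribution of the values on \<open>A\<close>. The distance between \<open>A\<close> and \<open>C\<close> keeps all
  kernels bounded.
\<close>

locale exterior_test = young G g for G g +
  fixes s d :: real and \<Omega> A C :: "'a::euclidean_space set"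
  assumes s: "s > 0" and d: "d > 0" and sets[measurable]: "\<Omega> \<in> sets borel" "A \<in> sets borel" "C \<in> sets borel"
    and bdd: "bounded A" "bounded C" and A: "A \<subseteq> \<Omega>" and sep: "\<And>x y. x \<in> A \<Longrightarrow> y \<in> C \<Longrightarrow> d \<le> norm (x - y)"
begin

definition ker :: "'a \<times> 'a \<Rightarrow> real" where
  "ker z = indicator (A \<times> C) z / (norm (fst z - snd z) powr s * norm (fst z - snd z) ^ DIM('a))"

definition pot :: "'a \<Rightarrow> real" where "pot x = (LINT y|lborel. ker (x, y))"

definition test :: "('a \<Rightarrow> real) \<times> ('a \<times> 'a \<Rightarrow> real)" where
  "test = (\<lambda>x. - pot x, indicator (A \<times> C))"

lemma AC_sets[measurable]: "A \<times> C \<in> sets (borel \<Otimes>\<^sub>M borel)" "A \<times> C \<in> sets borel"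
proof -
  show 1: "A \<times> C \<in> sets (borel \<Otimes>\<^sub>M borel)" by measurable
  then show "A \<times> C \<in> sets borel" unfolding borel_prod .
qed

lemma ker_measurable[measurable]: "ker \<in> borel_measurable (borel \<Otimes>\<^sub>M borel)"
  unfolding ker_def by measurable

lemma ker_bound: "0 \<le> ker z" "ker z \<le> 1 / (d powr s * d ^ DIM('a)) * indicator (A \<times> C) z"
proof -
  show "0 \<le> ker z" by (simp add: ker_def)
  show "ker z \<le> 1 / (d powr s * d ^ DIM('a)) * indicator (A \<times> C) z"
  proof (cases "z \<in> A \<times> C")
    case True
    then have le: "d \<le> norm (fst z - snd z)" using sep by auto
    then have "0 < norm (fst z - snd z)" using d by linarith
    with le have "0 < norm (fst z - snd z) powr s" "0 < norm (fst z - snd z) ^ DIM('a)" "d \<le> norm (fst z - snd z)" by auto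
    then have "1 / (norm (fst z - snd z) powr s * norm (fst z - snd z) ^ DIM('a)) \<le> 1 / (d powr s * d ^ DIM('a))"
      using d s by (intro divide_left_mono mult_mono powr_mono2 power_mono mult_pos_pos) auto
    then show ?thesis using True by (simp add: ker_def)
  qed (simp add: ker_def)
qed

lemma fin_AC: "emeasure lborel A < \<infinity>" "emeasure lborel C < \<infinity>" "emeasure (lborel \<Otimes>\<^sub>M lborel) (A \<times> C) < \<infinity>"
  using emeasure_bounded_finite[OF bdd(1)] emeasure_bounded_finite[OF bdd(2)]
  by (auto simp: lborel.emeasure_pair_measure_Times ennreal_mult_less_top)

lemma pot_measurable[measurable]: "pot \<in> borel_measurable borel"
  unfolding pot_def by (rule lborel.borel_measurable_lebesgue_integral) measurable

lemma pot_bound: "0 \<le> pot x" "pot x \<le> 1 / (d powr s * d ^ DIM('a)) * measure lborel C" "x \<notin> A \<Longrightarrow> pot x = 0"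
proof -
  show "0 \<le> pot x" unfolding pot_def by (intro integral_nonneg_AE) (auto simp: ker_bound)
  have "pot x \<le> (LINT y|lborel. 1 / (d powr s * d ^ DIM('a)) * indicator C y)"
    unfolding pot_def
  proof (rule integral_mono')
    show "integrable lborel (\<lambda>y. 1 / (d powr s * d ^ DIM('a)) * indicator C y :: real)"
      using fin_AC by (intro integrable_mult_right integrable_real_indicator) auto
    have "1 / (d powr s * d ^ DIM('a)) * indicator (A \<times> C) (x, y) \<le> 1 / (d powr s * d ^ DIM('a)) * indicator C y" for y
      using d by (intro mult_left_mono) (auto simp: indicator_def)
    then show "ker (x, y) \<le> 1 / (d powr s * d ^ DIM('a)) * indicator C y" for y
      using ker_bound(2)[of "(x, y)"] by (meson order_trans)
  qed (use d in auto)
  then show "pot x \<le> 1 / (d powr s * d ^ DIM('a)) * measure lborel C" by simp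
  show "pot x = 0" if "x \<notin> A" using that by (simp add: pot_def ker_def)
qed

lemma test_predual: "test \<in> predual G \<Omega>"
  unfolding test_def predual_def
proof (intro SigmaI bounded_fin_supp_orlicz_E gauge_compl)
  show "(\<lambda>x. - pot x) \<in> bounded_fin_supp (lebesgue_on \<Omega>)"
    unfolding bounded_fin_supp_def
  proof (intro CollectI conjI)
    show "(\<lambda>x. - pot x) \<in> borel_measurable (lebesgue_on \<Omega>)"
      by (intro measurable_restrict_space1 borel_imp_lebesgue) measurable
    show "\<exists>B. \<forall>x\<in>space (lebesgue_on \<Omega>). \<bar>- pot x\<bar> \<le> B" using pot_bound by (intro exI) auto
    have "{x \<in> space (lebesgue_on \<Omega>). - pot x \<noteq> 0} \<subseteq> A" using pot_bound(3) by auto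
    then have "emeasure (lebesgue_on \<Omega>) {x \<in> space (lebesgue_on \<Omega>). - pot x \<noteq> 0} \<le> emeasure (lebesgue_on \<Omega>) A"
      by (rule emeasure_mono) (use A in \<open>auto simp: sets_restrict_space_iff\<close>)
    also have "\<dots> = emeasure lborel A" using A by (subst emeasure_restrict_space) auto
    finally show "emeasure (lebesgue_on \<Omega>) {x \<in> space (lebesgue_on \<Omega>). - pot x \<noteq> 0} < \<infinity>" using fin_AC(1) by (simp add: order_le_less_trans)
  qed
  show "indicator (A \<times> C) \<in> bounded_fin_supp frac_mu"
    unfolding bounded_fin_supp_def
  proof (intro CollectI conjI)
    show "indicator (A \<times> C) \<in> borel_measurable frac_mu"
      by (auto simp: measurable_cong_sets[OF sets_frac_mu refl] intro!: borel_imp_lebesgue borel_measurable_indicator)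
    show "\<exists>B. \<forall>x\<in>space frac_mu. \<bar>indicator (A \<times> C) x :: real\<bar> \<le> B" by (intro exI[of _ 1]) auto
    have "emeasure frac_mu {x \<in> space frac_mu. indicator (A \<times> C) x \<noteq> (0::real)} = emeasure frac_mu (A \<times> C)"
      by (intro arg_cong2[where f = emeasure]) (auto simp: indicator_def)
    also have "\<dots> = (\<integral>\<^sup>+z. indicator (A \<times> C) z \<partial>frac_mu)" by (subst nn_integral_indicator) auto
    also have "\<dots> = (\<integral>\<^sup>+x. \<integral>\<^sup>+y. ennreal (1 / norm (x - y) ^ DIM('a)) * indicator (A \<times> C) (x, y) \<partial>lborel \<partial>lborel)"
      by (rule nn_integral_frac_mu) simp
    also have "\<dots> \<le> (\<integral>\<^sup>+x. \<integral>\<^sup>+y. ennreal (1 / d ^ DIM('a)) * indicator (A \<times> C) (x, y) \<partial>lborel \<partial>lborel)"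
      using d sep by (intro nn_integral_mono) (auto simp: indicator_def intro!: ennreal_leI divide_left_mono power_mono mult_pos_pos zero_less_power intro: less_le_trans)
    also have "\<dots> = ennreal (1 / d ^ DIM('a)) * emeasure (lborel \<Otimes>\<^sub>M lborel) (A \<times> C)"
      by (simp add: nn_integral_cmult lborel.emeasure_pair_measure)
    also have "\<dots> < \<infinity>" using fin_AC(3) by (simp add: ennreal_mult_less_top)
    finally show "emeasure frac_mu {x \<in> space frac_mu. indicator (A \<times> C) x \<noteq> (0::real)} < \<infinity>" .
  qed
qed

lemma pairing_test:
  assumes w[measurable]: "w \<in> borel_measurable borel" and wA: "integrable lborel (\<lambda>x. indicator \<Omega> x * (w x * indicator A x))"
    and C: "\<And>y. y \<in> C \<Longrightarrow> \<bar>w y\<bar> \<le> m"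
  shows "pairing s \<Omega> w test = - (LINT z|(lborel \<Otimes>\<^sub>M lborel). ker z * w (snd z))"
    and "integrable (lborel \<Otimes>\<^sub>M lborel) (\<lambda>z. ker z * w (snd z))"
proof -
  let ?P = "lborel \<Otimes>\<^sub>M lborel :: ('a \<times> 'a) measure"
  define c where "c = 1 / (d powr s * d ^ DIM('a))"
  have c: "c \<ge> 0" using d by (simp add: c_def)
  have i1: "integrable ?P (\<lambda>z. ker z * w (snd z))"
  proof (rule Bochner_Integration.integrable_bound)
    show "integrable ?P (\<lambda>z. c * \<bar>m\<bar> * indicator (A \<times> C) z :: real)"
      using fin_AC by (intro integrable_mult_right integrable_real_indicator) auto
    have "\<bar>ker z\<bar> * \<bar>w (snd z)\<bar> \<le> c * \<bar>m\<bar> * indicator (A \<times> C) z" for z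
    proof (cases "z \<in> A \<times> C")
      case True
      then have "\<bar>w (snd z)\<bar> \<le> \<bar>m\<bar>" using C[of "snd z"] by auto
      moreover have "\<bar>ker z\<bar> \<le> c" using ker_bound[of z] True by (simp add: c_def)
      ultimately show ?thesis using True c by (simp add: mult_mono)
    qed (simp add: ker_def)
    then show "AE z in ?P. norm (ker z * w (snd z)) \<le> norm (c * \<bar>m\<bar> * indicator (A \<times> C) z :: real)"
      using c by (intro AE_I2) (simp add: abs_mult)
  qed measurable
  then show "integrable ?P (\<lambda>z. ker z * w (snd z))" .
  have wA': "integrable lborel (\<lambda>x. w x * indicator A x)"
  proof -
    have "(\<lambda>x. indicator \<Omega> x * (w x * indicator A x)) = (\<lambda>x. w x * indicator A x)"
      using A by (auto simp: fun_eq_iff indicator_def)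
    then show ?thesis using wA by simp
  qed
  have i2: "integrable ?P (\<lambda>z. ker z * w (fst z))"
  proof (rule Bochner_Integration.integrable_bound)
    show "integrable ?P (\<lambda>z. c * ((w (fst z) * indicator A (fst z)) * indicator C (snd z)) :: real)"
    proof (intro integrable_mult_right)
      show "integrable ?P (\<lambda>z. w (fst z) * indicator A (fst z) * (indicator C (snd z) :: real))"
      proof (rule lborel_pair.Fubini_integrable, goal_cases)
        case 2
        show ?case using integrable_abs[OF wA'] by (simp add: abs_mult)
      next
        case 3
        show ?case using fin_AC by (auto intro!: integrable_mult_right integrable_real_indicator)
      qed measurable
    qed
    have "\<bar>ker z\<bar> * \<bar>w (fst z)\<bar> \<le> c * (\<bar>w (fst z)\<bar> * indicator A (fst z) * indicator C (snd z))" for z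
    proof (cases "z \<in> A \<times> C")
      case True
      then have "\<bar>ker z\<bar> \<le> c" using ker_bound[of z] by (simp add: c_def)
      then show ?thesis using True by (cases z) (auto intro: mult_right_mono)
    qed (use c in \<open>simp add: ker_def\<close>)
    then show "AE z in ?P. norm (ker z * w (fst z)) \<le> norm (c * ((w (fst z) * indicator A (fst z)) * indicator C (snd z)) :: real)"
      using c by (intro AE_I2) (simp add: abs_mult)
  qed measurable
  have "(LINT z|frac_mu. frac_D s w z * snd test z) = (LINT z|?P. 1 / norm (fst z - snd z) ^ DIM('a) * (frac_D s w z * snd test z))"
    using frac_D_borel[OF w, of s] by (intro integral_frac_mu(1)) (simp add: test_def)
  also have "\<dots> = (LINT z|?P. ker z * w (fst z) - ker z * w (snd z))"
    by (intro Bochner_Integration.integral_cong) (auto simp: test_def ker_def frac_D_def diff_divide_distrib left_diff_distrib right_diff_distrib mult.commute split: prod.splits)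
  also have "\<dots> = (LINT z|?P. ker z * w (fst z)) - (LINT z|?P. ker z * w (snd z))"
    using i1 i2 by simp
  also have "(LINT z|?P. ker z * w (fst z)) = (LINT x|lborel. LINT y|lborel. ker (x, y) * w x)"
    using lborel_pair.integral_fst'[OF i2] by simp
  also have "\<dots> = (LINT x|lborel. w x * pot x)"
    by (intro Bochner_Integration.integral_cong) (auto simp: pot_def mult.commute)
  finally have e1: "(LINT z|frac_mu. frac_D s w z * snd test z) = (LINT x|lborel. w x * pot x) - (LINT z|?P. ker z * w (snd z))" .
  have "(LINT x|lebesgue_on \<Omega>. w x * fst test x) = (LINT x|lborel. indicator \<Omega> x * (w x * - pot x))"
    by (subst integral_lebesgue_on_borel) (auto simp: test_def)
  also have "\<dots> = - (LINT x|lborel. w x * pot x)"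
    using pot_bound(3) A by (subst Bochner_Integration.integral_minus[symmetric], intro Bochner_Integration.integral_cong) (auto simp: indicator_def)
  finally show "pairing s \<Omega> w test = - (LINT z|?P. ker z * w (snd z))" by (simp add: pairing_def e1)
qed

end

context young begin

lemma frac_WL_integrable:
  assumes "v \<in> frac_WL s G \<Omega>" "\<Omega> \<in> sets borel" "A \<in> sets borel" "bounded A" "A \<subseteq> \<Omega>"
  shows "integrable (lebesgue_on \<Omega>) (\<lambda>x. v x * indicator A x)"
proof (rule integrable_mult_orlicz)
  show "v \<in> orlicz_L G (lebesgue_on \<Omega>)" using assms by (simp add: frac_WL_def)
  have "indicator A \<in> bounded_fin_supp (lebesgue_on \<Omega>)"
    unfolding bounded_fin_supp_def
  proof (intro CollectI conjI)
    show "indicator A \<in> borel_measurable (lebesgue_on \<Omega>)" using assms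
      by (intro measurable_restrict_space1 borel_imp_lebesgue) auto
    show "\<exists>B. \<forall>x\<in>space (lebesgue_on \<Omega>). \<bar>indicator A x :: real\<bar> \<le> B" by (intro exI[of _ 1]) auto
    have "{x \<in> space (lebesgue_on \<Omega>). indicator A x \<noteq> (0::real)} = A" using assms by (auto simp: indicator_def)
    then show "emeasure (lebesgue_on \<Omega>) {x \<in> space (lebesgue_on \<Omega>). indicator A x \<noteq> (0::real)} < \<infinity>"
      using assms emeasure_bounded_finite[of A] by (simp add: emeasure_restrict_space)
  qed
  then show "indicator A \<in> orlicz_L (compl_young G) (lebesgue_on \<Omega>)"
    using bounded_fin_supp_orlicz_E[OF gauge_compl] by (auto simp: orlicz_E_def)
qed

text \<open>
  Take for \<open>C\<close> the part of the complement, within a ball, where \<open>w\<close> is positive and bounded. Test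
  functions vanish on \<open>C\<close>, so their pairing with the test pair is 0, and by closure so is that of
  \<open>v\<close>. But the latter is an integral over \<open>A \<times> C\<close> of a function of one sign; hence \<open>C\<close> is a null
  set.
\<close>

lemma frac_WL0_le_zero_outside:
  fixes \<Omega> :: "'a::euclidean_space set"
  assumes v: "v \<in> frac_WL0 s G \<Omega>" and s: "s > 0" and \<Omega>: "open \<Omega>" "\<Omega> \<noteq> {}"
    and w[measurable]: "w \<in> borel_measurable borel" and vw: "AE x in lebesgue. v x = w x"
  shows "AE x in lborel. x \<notin> \<Omega> \<longrightarrow> w x \<le> 0"
proof -
  obtain x0 e where e: "e > 0" "ball x0 e \<subseteq> \<Omega>" using \<Omega> open_contains_ball by blast
  define A where "A = ball x0 (e/2)"
  have [measurable]: "\<Omega> \<in> sets borel" using \<Omega> by simp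
  have vWL: "v \<in> frac_WL s G \<Omega>" using frac_WL0_subset[OF v] .
  have "AE x in lborel. x \<notin> {x \<in> cball 0 (real m). x \<notin> \<Omega> \<and> 0 < w x \<and> w x \<le> real m}" for m :: nat
  proof -
    define C where "C = {x \<in> cball 0 (real m). x \<notin> \<Omega> \<and> 0 < w x \<and> w x \<le> real m}"
    have [measurable]: "C \<in> sets borel" unfolding C_def by measurable
    interpret exterior_test G g s "e/2" \<Omega> A C
    proof unfold_locales
      show "bounded C" by (rule bounded_subset[of "cball 0 (real m)"]) (auto simp: C_def)
      show "e/2 \<le> norm (x - y)" if "x \<in> A" "y \<in> C" for x y
      proof -
        have "y \<notin> ball x0 e" using that e by (auto simp: C_def)
        then have "e \<le> norm (x0 - y)" by (simp add: dist_norm)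
        also have "\<dots> \<le> norm (x0 - x) + norm (x - y)" using norm_triangle_ineq[of "x0 - x" "x - y"] by simp
        finally show ?thesis using that(1) by (simp add: A_def dist_norm)
      qed
    qed (use s e in \<open>auto simp: A_def\<close>)
    have test_meas: "fst test \<in> borel_measurable (lebesgue_on \<Omega>)" "snd test \<in> borel_measurable lebesgue"
      unfolding test_def by (auto intro!: measurable_restrict_space1 borel_imp_lebesgue)
    have int: "integrable lborel (\<lambda>x. indicator \<Omega> x * (u x * indicator A x))"
      if "u \<in> borel_measurable borel" "f \<in> frac_WL s G \<Omega>" "AE x in lebesgue. f x = u x" for u f
    proof -
      have "integrable (lebesgue_on \<Omega>) (\<lambda>x. f x * indicator A x)"
        by (rule frac_WL_integrable[OF that(2)]) (use A bdd in auto)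
      moreover have "(\<lambda>x. u x * indicator A x) \<in> borel_measurable (lebesgue_on \<Omega>)"
        using that(1) by (intro measurable_restrict_space1 borel_imp_lebesgue) auto
      moreover have "AE x in lebesgue_on \<Omega>. f x * indicator A x = u x * indicator A x"
        using AE_lebesgue_onI[OF that(3), of \<Omega>] by auto
      ultimately have "integrable (lebesgue_on \<Omega>) (\<lambda>x. u x * indicator A x)"
        by (rule integrable_cong_AE_imp)
      then show ?thesis using that(1) by (subst (asm) integral_lebesgue_on_borel(2)) auto
    qed
    have zero: "pairing s \<Omega> \<phi> test = 0" if \<phi>: "\<phi> \<in> Cc_infinity \<Omega>" "\<phi> \<in> frac_WL s G \<Omega>" for \<phi>
    proof -
      have b: "\<phi> \<in> borel_measurable borel"
        using \<phi>(1) by (intro borel_measurable_continuous_onI Ck_continuous[of 0]) (auto simp: Cc_infinity_def)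
      have 0: "\<phi> y = 0" if "y \<in> C" for y
      proof (rule ccontr)
        assume "\<phi> y \<noteq> 0"
        then have "y \<in> closure {x. \<phi> x \<noteq> 0}" using closure_subset[of "{x. \<phi> x \<noteq> 0}"] by blast
        then have "y \<in> \<Omega>" using \<phi>(1) by (auto simp: Cc_infinity_def)
        then show False using that by (simp add: C_def)
      qed
      have "pairing s \<Omega> \<phi> test = - (LINT z|(lborel \<Otimes>\<^sub>M lborel). ker z * \<phi> (snd z))"
        using 0 by (intro pairing_test(1)[OF b int[OF b \<phi>(2)], of 0]) auto
      also have "(LINT z|(lborel \<Otimes>\<^sub>M lborel). ker z * \<phi> (snd z)) = (LINT z|((lborel :: 'a measure) \<Otimes>\<^sub>M (lborel :: 'a measure)). 0)"
        using 0 by (intro Bochner_Integration.integral_cong) (auto simp: ker_def indicator_def)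
      finally show ?thesis by simp
    qed
    have "\<bar>pairing s \<Omega> v test\<bar> < \<epsilon>" if "\<epsilon> > 0" for \<epsilon>
      using v[unfolded frac_WL0_iff, THEN conjunct2, rule_format, of "{test}" \<epsilon>] that test_predual zero by force
    then have "pairing s \<Omega> v test = 0" by (metis abs_0_eq dense_ge_bounded less_irrefl linorder_neqE_linordered_idom abs_ge_zero zero_less_abs_iff)
    moreover have "pairing s \<Omega> v test = pairing s \<Omega> w test"
      using vw vWL test_meas orlicz_L_measurable[OF gauge_G, of "frac_D s v" frac_mu]
      by (intro pairing_cong_AE) (auto simp: frac_WL_def measurable_cong_sets[OF sets_frac_mu refl] intro!: borel_imp_lebesgue)
    moreover have Cm: "\<bar>w y\<bar> \<le> real m" if "y \<in> C" for y using that by (auto simp: C_def)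
    note pt = pairing_test[OF w int[OF w vWL vw] Cm]
    ultimately have "(LINT z|(lborel \<Otimes>\<^sub>M lborel). ker z * w (snd z)) = 0" using pt(1) by simp
    moreover have "0 \<le> ker z * w (snd z)" for z
    proof (cases "z \<in> A \<times> C")
      case True
      then have "w (snd z) > 0" by (auto simp: C_def)
      then show ?thesis using ker_bound(1)[of z] by simp
    qed (simp add: ker_def)
    ultimately have "AE z in lborel \<Otimes>\<^sub>M lborel. ker z * w (snd z) = 0"
      using integral_nonneg_eq_0_iff_AE[OF pt(2)] by simp
    then have "AE z in lborel \<Otimes>\<^sub>M lborel. z \<notin> A \<times> C"
    proof eventually_elim
      case (elim z)
      show ?case
      proof
        assume z: "z \<in> A \<times> C"
        then have "norm (fst z - snd z) > 0" using sep[of "fst z" "snd z"] d by (cases z) auto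
        then have "ker z \<noteq> 0" using z by (simp add: ker_def)
        moreover have "w (snd z) > 0" using z by (auto simp: C_def)
        ultimately show False using elim by simp
      qed
    qed
    then have "A \<times> C \<in> null_sets (lborel \<Otimes>\<^sub>M lborel)" by (subst AE_iff_null_sets) auto
    then have "emeasure lborel A * emeasure lborel C = 0"
      by (auto simp: lborel.emeasure_pair_measure_Times)
    moreover have "emeasure lborel A \<noteq> 0"
      using content_ball_pos[of "e/2" x0] e by (auto simp: A_def measure_def)
    ultimately have "emeasure lborel C = 0" by simp
    then have "C \<in> null_sets lborel" by auto
    from AE_not_in[OF this] show ?thesis by (simp add: C_def)
  qed
  then have "AE x in lborel. \<forall>m. x \<notin> {x \<in> cball 0 (real m). x \<notin> \<Omega> \<and> 0 < w x \<and> w x \<le> real m}"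
    by (subst AE_all_countable) blast
  then show ?thesis
  proof eventually_elim
    case (elim x)
    obtain m :: nat where "real m \<ge> max (norm x) (w x)" using real_arch_simple by blast
    then show ?case using elim[rule_format, of m] by auto
  qed
qed

lemma frac_WL0_zero_outside:
  fixes \<Omega> :: "'a::euclidean_space set"
  assumes v: "v \<in> frac_WL0 s G \<Omega>" and s: "s > 0" and \<Omega>: "open \<Omega>" "\<Omega> \<noteq> {}"
  shows "AE x in lebesgue. x \<notin> \<Omega> \<longrightarrow> v x = 0"
proof -
  obtain w where w: "w \<in> borel_measurable borel" and vw: "AE x in lebesgue. v x = w x"
    using borel_representative[of v] frac_WL0_subset[OF v] by (auto simp: frac_WL_def)
  have "AE x in lborel. x \<notin> \<Omega> \<longrightarrow> w x \<le> 0" by (rule frac_WL0_le_zero_outside[OF v s \<Omega> w vw])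
  moreover have "AE x in lborel. x \<notin> \<Omega> \<longrightarrow> - w x \<le> 0"
  proof (rule frac_WL0_le_zero_outside[OF _ s \<Omega>, of "\<lambda>x. - v x"])
    show "(\<lambda>x. - v x) \<in> frac_WL0 s G \<Omega>" using frac_WL0_lincomb[OF v v, of "-1" 0] by simp
  qed (use w vw in auto)
  ultimately have "AE x in lebesgue. (x \<notin> \<Omega> \<longrightarrow> w x \<le> 0) \<and> (x \<notin> \<Omega> \<longrightarrow> - w x \<le> 0)"
    by (intro AE_completion) auto
  then show ?thesis using vw by eventually_elim auto
qed

end

section \<open>Mollification of Lipschitz functions\<close>

lemma Ck_mult:
  fixes f g :: "'a::euclidean_space \<Rightarrow> real"
  assumes "Ck k f" "Ck k g"
  shows "Ck k (\<lambda>x. f x * g x)"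
  using assms
proof (induction k arbitrary: f g)
  case 0
  then show ?case by (auto intro!: continuous_intros)
next
  case (Suc k)
  have D: "frechet_derivative (\<lambda>x. f x * g x) (at x) = (\<lambda>h. f x * frechet_derivative g (at x) h + frechet_derivative f (at x) h * g x)" for x
  proof (rule frechet_derivative_at[symmetric])
    show "((\<lambda>x. f x * g x) has_derivative (\<lambda>h. f x * frechet_derivative g (at x) h + frechet_derivative f (at x) h * g x)) (at x)"
      using Suc.prems by (intro has_derivative_mult) (auto simp: frechet_derivative_works)
  qed
  have "Ck k (\<lambda>x. 1 * (f x * frechet_derivative g (at x) b) + 1 * (frechet_derivative f (at x) b * g x))" if "b \<in> Basis" for b
    using Suc.prems Suc.prems[THEN Ck_Suc_imp] that by (intro Ck_lincomb Suc.IH) auto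
  then show ?case using Suc.prems by (auto simp: D intro!: differentiable_mult)
qed

lemma Ck_scale:
  fixes f :: "'a::euclidean_space \<Rightarrow> real"
  assumes "Ck k f"
  shows "Ck k (\<lambda>x. f (c *\<^sub>R x))"
  using assms
proof (induction k arbitrary: f)
  case 0
  then show ?case by (auto intro!: continuous_on_compose2[of UNIV f] continuous_intros)
next
  case (Suc k)
  have d: "((\<lambda>x. f (c *\<^sub>R x)) has_derivative (\<lambda>h. c * frechet_derivative f (at (c *\<^sub>R x)) h)) (at x)" for x
  proof -
    have f: "(f has_derivative frechet_derivative f (at (c *\<^sub>R x))) (at (c *\<^sub>R x))"
      using Suc.prems by (auto simp: frechet_derivative_works)
    have "((\<lambda>x. f (c *\<^sub>R x)) has_derivative (\<lambda>h. frechet_derivative f (at (c *\<^sub>R x)) (c *\<^sub>R h))) (at x)"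
      by (rule has_derivative_compose[where g = f]) (use f in \<open>auto intro!: derivative_eq_intros\<close>)
    moreover have "frechet_derivative f (at (c *\<^sub>R x)) (c *\<^sub>R h) = c * frechet_derivative f (at (c *\<^sub>R x)) h" for h
      using linear_scale[OF has_derivative_linear[OF f]] by simp
    ultimately show ?thesis by simp
  qed
  have D: "frechet_derivative (\<lambda>x. f (c *\<^sub>R x)) (at x) = (\<lambda>h. c * frechet_derivative f (at (c *\<^sub>R x)) h)" for x
    by (rule frechet_derivative_at[OF d, symmetric])
  have "Ck k (\<lambda>x. c * frechet_derivative f (at (c *\<^sub>R x)) b + 0 * frechet_derivative f (at (c *\<^sub>R x)) b)" if "b \<in> Basis" for b
    using Suc.prems that Suc.IH[of "\<lambda>x. frechet_derivative f (at x) b"] by (intro Ck_lincomb) auto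
  then show ?case using d by (auto simp: D intro: differentiableI)
qed

text \<open>All derivatives fall on the smooth factor.\<close>

lemma Ck_convolution:
  fixes f \<rho> :: "'a::euclidean_space \<Rightarrow> real"
  assumes f: "continuous_on UNIV f" and "Ck k \<rho>"
  shows "Ck k (\<lambda>x. integral (cbox a b) (\<lambda>y. f y * \<rho> (x - y)))"
  using assms(2)
proof (induction k arbitrary: \<rho>)
  case 0
  then have \<rho>: "continuous_on UNIV \<rho>" by simp
  have "continuous_on (UNIV \<times> cbox a b) (\<lambda>(x, y). f y * \<rho> (x - y))"
    unfolding case_prod_beta
    by (intro continuous_on_mult continuous_on_compose2[OF f] continuous_on_compose2[OF \<rho>] continuous_intros) auto
  then show ?case using integral_continuous_on_param by simp
next
  case (Suc k)
  define fx where "fx x y = f y *\<^sub>R Blinfun (frechet_derivative \<rho> (at (x - y)))" for x y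
  have \<rho>: "(\<rho> has_derivative frechet_derivative \<rho> (at z)) (at z)" for z
    using Suc.prems by (auto simp: frechet_derivative_works)
  have ap: "blinfun_apply (fx x y) h = f y * frechet_derivative \<rho> (at (x - y)) h" for x y h
    using has_derivative_bounded_linear[OF \<rho>] by (simp add: fx_def bounded_linear_Blinfun_apply scaleR_blinfun.rep_eq)
  have d: "((\<lambda>x. integral (cbox a b) (\<lambda>y. f y * \<rho> (x - y))) has_derivative blinfun_apply (integral (cbox a b) (fx x0))) (at x0 within UNIV)" for x0
  proof (rule leibniz_rule)
    fix x y
    have "((\<lambda>x. \<rho> (x - y)) has_derivative (\<lambda>h. frechet_derivative \<rho> (at (x - y)) h)) (at x)"
      by (rule has_derivative_compose[where g = \<rho>]) (use \<rho>[of "x - y"] in \<open>auto intro!: derivative_eq_intros\<close>)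
    then have "((\<lambda>x. f y * \<rho> (x - y)) has_derivative (\<lambda>h. f y * frechet_derivative \<rho> (at (x - y)) h)) (at x)"
      by (rule has_derivative_mult_right)
    then show "((\<lambda>x. f y * \<rho> (x - y)) has_derivative blinfun_apply (fx x y)) (at x within UNIV)"
      by (simp add: ap[abs_def])
  next
    fix x
    show "(\<lambda>y. f y * \<rho> (x - y)) integrable_on cbox a b"
      by (intro integrable_continuous continuous_on_mult continuous_on_compose2[OF f]
          continuous_on_compose2[OF Ck_continuous[OF Suc.prems]] continuous_intros) auto
  next
    show "continuous_on (UNIV \<times> cbox a b) (\<lambda>(x, y). fx x y)"
    proof (rule continuous_on_blinfun_componentwise)
      fix i :: 'a assume i: "i \<in> Basis"
      then have c: "continuous_on UNIV (\<lambda>z. frechet_derivative \<rho> (at z) i)"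
        using Suc.prems Ck_continuous by auto
      show "continuous_on (UNIV \<times> cbox a b) (\<lambda>p. blinfun_apply (case p of (x, y) \<Rightarrow> fx x y) i)"
        unfolding case_prod_beta ap
        by (intro continuous_on_mult continuous_on_compose2[OF f] continuous_on_compose2[OF c] continuous_intros) auto
    qed
  qed auto
  have int: "fx x integrable_on cbox a b" for x
  proof (rule integrable_continuous, rule continuous_on_blinfun_componentwise)
    fix i :: 'a assume i: "i \<in> Basis"
    then have c: "continuous_on UNIV (\<lambda>z. frechet_derivative \<rho> (at z) i)"
      using Suc.prems Ck_continuous by auto
    show "continuous_on (cbox a b) (\<lambda>y. blinfun_apply (fx x y) i)"
      unfolding ap
      by (intro continuous_on_mult continuous_on_compose2[OF f] continuous_on_compose2[OF c] continuous_intros) auto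
  qed
  have D: "frechet_derivative (\<lambda>x. integral (cbox a b) (\<lambda>y. f y * \<rho> (x - y))) (at x) = 
      (\<lambda>h. integral (cbox a b) (\<lambda>y. f y * frechet_derivative \<rho> (at (x - y)) h))" for x
    using frechet_derivative_at[OF d[of x], symmetric] blinfun_apply_integral[OF int[of x]]
    by (simp add: ap fun_eq_iff)
  have "Ck k (\<lambda>x. integral (cbox a b) (\<lambda>y. f y * frechet_derivative \<rho> (at (x - y)) i))" if "i \<in> Basis" for i
    using Suc.prems that by (intro Suc.IH) auto
  then show ?case using d by (auto simp: D intro: differentiableI)
qed

lemma integrable_continuous_compact_support:
  fixes f :: "'a::euclidean_space \<Rightarrow> real"
  assumes "continuous_on UNIV f" "compact K" "\<And>x. x \<notin> K \<Longrightarrow> f x = 0"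
  shows "integrable lborel f"
proof -
  have "integrable lborel (\<lambda>x. indicator K x *\<^sub>R f x)"
    using assms continuous_on_subset by (intro borel_integrable_compact) blast+
  moreover have "(\<lambda>x. indicator K x *\<^sub>R f x) = f" using assms(3) by (auto simp: indicator_def fun_eq_iff)
  ultimately show ?thesis by simp
qed

lemma lborel_distr_reflect: "distr lborel borel (\<lambda>y. x - y) = (lborel :: 'a::euclidean_space measure)"
  by (subst lborel_affine[of "-1" x]) (auto simp: density_1)

text \<open>Any nonzero test function, squared, rescaled and normalised, is a kernel.\<close>

lemma exists_smooth_kernel:
  fixes \<phi> :: "'a::euclidean_space \<Rightarrow> real"
  assumes \<phi>: "\<phi> \<in> Cc_infinity \<Omega>" "\<phi> x0 \<noteq> 0" and \<delta>: "\<delta> > 0"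
  obtains \<rho> :: "'a \<Rightarrow> real" where "\<And>k. Ck k \<rho>" "\<And>z. 0 \<le> \<rho> z" "\<And>z. norm z \<ge> \<delta> \<Longrightarrow> \<rho> z = 0"
    "integrable lborel \<rho>" "(\<integral>z. \<rho> z \<partial>lborel) = 1"
proof -
  have "bounded {x. \<phi> x \<noteq> 0}" using \<phi>(1) bounded_subset[OF compact_imp_bounded closure_subset] by (auto simp: Cc_infinity_def)
  then obtain R where R: "R > 0" "{x. \<phi> x \<noteq> 0} \<subseteq> ball 0 R" using bounded_subset_ballD[of _ 0] by blast
  define k where "k = R / \<delta>"
  have k: "k > 0" using R \<delta> by (simp add: k_def)
  define t where "t z = \<phi> (k *\<^sub>R z) * \<phi> (k *\<^sub>R z)" for z
  have Ck: "Ck j t" for j unfolding t_def using \<phi> by (intro Ck_mult Ck_scale) (auto simp: Cc_infinity_def)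
  then have cont: "continuous_on UNIV t" using Ck_continuous by blast
  have supp: "t z = 0" if "norm z \<ge> \<delta>" for z
  proof -
    have "norm (k *\<^sub>R z) \<ge> R" using that R \<delta> by (simp add: k_def field_simps mult_left_mono)
    then show ?thesis using R(2) by (auto simp: t_def)
  qed
  have int: "integrable lborel t"
    by (rule integrable_continuous_compact_support[OF cont, of "cball 0 \<delta>"]) (auto intro: supp)
  define N where "N = (\<integral>z. t z \<partial>lborel)"
  have t0: "t z \<ge> 0" for z by (simp add: t_def)
  have "N \<noteq> 0"
  proof
    assume "N = 0"
    then have "AE z in lborel. t z = 0" unfolding N_def using t0 by (subst (asm) integral_nonneg_eq_0_iff_AE[OF int]) auto
    then have "AE z in lborel. z \<notin> {z. t z \<noteq> 0}" by auto
    moreover have op: "open {z. t z \<noteq> 0}" by (intro open_Collect_neq cont continuous_intros)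
    ultimately have "{z. t z \<noteq> 0} \<in> null_sets lborel" by (subst AE_iff_null_sets) auto
    then have "negligible {z. t z \<noteq> 0}" by (auto simp: negligible_iff_null_sets intro: null_sets_completionI)
    moreover have "x0 /\<^sub>R k \<in> {z. t z \<noteq> 0}" using k \<phi> by (simp add: t_def)
    ultimately show False using open_not_negligible[OF op] by blast
  qed
  moreover have "N \<ge> 0" unfolding N_def using t0 by (intro integral_nonneg_AE) auto
  ultimately have N: "N > 0" by simp
  show thesis
  proof (rule that[of "\<lambda>z. t z / N"])
    show "Ck j (\<lambda>z. t z / N)" for j
      using Ck_lincomb[OF Ck Ck, of j "1/N" 0] by simp
  qed (use N t0 supp int in \<open>auto simp: N_def\<close>)
qed

lemma lipschitz_continuous:
  fixes f :: "'a::euclidean_space \<Rightarrow> real"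
  assumes "\<And>x y. \<bar>f x - f y\<bar> \<le> C * norm (x - y)"
  shows "C \<ge> 0" "continuous_on UNIV f" "f \<in> borel_measurable borel"
proof -
  obtain b :: 'a where b: "b \<in> Basis" using nonempty_Basis by blast
  have "0 \<le> \<bar>f b - f 0\<bar>" by simp
  also have "\<dots> \<le> C * norm (b - 0)" by (rule assms)
  finally show C: "C \<ge> 0" using b by simp
  show cont: "continuous_on UNIV f"
    using assms C by (intro lipschitz_on_continuous_on[of C] lipschitz_onI) (auto simp: dist_norm)
  then show "f \<in> borel_measurable borel" by (rule borel_measurable_continuous_onI)
qed

text \<open>
  Convolution averages translates of \<open>f\<close>, which have the Lipschitz constant and the bound of \<open>f\<close>.
\<close>

lemma smooth_approximation:
  fixes f :: "'a::euclidean_space \<Rightarrow> real"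
  assumes \<phi>: "\<phi> \<in> Cc_infinity \<Omega>" "\<phi> x0 \<noteq> 0" and \<delta>: "\<delta> > 0"
    and f: "\<And>x y. \<bar>f x - f y\<bar> \<le> C * norm (x - y)" "\<And>x. x \<notin> K \<Longrightarrow> f x = 0" "\<And>x. \<bar>f x\<bar> \<le> m"
    and K: "compact K" and K': "(\<Union>x\<in>K. cball x \<delta>) \<subseteq> K'" "compact K'" "K' \<subseteq> \<Omega>"
  obtains h where "h \<in> Cc_infinity \<Omega>" "\<And>x y. \<bar>h x - h y\<bar> \<le> C * norm (x - y)" "\<And>x. x \<notin> K' \<Longrightarrow> h x = 0"
    "\<And>x. \<bar>h x\<bar> \<le> m" "\<And>x. \<bar>h x - f x\<bar> \<le> C * \<delta>"
proof -
  obtain \<rho> :: "'a \<Rightarrow> real" where \<rho>: "\<And>k. Ck k \<rho>" "\<And>z. 0 \<le> \<rho> z" "\<And>z. norm z \<ge> \<delta> \<Longrightarrow> \<rho> z = 0"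
    "integrable lborel \<rho>" "(\<integral>z. \<rho> z \<partial>lborel) = 1"
    using exists_smooth_kernel[OF \<phi> \<delta>] by blast
  have C: "C \<ge> 0" and fc: "continuous_on UNIV f" by (rule lipschitz_continuous[OF f(1)])+
  have \<rho>c: "continuous_on UNIV \<rho>" using \<rho>(1) Ck_continuous by blast
  have [measurable]: "f \<in> borel_measurable borel" "\<rho> \<in> borel_measurable borel"
    using fc \<rho>c by (auto intro: borel_measurable_continuous_onI)
  define h where "h x = (\<integral>w. \<rho> w * f (x - w) \<partial>lborel)" for x
  have int: "integrable lborel (\<lambda>w. \<rho> w * f (x - w))" for x
  proof (rule Bochner_Integration.integrable_bound)
    show "integrable lborel (\<lambda>w. m * \<rho> w)" using \<rho> by simp
    show "AE w in lborel. norm (\<rho> w * f (x - w)) \<le> norm (m * \<rho> w)"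
    proof (rule AE_I2)
      fix w
      have "\<bar>f (x - w)\<bar> \<le> \<bar>m\<bar>" using f(3)[of "x - w"] by simp
      then have "\<bar>\<rho> w\<bar> * \<bar>f (x - w)\<bar> \<le> \<bar>\<rho> w\<bar> * \<bar>m\<bar>" by (rule mult_left_mono) simp
      then show "norm (\<rho> w * f (x - w)) \<le> norm (m * \<rho> w)" by (simp add: abs_mult mult.commute)
    qed
  qed measurable
  have bound: "\<bar>\<integral>w. \<rho> w * F w \<partial>lborel\<bar> \<le> c" if "\<And>w. norm w < \<delta> \<Longrightarrow> \<bar>F w\<bar> \<le> c" "integrable lborel (\<lambda>w. \<rho> w * F w)" for F c
  proof -
    have "\<bar>\<integral>w. \<rho> w * F w \<partial>lborel\<bar> \<le> (\<integral>w. c * \<rho> w \<partial>lborel)"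
    proof (rule integral_abs_bound_integral[OF that(2)])
      show "integrable lborel (\<lambda>w. c * \<rho> w)" using \<rho> by simp
      show "\<bar>\<rho> w * F w\<bar> \<le> c * \<rho> w" for w
        using that(1)[of w] \<rho>(2,3)[of w] by (cases "norm w < \<delta>") (auto simp: abs_mult mult.commute[of c] mult_left_mono)
    qed
    then show ?thesis using \<rho>(5) by simp
  qed
  have L: "\<bar>h x - h y\<bar> \<le> C * norm (x - y)" for x y
  proof -
    have "h x - h y = (\<integral>w. \<rho> w * (f (x - w) - f (y - w)) \<partial>lborel)"
      using int by (simp add: h_def right_diff_distrib)
    also have "\<bar>\<dots>\<bar> \<le> C * norm (x - y)"
    proof (rule bound)
      show "\<bar>f (x - w) - f (y - w)\<bar> \<le> C * norm (x - y)" for w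
        using f(1)[of "x - w" "y - w"] by simp
      show "integrable lborel (\<lambda>w. \<rho> w * (f (x - w) - f (y - w)))"
        using int by (simp add: right_diff_distrib)
    qed
    finally show ?thesis .
  qed
  have M: "\<bar>h x\<bar> \<le> m" for x unfolding h_def by (intro bound f int)
  have A: "\<bar>h x - f x\<bar> \<le> C * \<delta>" for x
  proof -
    have "h x - f x = (\<integral>w. \<rho> w * (f (x - w) - f x) \<partial>lborel)"
      using int \<rho> by (simp add: h_def right_diff_distrib)
    also have "\<bar>\<dots>\<bar> \<le> C * \<delta>"
    proof (rule bound)
      show "\<bar>f (x - w) - f x\<bar> \<le> C * \<delta>" if "norm w < \<delta>" for w
        using f(1)[of "x - w" x] that C mult_left_mono[of "norm w" \<delta> C] by simp
      show "integrable lborel (\<lambda>w. \<rho> w * (f (x - w) - f x))"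
        using int \<rho> by (simp add: right_diff_distrib)
    qed
    finally show ?thesis .
  qed
  have Z: "h x = 0" if "x \<notin> K'" for x
  proof -
    have "\<rho> w * f (x - w) = 0" for w
    proof (cases "norm w < \<delta>")
      case True
      then have "x \<in> cball (x - w) \<delta>" by (simp add: dist_norm)
      then have "x - w \<notin> K" using K'(1) that by blast
      then show ?thesis using f(2) by simp
    qed (use \<rho>(3) in simp)
    then show ?thesis unfolding h_def by (simp only: Bochner_Integration.integral_zero)
  qed
  obtain a b where ab: "K \<subseteq> cbox a b" using bounded_subset_cbox_symmetric[OF compact_imp_bounded[OF K]] by metis
  have "h = (\<lambda>x. integral (cbox a b) (\<lambda>y. f y * \<rho> (x - y)))"
  proof
    fix x
    have intf: "integrable lborel (\<lambda>y. f y * \<rho> (x - y))" 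
    proof (rule integrable_continuous_compact_support[OF _ K])
      show "continuous_on UNIV (\<lambda>y. f y * \<rho> (x - y))"
        by (intro continuous_on_mult fc continuous_on_compose2[OF \<rho>c] continuous_intros) auto
    qed (simp add: f)
    have "h x = (\<integral>y. \<rho> (x - y) * f y \<partial>lborel)"
    proof -
      have "(\<integral>w. \<rho> w * f (x - w) \<partial>lborel) = (\<integral>w. \<rho> w * f (x - w) \<partial>distr lborel borel (\<lambda>y. x - y))"
        by (simp add: lborel_distr_reflect)
      then show ?thesis by (subst (asm) integral_distr) (auto simp: h_def)
    qed
    also have "\<dots> = integral UNIV (\<lambda>y. f y * \<rho> (x - y))"
      using integral_lborel[OF intf] by (simp add: mult.commute)
    also have "\<dots> = integral UNIV (\<lambda>y. if y \<in> cbox a b then f y * \<rho> (x - y) else 0)"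
      using ab f(2) by (intro integral_cong) auto
    also have "\<dots> = integral (cbox a b) (\<lambda>y. f y * \<rho> (x - y))" by (rule Henstock_Kurzweil_Integration.integral_restrict_UNIV)
    finally show "h x = integral (cbox a b) (\<lambda>y. f y * \<rho> (x - y))" .
  qed
  then have Ckh: "Ck k h" for k using Ck_convolution[OF fc \<rho>(1)] by simp
  have "closure {x. h x \<noteq> 0} \<subseteq> K'"
    using Z K'(2) by (intro closure_minimal) (auto intro: compact_imp_closed)
  moreover from this have "compact (closure {x. h x \<noteq> 0})"
    using K'(2) by (metis closed_closure compact_Int_closed inf.absorb_iff2)
  ultimately have "h \<in> Cc_infinity \<Omega>" using Ckh K'(3) by (auto simp: Cc_infinity_def)
  then show thesis using that L Z M A by blast
qed

section \<open>The energy of Lipschitz functions\<close>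

text \<open>
  For bounded Lipschitz \<open>f\<close> the quotient of \<open>f x - f y\<close> and \<open>|x - y|\<^sup>s\<close> is at most a multiple of
  this function at \<open>x - y\<close>.
\<close>

definition near_kernel :: "real \<Rightarrow> 'a::euclidean_space \<Rightarrow> real" where
  "near_kernel s z = min 1 (norm z) / norm z powr s"

lemma near_kernel_nonneg: "0 \<le> near_kernel s z"
  by (simp add: near_kernel_def)

lemma near_kernel_le_1:
  assumes "0 < s" "s < 1" shows "near_kernel s z \<le> 1"
proof (cases "z = 0")
  case False
  then have z: "norm z > 0" by simp
  have "min 1 (norm z) \<le> norm z powr s"
  proof (cases "norm z \<ge> 1")
    case True
    then show ?thesis using ge_one_powr_ge_zero[of "norm z" s] assms by simp
  next
    case F: False
    then have "norm z powr 1 \<le> norm z powr s" using assms z by (intro powr_mono') auto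
    then show ?thesis using z by simp
  qed
  then show ?thesis using z by (simp add: near_kernel_def)
qed (simp add: near_kernel_def)

lemma near_kernel_measurable [measurable]: "near_kernel s \<in> borel_measurable borel"
  unfolding near_kernel_def by measurable

lemma near_kernel_dyadic:
  fixes z :: "'a::euclidean_space"
  assumes s: "0 < s" "s < 1" and z: "z \<noteq> 0"
  shows "(\<exists>k. norm z < 2 ^ Suc k \<and> near_kernel s z / norm z ^ DIM('a) \<le> 1 / ((2 ^ k) powr s * (2 ^ k) ^ DIM('a))) \<or>
     (\<exists>k. norm z < (1/2) ^ k \<and> near_kernel s z / norm z ^ DIM('a) \<le> (1/2) ^ k / (((1/2) ^ Suc k) powr s * ((1/2) ^ Suc k) ^ DIM('a)))"
proof -
  have z0: "norm z > 0" using z by simp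
  have gen: "near_kernel s z / norm z ^ DIM('a) \<le> m / (a powr s * a ^ DIM('a))" if "0 < a" "a \<le> norm z" "min 1 (norm z) \<le> m" for a m
    unfolding near_kernel_def divide_divide_eq_left using that s z0
    by (intro frac_le mult_mono powr_mono2 power_mono) auto
  show ?thesis
  proof (cases "norm z \<ge> 1")
    case True
    obtain k0 where "norm z < 2 ^ k0" using real_arch_pow[of 2 "norm z"] by auto
    then have ex: "norm z < 2 ^ Suc k0" by (rule less_le_trans) simp
    define k where "k = (LEAST k. norm z < 2 ^ Suc k)"
    have k: "norm z < 2 ^ Suc k" unfolding k_def by (rule LeastI[of _ k0]) (rule ex)
    have "2 ^ k \<le> norm z"
    proof (cases k)
      case (Suc j)
      then have "\<not> norm z < 2 ^ Suc j" using not_less_Least[of j "\<lambda>k. norm z < 2 ^ Suc k"] by (simp add: k_def)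
      then show ?thesis using Suc by simp
    qed (use True in simp)
    from gen[OF _ this, of 1] k show ?thesis by auto
  next
    case False
    obtain k0 where "(1/2) ^ k0 < norm z" using real_arch_pow_inv[OF z0, of "1/2"] by auto
    moreover have "(1/2) ^ Suc k0 \<le> (1/2::real) ^ k0" by simp
    ultimately have ex: "(1/2) ^ Suc k0 \<le> norm z" by linarith
    define k where "k = (LEAST k. (1/2) ^ Suc k \<le> norm z)"
    have k: "(1/2) ^ Suc k \<le> norm z" unfolding k_def by (rule LeastI[of _ k0]) (rule ex)
    have lt: "norm z < (1/2) ^ k"
    proof (cases k)
      case (Suc j)
      then have "\<not> (1/2) ^ Suc j \<le> norm z" using not_less_Least[of j "\<lambda>k. (1/2) ^ Suc k \<le> norm z"] by (simp add: k_def)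
      then show ?thesis using Suc by simp
    qed (use False in simp)
    from gen[OF _ k, of "(1/2) ^ k"] lt show ?thesis by auto
  qed
qed

text \<open>
  The dyadic annuli near the origin contribute a geometric series with ratio \<open>2\<^sup>s / 2\<close>, and those
  near infinity one with ratio \<open>1 / 2\<^sup>s\<close>.
\<close>

lemma near_kernel_integral:
  assumes s: "0 < s" "s < 1"
  shows "(\<integral>\<^sup>+z. ennreal (near_kernel s (z::'a::euclidean_space) / norm z ^ DIM('a)) \<partial>lborel) < \<infinity>"
proof -
  let ?n = "DIM('a)"
  define a where "a k = 1 / ((2 ^ k) powr s * (2 ^ k) ^ ?n)" for k :: nat
  define b where "b k = (1/2) ^ k / (((1/2) ^ Suc k) powr s * ((1/2) ^ Suc k) ^ ?n)" for k :: nat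
  define B where "B k = ball (0::'a) (2 ^ Suc k)" for k
  define C where "C k = ball (0::'a) ((1/2) ^ k)" for k
  define \<omega> where "\<omega> = unit_ball_vol (real ?n)"
  have \<omega>: "\<omega> \<ge> 0" by (simp add: \<omega>_def)
  define q where "q = 2 powr s"
  have q: "1 < q" "q < 2"
    using s powr_less_mono[of s 1 2] by (auto simp: q_def gr_one_powr)
  have pk: "(2 ^ k) powr s = q ^ k" for k :: nat
    unfolding q_def by (simp add: powr_power powr_powr mult.commute flip: powr_realpow)
  have nn: "0 \<le> a k" "0 \<le> b k" for k by (auto simp: a_def b_def)
  have [measurable]: "B k \<in> sets borel" "C k \<in> sets borel" for k by (auto simp: B_def C_def)
  have "(\<integral>\<^sup>+z. ennreal (near_kernel s (z::'a) / norm z ^ ?n) \<partial>lborel) \<le>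
     (\<integral>\<^sup>+z. (\<Sum>k. ennreal (a k) * indicator (B k) z) + (\<Sum>k. ennreal (b k) * indicator (C k) z) \<partial>lborel)"
  proof (rule nn_integral_mono)
    fix z :: 'a
    show "ennreal (near_kernel s z / norm z ^ ?n) \<le> (\<Sum>k. ennreal (a k) * indicator (B k) z) + (\<Sum>k. ennreal (b k) * indicator (C k) z)"
    proof (cases "z = 0")
      case False
      have le: "f k \<le> (\<Sum>k. f k)" for f :: "nat \<Rightarrow> ennreal" and k
        using sum_le_suminf[of f "{k}"] by simp
      from near_kernel_dyadic[OF s False] show ?thesis
      proof (elim disjE exE conjE)
        fix k assume k: "norm z < 2 ^ Suc k" "near_kernel s z / norm z ^ ?n \<le> 1 / ((2 ^ k) powr s * (2 ^ k) ^ ?n)"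
        have "ennreal (near_kernel s z / norm z ^ ?n) \<le> ennreal (a k) * indicator (B k) z"
          using k by (auto simp: a_def B_def intro: ennreal_leI)
        also have "\<dots> \<le> (\<Sum>k. ennreal (a k) * indicator (B k) z)" by (rule le)
        finally show ?thesis by (rule add_increasing2[rotated]) simp
      next
        fix k assume k: "norm z < (1/2) ^ k" "near_kernel s z / norm z ^ ?n \<le> (1/2) ^ k / (((1/2) ^ Suc k) powr s * ((1/2) ^ Suc k) ^ ?n)"
        have "ennreal (near_kernel s z / norm z ^ ?n) \<le> ennreal (b k) * indicator (C k) z"
          using k by (auto simp: b_def C_def intro: ennreal_leI)
        also have "\<dots> \<le> (\<Sum>k. ennreal (b k) * indicator (C k) z)" by (rule le)
        finally show ?thesis by (rule add_increasing[rotated]) simp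
      qed
    qed (simp add: near_kernel_def)
  qed
  also have "\<dots> = (\<integral>\<^sup>+z. (\<Sum>k. ennreal (a k) * indicator (B k) z) \<partial>lborel) + (\<integral>\<^sup>+z. (\<Sum>k. ennreal (b k) * indicator (C k) z) \<partial>lborel)"
    by (rule nn_integral_add) auto
  also have "(\<integral>\<^sup>+z. (\<Sum>k. ennreal (a k) * indicator (B k) z) \<partial>lborel) = (\<Sum>k. ennreal (a k) * emeasure lborel (B k))"
    by (subst nn_integral_suminf) (auto simp: nn_integral_cmult_indicator)
  also have "\<dots> = (\<Sum>k. ennreal (\<omega> * 2 ^ ?n * ((1 / q) ^ k)))"
  proof (intro suminf_cong)
    fix k
    have "a k * (\<omega> * (2 ^ Suc k) ^ ?n) = \<omega> * 2 ^ ?n * ((1 / q) ^ k)"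
      unfolding a_def pk power_Suc power_mult_distrib power_one_over by simp
    note eq = this
    have "emeasure lborel (B k) = ennreal (\<omega> * (2 ^ Suc k) ^ ?n)"
      unfolding B_def \<omega>_def by (rule emeasure_ball) simp
    then have "ennreal (a k) * emeasure lborel (B k) = ennreal (a k * (\<omega> * (2 ^ Suc k) ^ ?n))"
      using nn[of k] \<omega> by (simp only:) (rule ennreal_mult[symmetric], auto)
    then show "ennreal (a k) * emeasure lborel (B k) = ennreal (\<omega> * 2 ^ ?n * ((1 / q) ^ k))"
      unfolding eq .
  qed
  also have "(\<integral>\<^sup>+z. (\<Sum>k. ennreal (b k) * indicator (C k) z) \<partial>lborel) = (\<Sum>k. ennreal (b k) * emeasure lborel (C k))"
    by (subst nn_integral_suminf) (auto simp: nn_integral_cmult_indicator)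
  also have "\<dots> = (\<Sum>k. ennreal (\<omega> * 2 ^ ?n * q * ((q / 2) ^ k)))"
  proof (intro suminf_cong)
    fix k
    have "b k * (\<omega> * ((1/2) ^ k) ^ ?n) = \<omega> * 2 ^ ?n * q * ((q / 2) ^ k)"
    proof -
      have "((1/2::real) ^ Suc k) powr s = (1 / 2 ^ Suc k) powr s" by (simp add: power_one_over)
      also have "\<dots> = 1 / q ^ Suc k" by (simp only: powr_divide powr_one_eq_one pk)
      finally have 1: "((1/2::real) ^ Suc k) powr s = 1 / q ^ Suc k" .
      have 2: "((1/2::real) ^ Suc k) ^ ?n = ((1/2) ^ k) ^ ?n / 2 ^ ?n"
        by (simp add: power_mult_distrib power_one_over)
      show ?thesis unfolding b_def 1 2 using q by (simp add: power_divide power_one_over)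
    qed
    note eq = this
    have "emeasure lborel (C k) = ennreal (\<omega> * ((1/2) ^ k) ^ ?n)"
      unfolding C_def \<omega>_def by (rule emeasure_ball) simp
    then have "ennreal (b k) * emeasure lborel (C k) = ennreal (b k * (\<omega> * ((1/2) ^ k) ^ ?n))"
      using nn[of k] \<omega> by (simp only:) (rule ennreal_mult[symmetric], auto)
    then show "ennreal (b k) * emeasure lborel (C k) = ennreal (\<omega> * 2 ^ ?n * q * ((q / 2) ^ k))"
      unfolding eq .
  qed
  also have "(\<Sum>k. ennreal (\<omega> * 2 ^ ?n * ((1 / q) ^ k))) + (\<Sum>k. ennreal (\<omega> * 2 ^ ?n * q * ((q / 2) ^ k))) < \<infinity>"
  proof -
    have "summable (\<lambda>k. \<omega> * 2 ^ ?n * ((1 / q) ^ k))" "summable (\<lambda>k. \<omega> * 2 ^ ?n * q * ((q / 2) ^ k))"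
      using q by (auto intro!: summable_mult summable_geometric)
    then have "(\<Sum>k. ennreal (\<omega> * 2 ^ ?n * ((1 / q) ^ k))) \<noteq> top" "(\<Sum>k. ennreal (\<omega> * 2 ^ ?n * q * ((q / 2) ^ k))) \<noteq> top"
      using \<omega> q by (intro ennreal_suminf_neq_top; simp)+
    then show ?thesis
      unfolding infinity_ennreal_def less_top ennreal_add_less_top by blast
  qed
  finally show ?thesis .
qed

definition lip_majorant :: "real \<Rightarrow> 'a::euclidean_space set \<Rightarrow> 'a \<times> 'a \<Rightarrow> real" where
  "lip_majorant s K z = near_kernel s (fst z - snd z) * (indicator K (fst z) + indicator K (snd z))"

lemma lip_majorant_bounds:
  assumes "0 < s" "s < 1" shows "0 \<le> lip_majorant s K z" "lip_majorant s K z \<le> 2"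
proof -
  show "0 \<le> lip_majorant s K z" by (simp add: lip_majorant_def near_kernel_nonneg)
  have "lip_majorant s K z \<le> 1 * (1 + 1)"
    unfolding lip_majorant_def using near_kernel_le_1[OF assms] 
    by (intro mult_mono add_mono) (auto simp: indicator_def)
  then show "lip_majorant s K z \<le> 2" by simp
qed

lemma lip_majorant_measurable [measurable]:
  assumes [measurable]: "K \<in> sets borel"
  shows "lip_majorant s K \<in> borel_measurable (borel :: ('a::euclidean_space \<times> 'a) measure)"
  unfolding lip_majorant_def[abs_def] borel_prod[symmetric] by measurable

lemma nn_integral_lborel_shift:
  fixes f :: "'a::euclidean_space \<Rightarrow> ennreal"
  assumes [measurable]: "f \<in> borel_measurable borel"
  shows "(\<integral>\<^sup>+y. f (y - x) \<partial>lborel) = (\<integral>\<^sup>+y. f y \<partial>lborel)"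
proof -
  have "(\<integral>\<^sup>+y. f y \<partial>distr lborel borel ((+) (- x))) = (\<integral>\<^sup>+y. f (- x + y) \<partial>lborel)"
    by (rule nn_integral_distr) auto
  then show ?thesis by (simp add: lborel_distr_plus)
qed

lemma lip_majorant_integral:
  assumes s: "0 < s" "s < 1" and K: "bounded K" and [measurable]: "K \<in> sets borel"
  shows "(\<integral>\<^sup>+z. ennreal (lip_majorant s K z) \<partial>(frac_mu :: ('a::euclidean_space \<times> 'a) measure)) < \<infinity>"
proof -
  let ?n = "DIM('a)"
  define q where "q z = ennreal (near_kernel s (z::'a) / norm z ^ ?n)" for z
  have [measurable]: "q \<in> borel_measurable borel" unfolding q_def by measurable
  have sym: "q (x - y) = q (y - x)" for x y by (simp add: q_def near_kernel_def norm_minus_commute)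
  have q: "(\<integral>\<^sup>+y. q (y - x) \<partial>lborel) = (\<integral>\<^sup>+y. q y \<partial>lborel)" for x
    by (rule nn_integral_lborel_shift) simp
  have q': "(\<integral>\<^sup>+y. q (x - y) \<partial>lborel) = (\<integral>\<^sup>+y. q y \<partial>lborel)" for x
    unfolding sym[of x] by (rule q)
  have one: "(\<integral>\<^sup>+x. \<integral>\<^sup>+y. q (x - y) * indicator K x \<partial>lborel \<partial>lborel) = (\<integral>\<^sup>+y. q y \<partial>lborel) * emeasure lborel K"
    by (simp add: nn_integral_multc nn_integral_cmult q')
  have "(\<integral>\<^sup>+z. ennreal (lip_majorant s K z) \<partial>(frac_mu :: ('a \<times> 'a) measure)) =
     (\<integral>\<^sup>+x. \<integral>\<^sup>+y. ennreal (1 / norm (x - y) ^ ?n) * ennreal (lip_majorant s K (x, y)) \<partial>lborel \<partial>lborel)"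
    by (rule nn_integral_frac_mu) measurable
  also have "\<dots> = (\<integral>\<^sup>+x. \<integral>\<^sup>+y. q (x - y) * indicator K x + q (x - y) * indicator K y \<partial>lborel \<partial>lborel)"
  proof (intro nn_integral_cong)
    fix x y :: 'a
    have "ennreal (1 / norm (x - y) ^ ?n) * ennreal (lip_majorant s K (x, y))
      = q (x - y) * ennreal (indicator K x + indicator K y)"
      unfolding q_def by (subst (1 2) ennreal_mult[symmetric]) (auto simp: lip_majorant_def near_kernel_nonneg)
    also have "\<dots> = q (x - y) * indicator K x + q (x - y) * indicator K y"
      by (simp add: distrib_left ennreal_indicator[symmetric])
    finally show "ennreal (1 / norm (x - y) ^ ?n) * ennreal (lip_majorant s K (x, y)) = q (x - y) * indicator K x + q (x - y) * indicator K y" .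
  qed
  also have "\<dots> = (\<integral>\<^sup>+x. \<integral>\<^sup>+y. q (x - y) * indicator K x \<partial>lborel \<partial>lborel) + (\<integral>\<^sup>+x. \<integral>\<^sup>+y. q (x - y) * indicator K y \<partial>lborel \<partial>lborel)"
    by (simp add: nn_integral_add)
  also have "(\<integral>\<^sup>+x. \<integral>\<^sup>+y. q (x - y) * indicator K y \<partial>lborel \<partial>lborel) = (\<integral>\<^sup>+y. \<integral>\<^sup>+x. q (x - y) * indicator K y \<partial>lborel \<partial>lborel)"
    by (rule lborel_pair.Fubini') measurable
  also have "\<dots> = (\<integral>\<^sup>+y. q y \<partial>lborel) * emeasure lborel K"
    by (simp add: nn_integral_multc nn_integral_cmult q)
  also note one
  also have "(\<integral>\<^sup>+y. q y \<partial>lborel) * emeasure lborel K + (\<integral>\<^sup>+y. q y \<partial>lborel) * emeasure lborel K < \<infinity>"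
    using near_kernel_integral[OF s, where 'a = 'a] emeasure_bounded_finite[OF K]
    by (simp add: q_def ennreal_mult_less_top)
  finally show ?thesis .
qed

text \<open>
  The majorant is bounded and integrable, and by convexity \<open>G\<close> is below a linear function on a
  bounded interval.
\<close>

lemma (in young) lip_majorant_modular:
  assumes s: "0 < s" "s < 1" and K: "bounded K" "K \<in> sets borel"
  shows "integrable (frac_mu :: ('a::euclidean_space \<times> 'a) measure) (\<lambda>z. G \<bar>c * lip_majorant s K z\<bar>)"
proof -
  have [measurable]: "lip_majorant s K \<in> borel_measurable (frac_mu :: ('a \<times> 'a) measure)"
    using K(2) by (auto simp: measurable_cong_sets[OF sets_frac_mu refl] intro!: borel_imp_lebesgue)
  have i: "integrable (frac_mu :: ('a \<times> 'a) measure) (lip_majorant s K)"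
    using lip_majorant_integral[OF s K] lip_majorant_bounds[OF s] by (subst integrable_nonneg_iff) auto
  show ?thesis
  proof (rule Bochner_Integration.integrable_bound)
    show "integrable frac_mu (\<lambda>z :: 'a \<times> 'a. G (2 * \<bar>c\<bar>) * lip_majorant s K z)" using i by simp
    show "(\<lambda>z :: 'a \<times> 'a. G \<bar>c * lip_majorant s K z\<bar>) \<in> borel_measurable frac_mu"
      by (intro gauge_measurable[OF gauge_G]) simp
    show "AE z :: 'a \<times> 'a in frac_mu. norm (G \<bar>c * lip_majorant s K z\<bar>) \<le> norm (G (2 * \<bar>c\<bar>) * lip_majorant s K z)"
    proof (rule AE_I2)
      fix z :: "'a \<times> 'a"
      note b = lip_majorant_bounds[OF s, of K z]
      have "G \<bar>c * lip_majorant s K z\<bar> = G ((lip_majorant s K z / 2) * (2 * \<bar>c\<bar>))"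
        using b by (simp add: abs_mult mult.commute)
      also have "\<dots> \<le> (lip_majorant s K z / 2) * G (2 * \<bar>c\<bar>)"
        using b by (intro gauge_scale[OF gauge_G]) auto
      also have "\<dots> \<le> G (2 * \<bar>c\<bar>) * lip_majorant s K z"
        using b G_nonneg[of "2 * \<bar>c\<bar>"] by (simp add: mult.commute)
      finally show "norm (G \<bar>c * lip_majorant s K z\<bar>) \<le> norm (G (2 * \<bar>c\<bar>) * lip_majorant s K z)"
        using b G_nonneg by simp
    qed
  qed
qed

lemma frac_D_lip_bound:
  fixes f :: "'a::euclidean_space \<Rightarrow> real"
  assumes f: "\<And>x y. \<bar>f x - f y\<bar> \<le> C * norm (x - y)" "\<And>x. x \<notin> K \<Longrightarrow> f x = 0" "\<And>x. \<bar>f x\<bar> \<le> m"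
  shows "\<bar>frac_D s f z\<bar> \<le> max C (2 * m) * lip_majorant s K z"
proof -
  obtain x y where z: "z = (x, y)" by (cases z)
  have m: "m \<ge> 0" using f(3)[of 0] by simp
  then have M: "max C (2 * m) \<ge> 0" by simp
  show ?thesis
  proof (cases "x \<in> K \<or> y \<in> K")
    case True
    have "\<bar>f x - f y\<bar> \<le> max C (2 * m) * min 1 (norm (x - y))"
    proof (cases "norm (x - y) \<le> 1")
      case True
      have "\<bar>f x - f y\<bar> \<le> C * norm (x - y)" by (rule f)
      also have "\<dots> \<le> max C (2 * m) * norm (x - y)" by (intro mult_right_mono) auto
      finally show ?thesis using True by simp
    next
      case False
      have "\<bar>f x - f y\<bar> \<le> 2 * m" using f(3)[of x] f(3)[of y] by linarith
      then show ?thesis using False by simp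
    qed
    then have "\<bar>frac_D s f z\<bar> \<le> max C (2 * m) * near_kernel s (x - y)"
      by (simp add: z frac_D_def near_kernel_def abs_mult divide_right_mono)
    also have "\<dots> \<le> max C (2 * m) * lip_majorant s K z"
      using M True near_kernel_nonneg[of s "x - y"]
      by (intro mult_left_mono) (auto simp: lip_majorant_def z indicator_def)
    finally show ?thesis .
  next
    case False
    then show ?thesis using M f(2) by (simp add: z frac_D_def lip_majorant_def)
  qed
qed

context young begin

lemma bounded_orlicz_L:
  assumes "\<Omega> \<in> sets borel" "bounded \<Omega>" "f \<in> borel_measurable borel" "\<And>x. \<bar>f x\<bar> \<le> m"
  shows "f \<in> orlicz_L G (lebesgue_on (\<Omega> :: 'a::euclidean_space set))"
proof -
  have "f \<in> bounded_fin_supp (lebesgue_on \<Omega>)"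
    unfolding bounded_fin_supp_def
  proof (intro CollectI conjI)
    show 1: "f \<in> borel_measurable (lebesgue_on \<Omega>)"
      using assms by (intro measurable_restrict_space1 borel_imp_lebesgue)
    show "\<exists>B. \<forall>x\<in>space (lebesgue_on \<Omega>). \<bar>f x\<bar> \<le> B" using assms(4) by blast
    have "emeasure (lebesgue_on \<Omega>) {x \<in> space (lebesgue_on \<Omega>). f x \<noteq> 0} \<le> emeasure (lebesgue_on \<Omega>) (space (lebesgue_on \<Omega>))"
      by (rule emeasure_space)
    also have "\<dots> = emeasure lborel \<Omega>" using assms by (simp add: emeasure_restrict_space)
    also have "\<dots> < \<infinity>" using emeasure_bounded_finite[OF assms(2)] .
    finally show "emeasure (lebesgue_on \<Omega>) {x \<in> space (lebesgue_on \<Omega>). f x \<noteq> 0} < \<infinity>" .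
  qed
  then show ?thesis using bounded_fin_supp_orlicz_E[OF gauge_G] by (auto simp: orlicz_E_def)
qed

lemma lipschitz_frac_D_integrable:
  fixes f :: "'a::euclidean_space \<Rightarrow> real"
  assumes s: "0 < s" "s < 1" 
    and f: "\<And>x y. \<bar>f x - f y\<bar> \<le> C * norm (x - y)" "\<And>x. x \<notin> K \<Longrightarrow> f x = 0" "\<And>x. \<bar>f x\<bar> \<le> m"
    and K: "bounded K" "K \<in> sets borel"
  shows "integrable frac_mu (\<lambda>z. G \<bar>c * frac_D s f z\<bar>)"
proof (rule Bochner_Integration.integrable_bound)
  let ?c = "\<bar>c\<bar> * max C (2 * m)"
  show "integrable frac_mu (\<lambda>z. G \<bar>?c * lip_majorant s K z\<bar>)" by (rule lip_majorant_modular[OF s K])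
  have [measurable]: "frac_D s f \<in> borel_measurable frac_mu"
    using lipschitz_continuous(3)[OF f(1)] by (auto simp: measurable_cong_sets[OF sets_frac_mu refl] intro!: borel_imp_lebesgue)
  show "(\<lambda>z. G \<bar>c * frac_D s f z\<bar>) \<in> borel_measurable frac_mu"
    by (intro gauge_measurable[OF gauge_G]) simp
  show "AE z in frac_mu. norm (G \<bar>c * frac_D s f z\<bar>) \<le> norm (G \<bar>?c * lip_majorant s K z\<bar>)"
  proof (rule AE_I2)
    fix z
    have m: "m \<ge> 0" using f(3)[of 0] by simp
    have "\<bar>c * frac_D s f z\<bar> \<le> \<bar>c\<bar> * (max C (2 * m) * lip_majorant s K z)"
      unfolding abs_mult by (intro mult_left_mono frac_D_lip_bound f) auto
    also have "\<dots> \<le> \<bar>?c * lip_majorant s K z\<bar>" by (simp only: mult.assoc abs_ge_self)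
    finally have "G \<bar>c * frac_D s f z\<bar> \<le> G \<bar>?c * lip_majorant s K z\<bar>" by (intro G_mono) auto
    then show "norm (G \<bar>c * frac_D s f z\<bar>) \<le> norm (G \<bar>?c * lip_majorant s K z\<bar>)" by (simp add: G_nonneg)
  qed
qed

lemma lipschitz_frac_WL:
  fixes f :: "'a::euclidean_space \<Rightarrow> real"
  assumes s: "0 < s" "s < 1" and \<Omega>: "bounded \<Omega>" "\<Omega> \<in> sets borel"
    and f: "\<And>x y. \<bar>f x - f y\<bar> \<le> C * norm (x - y)" "\<And>x. x \<notin> K \<Longrightarrow> f x = 0" "\<And>x. \<bar>f x\<bar> \<le> m"
    and K: "bounded K" "K \<in> sets borel"
  shows "f \<in> frac_WL s G \<Omega>"
proof -
  have b: "f \<in> borel_measurable borel" by (rule lipschitz_continuous(3)[OF f(1)])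
  have "frac_D s f \<in> orlicz_L G frac_mu"
    using lipschitz_frac_D_integrable[OF s f K, of 1] b
    by (intro orlicz_LI[OF gauge_G, of _ _ 1]) (auto simp: measurable_cong_sets[OF sets_frac_mu refl] intro!: borel_imp_lebesgue)
  then show ?thesis
    using bounded_orlicz_L[OF \<Omega>(2,1) b f(3)] b by (auto simp: frac_WL_def intro: borel_imp_lebesgue)
qed

lemma pairing_lipschitz_limit:
  fixes f :: "'a::euclidean_space \<Rightarrow> real"
  assumes s: "0 < s" "s < 1" and \<Omega>: "bounded \<Omega>" "\<Omega> \<in> sets borel"
    and h: "\<And>n x y. \<bar>h n x - h n y\<bar> \<le> C * norm (x - y)" "\<And>n x. x \<notin> K \<Longrightarrow> h n x = 0" "\<And>n x. \<bar>h n x\<bar> \<le> m"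
    and f: "\<And>x y. \<bar>f x - f y\<bar> \<le> C * norm (x - y)"
    and K: "bounded K" "K \<in> sets borel" and lim: "\<And>x. (\<lambda>n. h n x) \<longlonglongrightarrow> f x"
    and p: "p \<in> predual G \<Omega>"
  shows "(\<lambda>n. pairing s \<Omega> (h n) p) \<longlonglongrightarrow> pairing s \<Omega> f p"
proof -
  obtain a b where ab: "p = (a, b)" "a \<in> orlicz_L (compl_young G) (lebesgue_on \<Omega>)" "b \<in> orlicz_L (compl_young G) frac_mu"
    using p by (auto simp: predual_def orlicz_E_def)
  have [measurable]: "a \<in> borel_measurable (lebesgue_on \<Omega>)" "b \<in> borel_measurable frac_mu"
    using ab orlicz_L_measurable[OF gauge_compl] by auto
  have hb: "h n \<in> borel_measurable borel" "f \<in> borel_measurable borel" for n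
    using lipschitz_continuous(3)[OF h(1)] lipschitz_continuous(3)[OF f] by auto
  then have [measurable]: "h n \<in> borel_measurable (lebesgue_on \<Omega>)" "f \<in> borel_measurable (lebesgue_on \<Omega>)" 
    "frac_D s (h n) \<in> borel_measurable frac_mu" "frac_D s f \<in> borel_measurable frac_mu" for n
    by (auto simp: measurable_cong_sets[OF sets_frac_mu refl] intro!: measurable_restrict_space1 borel_imp_lebesgue)
  have m: "m \<ge> 0" using h(3)[of 0 0] by simp
  let ?c = "max C (2 * m)"
  have 1: "(\<lambda>n. LINT x|lebesgue_on \<Omega>. h n x * a x) \<longlonglongrightarrow> (LINT x|lebesgue_on \<Omega>. f x * a x)"
  proof (rule integral_dominated_convergence[where w = "\<lambda>x. \<bar>m * a x\<bar>"])
    show "integrable (lebesgue_on \<Omega>) (\<lambda>x. \<bar>m * a x\<bar>)"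
      using ab bounded_orlicz_L[OF \<Omega>(2,1), of "\<lambda>_. m" "\<bar>m\<bar>"] by (intro integrable_abs integrable_mult_orlicz) auto
    show "AE x in lebesgue_on \<Omega>. (\<lambda>n. h n x * a x) \<longlonglongrightarrow> f x * a x" using lim by (intro AE_I2 tendsto_intros)
    show "AE x in lebesgue_on \<Omega>. norm (h n x * a x) \<le> \<bar>m * a x\<bar>" for n
      using h(3) m by (auto simp: abs_mult intro!: mult_right_mono)
  qed measurable
  have 2: "(\<lambda>n. LINT z|frac_mu. frac_D s (h n) z * b z) \<longlonglongrightarrow> (LINT z|frac_mu. frac_D s f z * b z)"
  proof (rule integral_dominated_convergence[where w = "\<lambda>z. \<bar>?c * lip_majorant s K z * b z\<bar>"])
    have lm: "lip_majorant s K \<in> borel_measurable frac_mu"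
      using K(2) by (auto simp: measurable_cong_sets[OF sets_frac_mu refl] intro!: borel_imp_lebesgue)
    have "(\<lambda>z. ?c * lip_majorant s K z) \<in> orlicz_L G frac_mu"
      using lip_majorant_modular[OF s K, of ?c] lm by (intro orlicz_LI[OF gauge_G, of _ _ 1]) auto
    then show "integrable frac_mu (\<lambda>z. \<bar>?c * lip_majorant s K z * b z\<bar>)"
      using ab by (intro integrable_abs integrable_mult_orlicz) auto
    have "(\<lambda>n. frac_D s (h n) z) \<longlonglongrightarrow> frac_D s f z" for z
      using lim by (cases z) (auto simp: frac_D_def divide_inverse intro!: tendsto_intros)
    then show "AE z in frac_mu. (\<lambda>n. frac_D s (h n) z * b z) \<longlonglongrightarrow> frac_D s f z * b z"
      by (intro AE_I2 tendsto_intros)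
    show "AE z in frac_mu. norm (frac_D s (h n) z * b z) \<le> \<bar>?c * lip_majorant s K z * b z\<bar>" for n
    proof (rule AE_I2)
      fix z
      have "\<bar>frac_D s (h n) z\<bar> \<le> ?c * lip_majorant s K z" by (rule frac_D_lip_bound[OF h])
      also have "\<dots> \<le> \<bar>?c * lip_majorant s K z\<bar>" by (rule abs_ge_self)
      finally have "\<bar>frac_D s (h n) z\<bar> \<le> \<bar>?c * lip_majorant s K z\<bar>" .
      then show "norm (frac_D s (h n) z * b z) \<le> \<bar>?c * lip_majorant s K z * b z\<bar>"
        by (simp add: abs_mult mult_right_mono)
    qed
  qed measurable
  show ?thesis using tendsto_add[OF 1 2] by (simp add: pairing_def ab)
qed

text \<open>
  The mollified functions have a common Lipschitz constant, bound and compact support, so one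
  majorant dominates their difference quotients, and the pairings converge.
\<close>

lemma lipschitz_frac_WL0:
  fixes f :: "'a::euclidean_space \<Rightarrow> real"
  assumes s: "0 < s" "s < 1" and \<Omega>: "bounded \<Omega>" "open \<Omega>" and \<phi>: "\<phi> \<in> Cc_infinity \<Omega>" "\<phi> x0 \<noteq> 0"
    and f: "\<And>x y. \<bar>f x - f y\<bar> \<le> C * norm (x - y)" "\<And>x. x \<notin> K \<Longrightarrow> f x = 0" "\<And>x. \<bar>f x\<bar> \<le> m"
    and K: "compact K" "K \<subseteq> \<Omega>"
  shows "f \<in> frac_WL0 s G \<Omega>"
proof -
  have \<Omega>b: "\<Omega> \<in> sets borel" using \<Omega> by simp
  obtain e where e: "e > 0" "(\<Union>x\<in>K. cball x e) \<subseteq> \<Omega>"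
    using compact_subset_open_imp_cball_epsilon_subset[OF K(1) \<Omega>(2) K(2)] .
  define K' where "K' = (\<lambda>(x, y). x + y) ` (K \<times> cball 0 e)"
  have K'_eq: "K' = (\<Union>x\<in>K. cball x e)"
  proof (intro equalityI subsetI)
    fix z assume "z \<in> (\<Union>x\<in>K. cball x e)"
    then obtain x where "x \<in> K" "norm (z - x) \<le> e" by (auto simp: dist_norm norm_minus_commute)
    then show "z \<in> K'" unfolding K'_def by (intro image_eqI[of _ _ "(x, z - x)"]) auto
  next
    fix z assume "z \<in> K'"
    then obtain x y where "x \<in> K" "norm y \<le> e" "z = x + y" by (auto simp: K'_def)
    then show "z \<in> (\<Union>x\<in>K. cball x e)" by (intro UN_I[of x]) (auto simp: dist_norm)
  qed
  have cK': "compact K'" unfolding K'_def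
    using K(1) by (intro compact_continuous_image compact_Times) (auto simp: case_prod_beta intro!: continuous_intros)
  define \<delta> where "\<delta> n = e / real (Suc n)" for n
  have \<delta>: "\<delta> n > 0" "\<delta> n \<le> e" for n using e by (auto simp: \<delta>_def field_simps)
  have "\<exists>h. h \<in> Cc_infinity \<Omega> \<and> (\<forall>x y. \<bar>h x - h y\<bar> \<le> C * norm (x - y)) \<and> (\<forall>x. x \<notin> K' \<longrightarrow> h x = 0) \<and>
     (\<forall>x. \<bar>h x\<bar> \<le> m) \<and> (\<forall>x. \<bar>h x - f x\<bar> \<le> C * \<delta> n)" for n
  proof -
    have sub: "(\<Union>x\<in>K. cball x (\<delta> n)) \<subseteq> K'"
      unfolding K'_eq using \<delta>(2)[of n] by fastforce
    show ?thesis
      by (rule smooth_approximation[OF \<phi> \<delta>(1)[of n] f K(1) sub cK']) (use e K'_eq in blast)+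
  qed
  then obtain h where h: "\<And>n. h n \<in> Cc_infinity \<Omega>" "\<And>n x y. \<bar>h n x - h n y\<bar> \<le> C * norm (x - y)" "\<And>n x. x \<notin> K' \<Longrightarrow> h n x = 0"
    "\<And>n x. \<bar>h n x\<bar> \<le> m" "\<And>n x. \<bar>h n x - f x\<bar> \<le> C * \<delta> n" by metis
  have bK': "bounded K'" "K' \<in> sets borel" using cK' by (auto intro: compact_imp_bounded borel_compact)
  have hWL: "h n \<in> frac_WL s G \<Omega>" for n by (rule lipschitz_frac_WL[OF s \<Omega>(1) \<Omega>b h(2-4) bK'])
  have "\<delta> \<longlonglongrightarrow> 0" unfolding \<delta>_def by (rule LIMSEQ_Suc) (rule lim_const_over_n)
  then have C0: "(\<lambda>n. C * \<delta> n) \<longlonglongrightarrow> 0" by (rule tendsto_mult_right_zero)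
  have lim: "(\<lambda>n. h n x) \<longlonglongrightarrow> f x" for x
  proof (rule LIM_zero_cancel, rule Lim_null_comparison[OF _ C0])
    show "\<forall>\<^sub>F n in sequentially. norm (h n x - f x) \<le> C * \<delta> n" using h(5) by simp
  qed
  show ?thesis
    unfolding frac_WL0_iff
  proof (intro conjI allI impI)
    show "f \<in> frac_WL s G \<Omega>"
      by (rule lipschitz_frac_WL[OF s \<Omega>(1) \<Omega>b f]) (use K in \<open>auto intro: compact_imp_bounded borel_compact\<close>)
    fix F and \<epsilon> :: real assume F: "finite F" "F \<subseteq> predual G \<Omega>" and \<epsilon>: "\<epsilon> > 0"
    have "\<forall>\<^sub>F n in sequentially. \<bar>pairing s \<Omega> (h n) p - pairing s \<Omega> f p\<bar> < \<epsilon>" if "p \<in> F" for p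
    proof -
      have "p \<in> predual G \<Omega>" using that F by blast
      from tendstoD[OF pairing_lipschitz_limit[OF s \<Omega>(1) \<Omega>b h(2-4) f(1) bK' lim this] \<epsilon>]
      show ?thesis by (simp add: dist_real_def)
    qed
    then have "\<forall>\<^sub>F n in sequentially. \<forall>p\<in>F. \<bar>pairing s \<Omega> (h n) p - pairing s \<Omega> f p\<bar> < \<epsilon>"
      using F(1) by (intro eventually_ball_finite) auto
    then obtain n where "\<forall>p\<in>F. \<bar>pairing s \<Omega> (h n) p - pairing s \<Omega> f p\<bar> < \<epsilon>"
      using eventually_happens'[OF sequentially_bot] by blast
    then show "\<exists>\<phi>\<in>Cc_infinity \<Omega> \<inter> frac_WL s G \<Omega>. \<forall>p\<in>F. \<bar>pairing s \<Omega> \<phi> p - pairing s \<Omega> f p\<bar> < \<epsilon>"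
      using h(1) hWL by blast
  qed
qed

end

section \<open>Lipschitz functions that recover the energy\<close>

context young begin

text \<open>
  Truncation at a large height is followed by continuous functions that converge almost everywhere
  to the truncated function. Both errors tend to 0 by dominated convergence; the factor 2 in the
  last hypothesis pays for their sum.
\<close>

lemma continuous_modular_approximation:
  fixes u :: "'a::euclidean_space \<Rightarrow> real"
  assumes u[measurable]: "u \<in> borel_measurable borel" and B: "bounded B" and [measurable]: "B \<in> sets borel" and uB: "\<And>x. x \<notin> B \<Longrightarrow> u x = 0"
    and fin: "(\<integral>\<^sup>+x. ennreal (G \<bar>2 * c * u x\<bar>) \<partial>lborel) < \<infinity>"
  obtains v where "continuous_on UNIV v" "(\<integral>\<^sup>+x. ennreal (G \<bar>c * (u x - v x * indicator B x)\<bar>) \<partial>lborel) \<le> 1"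
proof -
  define T where "T m t = max (- real m) (min (real m) t)" for m :: nat and t :: real
  have [measurable]: "T m \<in> borel_measurable borel" for m unfolding T_def by measurable
  have "(\<lambda>m. \<integral>\<^sup>+x. ennreal (G \<bar>2 * c * (u x - T m (u x))\<bar>) \<partial>lborel) \<longlonglongrightarrow> (\<integral>\<^sup>+x. 0 \<partial>(lborel :: 'a measure))"
  proof (rule nn_integral_dominated_convergence[where w = "\<lambda>x. ennreal (G \<bar>2 * c * u x\<bar>)"])
    show "AE x in lborel. ennreal (G \<bar>2 * c * (u x - T m (u x))\<bar>) \<le> ennreal (G \<bar>2 * c * u x\<bar>)" for m
    proof (rule AE_I2)
      fix x
      have "\<bar>u x - T m (u x)\<bar> \<le> \<bar>u x\<bar>" by (auto simp: T_def)
      then show "ennreal (G \<bar>2 * c * (u x - T m (u x))\<bar>) \<le> ennreal (G \<bar>2 * c * u x\<bar>)"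
        by (intro ennreal_leI G_mono) (auto simp: abs_mult intro: mult_left_mono)
    qed
    show "AE x in lborel. (\<lambda>m. ennreal (G \<bar>2 * c * (u x - T m (u x))\<bar>)) \<longlonglongrightarrow> 0"
    proof (rule AE_I2)
      fix x
      obtain m0 :: nat where m0: "\<bar>u x\<bar> \<le> real m0" using real_arch_simple by blast
      have "\<forall>\<^sub>F m in sequentially. ennreal (G \<bar>2 * c * (u x - T m (u x))\<bar>) = 0"
        unfolding eventually_sequentially
      proof (intro exI allI impI)
        fix m assume "m0 \<le> m"
        then have "T m (u x) = u x" using m0 by (auto simp: T_def)
        then show "ennreal (G \<bar>2 * c * (u x - T m (u x))\<bar>) = 0" by (simp add: G_zero)
      qed
      then show "(\<lambda>m. ennreal (G \<bar>2 * c * (u x - T m (u x))\<bar>)) \<longlonglongrightarrow> 0" by (rule tendsto_eventually)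
    qed
  qed (use fin in auto)
  then have "\<forall>\<^sub>F m in sequentially. (\<integral>\<^sup>+x. ennreal (G \<bar>2 * c * (u x - T m (u x))\<bar>) \<partial>lborel) < 1"
    by (intro order_tendstoD) auto
  then obtain m where m: "(\<integral>\<^sup>+x. ennreal (G \<bar>2 * c * (u x - T m (u x))\<bar>) \<partial>lborel) < 1"
    using eventually_happens'[OF sequentially_bot] by blast
  define w where "w x = T m (u x)" for x
  have [measurable]: "w \<in> borel_measurable borel" unfolding w_def by measurable
  have "w measurable_on UNIV"
  proof (rule measurable_on_iff_borel_measurable[THEN iffD2])
    show "UNIV \<in> sets (lebesgue :: 'a measure)" by simp
    show "w \<in> borel_measurable (lebesgue_on UNIV)"
      by (intro measurable_restrict_space1 borel_imp_lebesgue) fact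
  qed
  then obtain N q where N: "negligible N" and "\<forall>n. continuous_on UNIV (q n)"
      "\<forall>x. x \<notin> N \<longrightarrow> (\<lambda>n. q n x) \<longlonglongrightarrow> (if x \<in> UNIV then w x else 0)"
    unfolding measurable_on_def by (elim exE conjE)
  then have q: "\<And>n. continuous_on UNIV (q n)" "\<And>x. x \<notin> N \<Longrightarrow> (\<lambda>n. q n x) \<longlonglongrightarrow> w x"
    by simp_all
  define v where "v n x = T m (q n x)" for n x
  have vc: "continuous_on UNIV (v n)" for n unfolding v_def T_def by (intro continuous_intros q)
  have [measurable]: "v n \<in> borel_measurable borel" for n using vc by (rule borel_measurable_continuous_onI)
  have "AE x in lebesgue. x \<notin> N" using N unfolding negligible_iff_null_sets by (rule AE_not_in)
  then have "AE x in lebesgue. (\<lambda>n. v n x) \<longlonglongrightarrow> w x"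
  proof eventually_elim
    case (elim x)
    have "(\<lambda>n. v n x) \<longlonglongrightarrow> T m (w x)" unfolding v_def T_def by (intro tendsto_intros q elim)
    moreover have "T m (w x) = w x" by (auto simp: w_def T_def)
    ultimately show ?case by simp
  qed
  then have lim: "AE x in lborel. (\<lambda>n. v n x) \<longlonglongrightarrow> w x" by (subst (asm) AE_completion_iff) measurable
  have "(\<lambda>n. \<integral>\<^sup>+x. ennreal (G \<bar>2 * c * (w x - v n x)\<bar>) * indicator B x \<partial>lborel) \<longlonglongrightarrow> (\<integral>\<^sup>+x. 0 \<partial>(lborel :: 'a measure))"
  proof (rule nn_integral_dominated_convergence[where w = "\<lambda>x. ennreal (G \<bar>2 * c * (2 * real m)\<bar>) * indicator B x"])
    show "AE x in lborel. ennreal (G \<bar>2 * c * (w x - v n x)\<bar>) * indicator B x \<le> ennreal (G \<bar>2 * c * (2 * real m)\<bar>) * indicator B x" for n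
    proof (rule AE_I2)
      fix x
      have "\<bar>w x - v n x\<bar> \<le> \<bar>2 * real m\<bar>" by (auto simp: w_def v_def T_def)
      then have "\<bar>2 * c * (w x - v n x)\<bar> \<le> \<bar>2 * c * (2 * real m)\<bar>"
        unfolding abs_mult[of "2 * c"] by (intro mult_left_mono) auto
      then show "ennreal (G \<bar>2 * c * (w x - v n x)\<bar>) * indicator B x \<le> ennreal (G \<bar>2 * c * (2 * real m)\<bar>) * indicator B x"
        by (intro mult_right_mono ennreal_leI G_mono) auto
    qed
    show "(\<integral>\<^sup>+x. ennreal (G \<bar>2 * c * (2 * real m)\<bar>) * indicator B x \<partial>lborel) < \<infinity>"
      using emeasure_bounded_finite[OF B] by (simp add: nn_integral_cmult_indicator ennreal_mult_less_top)
    show "AE x in lborel. (\<lambda>n. ennreal (G \<bar>2 * c * (w x - v n x)\<bar>) * indicator B x) \<longlonglongrightarrow> 0"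
      using lim
    proof eventually_elim
      case (elim x)
      have "(\<lambda>n. 2 * c * (w x - v n x)) \<longlonglongrightarrow> 2 * c * (w x - w x)" by (intro tendsto_intros elim)
      then have "(\<lambda>n. G \<bar>2 * c * (w x - v n x)\<bar>) \<longlonglongrightarrow> G \<bar>2 * c * (w x - w x)\<bar>"
        by (rule continuous_on_tendsto_compose[OF G_abs_continuous]) auto
      then have "(\<lambda>n. ennreal (G \<bar>2 * c * (w x - v n x)\<bar>)) \<longlonglongrightarrow> 0"
        using tendsto_ennrealI by (fastforce simp: G_zero)
      then show ?case by (cases "x \<in> B") auto
    qed
  qed auto
  then have "\<forall>\<^sub>F n in sequentially. (\<integral>\<^sup>+x. ennreal (G \<bar>2 * c * (w x - v n x)\<bar>) * indicator B x \<partial>lborel) < 1"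
    by (intro order_tendstoD) auto
  then obtain n where n: "(\<integral>\<^sup>+x. ennreal (G \<bar>2 * c * (w x - v n x)\<bar>) * indicator B x \<partial>lborel) < 1"
    using eventually_happens'[OF sequentially_bot] by blast
  show thesis
  proof (rule that[of "v n"])
    show "continuous_on UNIV (v n)" by (rule vc)
    have "(\<integral>\<^sup>+x. ennreal (G \<bar>c * (u x - v n x * indicator B x)\<bar>) \<partial>lborel) \<le>
      (\<integral>\<^sup>+x. ennreal (1/2) * ennreal (G \<bar>2 * c * (u x - w x)\<bar>) + ennreal (1/2) * (ennreal (G \<bar>2 * c * (w x - v n x)\<bar>) * indicator B x) \<partial>lborel)"
    proof (rule nn_integral_mono)
      fix x
      show "ennreal (G \<bar>c * (u x - v n x * indicator B x)\<bar>) \<le> ennreal (1/2) * ennreal (G \<bar>2 * c * (u x - w x)\<bar>) + ennreal (1/2) * (ennreal (G \<bar>2 * c * (w x - v n x)\<bar>) * indicator B x)"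
      proof (cases "x \<in> B")
        case True
        have "G \<bar>(1 - 1/2) * (2 * c * (u x - w x)) + 1/2 * (2 * c * (w x - v n x))\<bar> \<le> (1 - 1/2) * G \<bar>2 * c * (u x - w x)\<bar> + 1/2 * G \<bar>2 * c * (w x - v n x)\<bar>"
          by (rule gauge_abs_convex[OF gauge_G]) auto
        moreover have "(1 - 1/2) * (2 * c * (u x - w x)) + 1/2 * (2 * c * (w x - v n x)) = c * (u x - v n x)" by (simp add: algebra_simps)
        ultimately have "G \<bar>c * (u x - v n x)\<bar> \<le> 1/2 * G \<bar>2 * c * (u x - w x)\<bar> + 1/2 * G \<bar>2 * c * (w x - v n x)\<bar>" by simp
        then have "ennreal (G \<bar>c * (u x - v n x)\<bar>) \<le> ennreal (1/2 * G \<bar>2 * c * (u x - w x)\<bar> + 1/2 * G \<bar>2 * c * (w x - v n x)\<bar>)"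
          by (rule ennreal_leI)
        also have "\<dots> = ennreal (1/2) * ennreal (G \<bar>2 * c * (u x - w x)\<bar>) + ennreal (1/2) * ennreal (G \<bar>2 * c * (w x - v n x)\<bar>)"
        proof -
          have p: "0 \<le> G \<bar>2 * c * (u x - w x)\<bar>" "0 \<le> G \<bar>2 * c * (w x - v n x)\<bar>" by (auto intro: G_nonneg)
          then have "ennreal (1/2 * G \<bar>2 * c * (u x - w x)\<bar> + 1/2 * G \<bar>2 * c * (w x - v n x)\<bar>)
              = ennreal (1/2 * G \<bar>2 * c * (u x - w x)\<bar>) + ennreal (1/2 * G \<bar>2 * c * (w x - v n x)\<bar>)"
            by (intro ennreal_plus) auto
          also have "ennreal (1/2 * G \<bar>2 * c * (u x - w x)\<bar>) = ennreal (1/2) * ennreal (G \<bar>2 * c * (u x - w x)\<bar>)"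
            using p by (intro ennreal_mult) auto
          also have "ennreal (1/2 * G \<bar>2 * c * (w x - v n x)\<bar>) = ennreal (1/2) * ennreal (G \<bar>2 * c * (w x - v n x)\<bar>)"
            using p by (intro ennreal_mult) auto
          finally show ?thesis .
        qed
        finally show ?thesis using True by simp
      qed (simp add: uB G_zero)
    qed
    also have "\<dots> = ennreal (1/2) * (\<integral>\<^sup>+x. ennreal (G \<bar>2 * c * (u x - w x)\<bar>) \<partial>lborel) + ennreal (1/2) * (\<integral>\<^sup>+x. ennreal (G \<bar>2 * c * (w x - v n x)\<bar>) * indicator B x \<partial>lborel)"
      by (subst nn_integral_add) (auto simp: nn_integral_cmult)
    also have "\<dots> \<le> ennreal (1/2) * 1 + ennreal (1/2) * 1"
      using m n unfolding w_def by (intro add_mono mult_left_mono) (auto simp: less_imp_le)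
    also have "\<dots> = ennreal (1/2 + 1/2)" by (subst ennreal_plus) auto
    also have "\<dots> = 1" by (subst field_sum_of_halves) (rule ennreal_1)
    finally show "(\<integral>\<^sup>+x. ennreal (G \<bar>c * (u x - v n x * indicator B x)\<bar>) \<partial>lborel) \<le> 1" .
  qed
qed

text \<open>
  If \<open>v\<close> is small even after division by a small \<open>\<theta>\<close>, then so is its pairing with the subgradient:
  a modular substitute for a norm estimate.
\<close>

lemma young_deriv_pairing:
  assumes [measurable]: "u \<in> borel_measurable M" "v \<in> borel_measurable M"
    and u: "integrable M (\<lambda>x. G \<bar>2 * u x\<bar>)" and v: "integrable M (\<lambda>x. G \<bar>2 / \<theta> * v x\<bar>)" and \<theta>: "\<theta> > 0"
  shows "integrable M (\<lambda>x. young_deriv g (u x) * v x)" "integrable M (\<lambda>x. g \<bar>u x\<bar> * \<bar>u x\<bar>)"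
    "\<bar>\<integral>x. young_deriv g (u x) * v x \<partial>M\<bar> \<le> \<theta> * (\<integral>x. g \<bar>u x\<bar> * \<bar>u x\<bar> \<partial>M) + \<theta> * (\<integral>x. G \<bar>2 / \<theta> * v x\<bar> \<partial>M)"
proof -
  have eq: "g \<bar>u x\<bar> * \<bar>u x\<bar> = young_deriv g (u x) * u x" for x by (simp add: young_deriv_mult_self)
  show i: "integrable M (\<lambda>x. g \<bar>u x\<bar> * \<bar>u x\<bar>)"
  proof (rule Bochner_Integration.integrable_bound[OF u])
    show "(\<lambda>x. g \<bar>u x\<bar> * \<bar>u x\<bar>) \<in> borel_measurable M" unfolding eq by measurable
    show "AE x in M. norm (g \<bar>u x\<bar> * \<bar>u x\<bar>) \<le> norm (G \<bar>2 * u x\<bar>)"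
      using g_self_le[of "\<bar>u _\<bar>"] g_nonneg G_nonneg by (auto simp: abs_mult)
  qed
  have b: "\<bar>young_deriv g (u x) * v x\<bar> \<le> \<theta> * (g \<bar>u x\<bar> * \<bar>u x\<bar>) + \<theta> * G \<bar>2 / \<theta> * v x\<bar>" for x
    using young_deriv_young[OF \<theta>, of "u x" "v x"] \<theta> by (simp add: abs_mult)
  have ib: "integrable M (\<lambda>x. \<theta> * (g \<bar>u x\<bar> * \<bar>u x\<bar>) + \<theta> * G \<bar>2 / \<theta> * v x\<bar>)" using i v by simp
  show i2: "integrable M (\<lambda>x. young_deriv g (u x) * v x)"
  proof (rule Bochner_Integration.integrable_bound[OF ib])
    show "AE x in M. norm (young_deriv g (u x) * v x) \<le> norm (\<theta> * (g \<bar>u x\<bar> * \<bar>u x\<bar>) + \<theta> * G \<bar>2 / \<theta> * v x\<bar>)"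
      unfolding real_norm_def by (rule AE_I2) (rule order_trans[OF b abs_ge_self])
  qed measurable
  have "\<bar>\<integral>x. young_deriv g (u x) * v x \<partial>M\<bar> \<le> (\<integral>x. \<theta> * (g \<bar>u x\<bar> * \<bar>u x\<bar>) + \<theta> * G \<bar>2 / \<theta> * v x\<bar> \<partial>M)"
    by (rule order_trans[OF integral_abs_bound]) (rule integral_mono[OF integrable_abs[OF i2] ib b])
  then show "\<bar>\<integral>x. young_deriv g (u x) * v x \<partial>M\<bar> \<le> \<theta> * (\<integral>x. g \<bar>u x\<bar> * \<bar>u x\<bar> \<partial>M) + \<theta> * (\<integral>x. G \<bar>2 / \<theta> * v x\<bar> \<partial>M)"
    using i v by simp
qed

lemma frac_WL0_borel_representative:
  fixes u :: "'a::euclidean_space \<Rightarrow> real"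
  assumes s: "0 < s" and \<Omega>: "open \<Omega>" "bounded \<Omega>" "\<Omega> \<noteq> {}" and u: "u \<in> frac_WL0 s G \<Omega>"
  obtains w where "w \<in> borel_measurable borel" "AE x in lebesgue. u x = w x" "\<And>x. x \<notin> \<Omega> \<Longrightarrow> w x = 0"
    "\<And>c. (\<integral>\<^sup>+x. ennreal (G \<bar>c * w x\<bar>) \<partial>lborel) < \<infinity>" "integrable lborel w"
proof -
  have uWL: "u \<in> frac_WL s G \<Omega>" by (rule frac_WL0_subset[OF u])
  obtain w0 where w0[measurable]: "w0 \<in> borel_measurable borel" and uw0: "AE x in lebesgue. u x = w0 x"
    using borel_representative[of u] uWL by (auto simp: frac_WL_def)
  have [measurable]: "\<Omega> \<in> sets borel" using \<Omega> by simp
  define w where "w x = w0 x * indicator \<Omega> x" for x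
  have wm[measurable]: "w \<in> borel_measurable borel" unfolding w_def by measurable
  have uw: "AE x in lebesgue. u x = w x"
    using uw0 frac_WL0_zero_outside[OF u s \<Omega>(1,3)] by eventually_elim (auto simp: w_def indicator_def)
  have w0: "w x = 0" if "x \<notin> \<Omega>" for x using that by (simp add: w_def)
  have fin: "(\<integral>\<^sup>+x. ennreal (G \<bar>c * w x\<bar>) \<partial>lborel) < \<infinity>" for c
  proof -
    have "integrable (lebesgue_on \<Omega>) (\<lambda>x. G \<bar>c * u x\<bar>)"
      using frac_WL_all_moments[OF uWL s \<Omega>(2)] by simp
    then have "(\<integral>\<^sup>+x. ennreal (G \<bar>c * u x\<bar>) \<partial>lebesgue_on \<Omega>) < \<infinity>"
      by (subst integrable_nonneg_iff[symmetric]) (auto simp: G_nonneg)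
    also have "(\<integral>\<^sup>+x. ennreal (G \<bar>c * u x\<bar>) \<partial>lebesgue_on \<Omega>) = (\<integral>\<^sup>+x. ennreal (G \<bar>c * w x\<bar>) \<partial>lebesgue_on \<Omega>)"
      using AE_lebesgue_onI[OF uw, of \<Omega>] by (intro nn_integral_cong_AE) auto
    also have "\<dots> = (\<integral>\<^sup>+x. ennreal (G \<bar>c * w x\<bar>) * indicator \<Omega> x \<partial>lborel)"
      using gauge_measurable[OF gauge_G, of "\<lambda>x. c * w x" borel] by (intro nn_integral_lebesgue_on_borel) auto
    also have "\<dots> = (\<integral>\<^sup>+x. ennreal (G \<bar>c * w x\<bar>) \<partial>lborel)"
      by (intro nn_integral_cong) (auto simp: w0 G_zero indicator_def)
    finally show ?thesis .
  qed
  have "integrable lborel w"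
  proof (rule Bochner_Integration.integrable_bound)
    show "integrable lborel (\<lambda>x. G \<bar>1 * w x\<bar> / g 1 + indicator \<Omega> x)"
    proof (intro Bochner_Integration.integrable_add integrable_divide)
      show "integrable lborel (\<lambda>x. G \<bar>1 * w x\<bar>)"
        using fin[of 1] gauge_measurable[OF gauge_G, of "\<lambda>x. 1 * w x" borel] by (subst integrable_nonneg_iff) (auto simp: G_nonneg)
      show "integrable lborel (indicator \<Omega> :: 'a \<Rightarrow> real)" using emeasure_bounded_finite[OF \<Omega>(2)] by (intro integrable_real_indicator) auto
    qed
    show "AE x in lborel. norm (w x) \<le> norm (G \<bar>1 * w x\<bar> / g 1 + indicator \<Omega> x)"
    proof (rule AE_I2)
      fix x
      have "\<bar>w x\<bar> \<le> G \<bar>1 * w x\<bar> / g 1 + indicator \<Omega> x"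
        using G_linear_lower[of "\<bar>w x\<bar>"] by (cases "x \<in> \<Omega>") (auto simp: w0 G_zero)
      then show "norm (w x) \<le> norm (G \<bar>1 * w x\<bar> / g 1 + indicator \<Omega> x)"
        unfolding real_norm_def by (rule order_trans) (rule abs_ge_self)
    qed
  qed simp
  then show thesis using that wm uw w0 fin by blast
qed

end

context averaging begin

lemma avg_close:
  assumes sup: "\<And>w. norm w \<ge> \<eta> \<Longrightarrow> \<rho> w = 0" and u: "integrable lborel u"
    and cl: "\<And>w. norm w < \<eta> \<Longrightarrow> \<bar>u (\<Phi> x + w) - c\<bar> \<le> \<theta>"
  shows "\<bar>avg u x - c\<bar> \<le> \<theta>"
proof -
  have i: "integrable lborel (\<lambda>w. \<rho> w * (u (\<Phi> x + w) - c))"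
    using integrable_avg[OF u] kernel by (simp add: right_diff_distrib)
  have "avg u x - c = (\<integral>w. \<rho> w * (u (\<Phi> x + w) - c) \<partial>lborel)"
    using integrable_avg[OF u] kernel by (simp add: avg_def right_diff_distrib)
  also have "\<bar>\<dots>\<bar> \<le> (\<integral>w. \<theta> * \<rho> w \<partial>lborel)"
  proof (rule integral_abs_bound_integral[OF i])
    show "integrable lborel (\<lambda>w. \<theta> * \<rho> w)" using kernel by simp
    show "\<bar>\<rho> w * (u (\<Phi> x + w) - c)\<bar> \<le> \<theta> * \<rho> w" for w
    proof (cases "norm w < \<eta>")
      case True
      then have "\<rho> w * \<bar>u (\<Phi> x + w) - c\<bar> \<le> \<rho> w * \<theta>" by (intro mult_left_mono cl kernel)
      then show ?thesis using kernel(1)[of w] by (simp add: abs_mult mult.commute)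
    qed (simp add: sup)
  qed
  also have "\<dots> = \<theta>" using kernel by simp
  finally show ?thesis .
qed

lemma avg_measurable:
  assumes [measurable]: "u \<in> borel_measurable borel" shows "avg u \<in> borel_measurable borel"
  unfolding avg_def by (rule lborel.borel_measurable_lebesgue_integral) measurable

lemma avg_diff:
  assumes "integrable lborel u" "integrable lborel v"
  shows "avg (\<lambda>x. u x - v x) x = avg u x - avg v x"
  using integrable_avg[OF assms(1)] integrable_avg[OF assms(2)] by (simp add: avg_def right_diff_distrib)

end

context young begin

lemma exists_averaging:
  fixes \<Omega> :: "'a::euclidean_space set"
  assumes \<Omega>: "open \<Omega>" "bounded \<Omega>" "lipschitz_boundary \<Omega>" and e: "0 < e" "e \<le> 1/2"
  obtains \<Phi> \<rho> B \<eta> where "averaging G g \<Phi> \<rho> (1 / (1 - e)) (1 + e) B" "0 < \<eta>" "\<eta> \<le> e"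
    "\<And>w. norm w \<ge> \<eta> \<Longrightarrow> \<rho> w = 0" "\<And>x. norm (\<Phi> x - x) \<le> e"
    "\<And>x y z. y \<notin> \<Omega> \<Longrightarrow> norm (x - y) \<le> \<eta> \<Longrightarrow> norm (z - \<Phi> x) \<le> \<eta> \<Longrightarrow> z \<notin> \<Omega>"
proof -
  obtain \<Phi> :: "'a \<Rightarrow> 'a" and \<eta> where \<Phi>: "\<eta> > 0" "\<eta> \<le> e" "\<And>x. norm (\<Phi> x - x) \<le> e"
    "\<And>x y. norm ((\<Phi> x - x) - (\<Phi> y - y)) \<le> e * norm (x - y)"
    "\<And>x y z. y \<notin> \<Omega> \<Longrightarrow> norm (x - y) \<le> \<eta> \<Longrightarrow> norm (z - \<Phi> x) \<le> \<eta> \<Longrightarrow> z \<notin> \<Omega>"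
    by (rule exists_inward_deformation[OF \<Omega> e(1)]) (rule that, assumption+)
  obtain \<rho> :: "'a \<Rightarrow> real" and B where \<rho>: "\<And>w. 0 \<le> \<rho> w" "\<And>w. \<rho> w \<le> B" "\<And>w. norm w \<ge> \<eta> \<Longrightarrow> \<rho> w = 0" "\<And>v w. \<bar>\<rho> v - \<rho> w\<bar> \<le> B * norm (v - w)"
    "continuous_on UNIV \<rho>" "integrable lborel \<rho>" "(\<integral>w. \<rho> w \<partial>lborel) = 1" "B \<ge> 0"
    by (rule exists_lipschitz_kernel[OF \<Phi>(1)]) (rule that, assumption+)
  have "averaging G g \<Phi> \<rho> (1 / (1 - e)) (1 + e) B"
  proof unfold_locales
    show "norm (x - y) \<le> 1 / (1 - e) * norm (\<Phi> x - \<Phi> y)" for x y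
    proof -
      have "x - y = (\<Phi> x - \<Phi> y) - ((\<Phi> x - x) - (\<Phi> y - y))" by simp
      then have "norm (x - y) \<le> norm (\<Phi> x - \<Phi> y) + e * norm (x - y)"
        using norm_triangle_ineq4[of "\<Phi> x - \<Phi> y" "(\<Phi> x - x) - (\<Phi> y - y)"] \<Phi>(4)[of x y] by simp
      then show ?thesis using e by (simp add: field_simps)
    qed
    show "norm (\<Phi> x - \<Phi> y) \<le> (1 + e) * norm (x - y)" for x y
    proof -
      have "\<Phi> x - \<Phi> y = (x - y) + ((\<Phi> x - x) - (\<Phi> y - y))" by simp
      then show ?thesis
        using norm_triangle_ineq[of "x - y" "(\<Phi> x - x) - (\<Phi> y - y)"] \<Phi>(4)[of x y] by (simp add: algebra_simps)
    qed
    show "surj \<Phi>"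
    proof -
      have "\<exists>x. y = \<Phi> x" for y
      proof -
        \<comment> \<open>a solution of \<open>\<Phi> x = y\<close> is a fixed point of a contraction\<close>
        have "\<exists>!x. y - (\<Phi> x - x) = x"
        proof (rule banach_fix_type)
          show "\<forall>x x'. dist (y - (\<Phi> x - x)) (y - (\<Phi> x' - x')) \<le> e * dist x x'"
          proof (intro allI)
            fix x x'
            have eq: "y - (\<Phi> x - x) - (y - (\<Phi> x' - x')) = (\<Phi> x' - x') - (\<Phi> x - x)" by simp
            show "dist (y - (\<Phi> x - x)) (y - (\<Phi> x' - x')) \<le> e * dist x x'"
              unfolding dist_norm eq norm_minus_commute[of x x'] by (rule \<Phi>(4))
          qed
        qed (use e in auto)
        then obtain x where "y - (\<Phi> x - x) = x" by blast
        then have "y = \<Phi> x" by (simp add: algebra_simps)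
        then show ?thesis by blast
      qed
      then show ?thesis by (simp add: surj_def)
    qed
  qed (use e \<rho> in auto)
  then show thesis by (rule that) (fact \<Phi> \<rho>(3))+
qed

lemma restrict_modular:
  fixes q :: "'a::euclidean_space \<Rightarrow> real"
  assumes q: "q \<in> borel_measurable borel" and \<Omega>: "\<Omega> \<in> sets borel" and le: "(\<integral>\<^sup>+x. ennreal (G \<bar>q x\<bar>) \<partial>lborel) \<le> ennreal r" and r: "r \<ge> 0"
  shows "integrable (lebesgue_on \<Omega>) (\<lambda>x. G \<bar>q x\<bar>)" "(LINT x|lebesgue_on \<Omega>. G \<bar>q x\<bar>) \<le> r"
proof -
  have Gq: "(\<lambda>x. G \<bar>q x\<bar>) \<in> borel_measurable borel" by (rule gauge_measurable[OF gauge_G q])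
  have m: "(\<lambda>x. G \<bar>q x\<bar>) \<in> borel_measurable (lebesgue_on \<Omega>)"
    using Gq by (intro measurable_restrict_space1 borel_imp_lebesgue)
  have "(\<integral>\<^sup>+x. ennreal (G \<bar>q x\<bar>) \<partial>lebesgue_on \<Omega>) = (\<integral>\<^sup>+x. ennreal (G \<bar>q x\<bar>) * indicator \<Omega> x \<partial>lborel)"
    using Gq by (intro nn_integral_lebesgue_on_borel \<Omega>) auto
  also have "\<dots> \<le> (\<integral>\<^sup>+x. ennreal (G \<bar>q x\<bar>) \<partial>lborel)" by (intro nn_integral_mono) (auto simp: indicator_def)
  also note le
  finally have le': "(\<integral>\<^sup>+x. ennreal (G \<bar>q x\<bar>) \<partial>lebesgue_on \<Omega>) \<le> ennreal r" .
  show i: "integrable (lebesgue_on \<Omega>) (\<lambda>x. G \<bar>q x\<bar>)"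
    using le' m by (subst integrable_nonneg_iff) (auto simp: G_nonneg order_le_less_trans)
  have "ennreal (LINT x|lebesgue_on \<Omega>. G \<bar>q x\<bar>) \<le> ennreal r"
    using le' by (subst (asm) nn_integral_eq_integral[OF i]) (auto simp: G_nonneg)
  then show "(LINT x|lebesgue_on \<Omega>. G \<bar>q x\<bar>) \<le> r" using r by simp
qed

lemma integrable_g_abs:
  assumes [measurable]: "u \<in> borel_measurable M" and "finite_measure M" and i: "integrable M (\<lambda>x. g \<bar>u x\<bar> * \<bar>u x\<bar>)"
  shows "integrable M (\<lambda>x. \<bar>young_deriv g (u x)\<bar>)"
proof -
  interpret finite_measure M by fact
  show ?thesis
  proof (rule Bochner_Integration.integrable_bound)
    show "integrable M (\<lambda>x. g \<bar>u x\<bar> * \<bar>u x\<bar> + g 1)" using i by simp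
    show "AE x in M. norm \<bar>young_deriv g (u x)\<bar> \<le> norm (g \<bar>u x\<bar> * \<bar>u x\<bar> + g 1)"
    proof (rule AE_I2)
      fix x
      have n: "g \<bar>u x\<bar> \<ge> 0" "g 1 \<ge> 0" by (auto intro: g_nonneg)
      have "g \<bar>u x\<bar> \<le> g \<bar>u x\<bar> * \<bar>u x\<bar> + g 1"
      proof (cases "\<bar>u x\<bar> \<le> 1")
        case True
        then have "g \<bar>u x\<bar> \<le> g 1" by (intro g_mono) auto
        moreover have "0 \<le> g \<bar>u x\<bar> * \<bar>u x\<bar>" using n by simp
        ultimately show ?thesis by linarith
      next
        case False
        then have "g \<bar>u x\<bar> * 1 \<le> g \<bar>u x\<bar> * \<bar>u x\<bar>" using n by (intro mult_left_mono) auto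
        then show ?thesis using n by linarith
      qed
      then show "norm \<bar>young_deriv g (u x)\<bar> \<le> norm (g \<bar>u x\<bar> * \<bar>u x\<bar> + g 1)"
        unfolding real_norm_def abs_abs by (intro order_trans[OF _ abs_ge_self]) (simp add: abs_young_deriv)
    qed
  qed measurable
qed

text \<open>
  At distance at most \<open>\<eta>\<close> from the complement the average involves only points outside \<open>\<Omega>\<close>, where
  \<open>w\<close> vanishes.
\<close>

lemma lipschitz_average:
  fixes \<Omega> :: "'a::euclidean_space set"
  assumes av: "averaging G g \<Phi> \<rho> L M B" and \<Omega>: "open \<Omega>" "bounded \<Omega>" and \<eta>: "0 < \<eta>"
    and \<rho>: "\<And>w. norm w \<ge> \<eta> \<Longrightarrow> \<rho> w = 0"
    and \<Phi>: "\<And>x y z. y \<notin> \<Omega> \<Longrightarrow> norm (x - y) \<le> \<eta> \<Longrightarrow> norm (z - \<Phi> x) \<le> \<eta> \<Longrightarrow> z \<notin> \<Omega>"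
    and w: "integrable lborel w" "\<And>x. x \<notin> \<Omega> \<Longrightarrow> w x = 0"
  obtains C K m where "\<And>x y. \<bar>c * averaging.avg \<Phi> \<rho> w x - c * averaging.avg \<Phi> \<rho> w y\<bar> \<le> C * norm (x - y)" "compact K" "K \<subseteq> \<Omega>"
    "\<And>x. x \<notin> K \<Longrightarrow> c * averaging.avg \<Phi> \<rho> w x = 0" "\<And>x. \<bar>c * averaging.avg \<Phi> \<rho> w x\<bar> \<le> m"
proof -
  interpret averaging G g \<Phi> \<rho> L M B by fact
  define C where "C = \<bar>c\<bar> * (B * M * (\<integral>w'. \<bar>w w'\<bar> \<partial>lborel))"
  have lip: "\<bar>c * avg w x - c * avg w y\<bar> \<le> C * norm (x - y)" for x y
    using mult_left_mono[OF avg_lipschitz[OF w(1), of x y], of "\<bar>c\<bar>"]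
    by (simp add: C_def abs_mult[symmetric] right_diff_distrib mult_ac)
  define K where "K = (\<Inter>y\<in>-\<Omega>. {x. \<eta> \<le> dist x y}) \<inter> closure \<Omega>"
  have "closed K" unfolding K_def by (intro closed_Int closed_INT ballI closed_Collect_le continuous_intros closed_closure)
  moreover have "bounded K" using \<Omega>(2) by (auto simp: K_def intro: bounded_subset[of "closure \<Omega>"])
  ultimately have K: "compact K" by (simp add: compact_eq_bounded_closed)
  have K\<Omega>: "K \<subseteq> \<Omega>"
  proof
    fix x assume x: "x \<in> K"
    show "x \<in> \<Omega>"
    proof (rule ccontr)
      assume "x \<notin> \<Omega>"
      then have "\<eta> \<le> dist x x" using x unfolding K_def by blast
      then show False using \<eta> by simp
    qed
  qed
  have zero: "avg w x = 0" if "x \<notin> K" for x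
  proof -
    have "\<exists>y. y \<notin> \<Omega> \<and> norm (x - y) \<le> \<eta>"
    proof (cases "x \<in> \<Omega>")
      case True
      then have "x \<in> closure \<Omega>" using closure_subset by blast
      then obtain y where "y \<notin> \<Omega>" "\<not> \<eta> \<le> dist x y" using \<open>x \<notin> K\<close> unfolding K_def by blast
      then show ?thesis by (auto simp: dist_norm)
    qed (use \<eta> in \<open>auto intro!: exI[of _ x]\<close>)
    then obtain y where "y \<notin> \<Omega>" "norm (x - y) \<le> \<eta>" by blast
    from \<Phi>[OF this] show ?thesis using w(2) \<rho> by (intro avg_zero[of \<eta>]) auto
  qed
  have "continuous_on UNIV (\<lambda>x. c * avg w x)" by (rule lipschitz_continuous(2)[OF lip])
  then have "compact ((\<lambda>x. c * avg w x) ` K)" using K by (intro compact_continuous_image) (auto intro: continuous_on_subset)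
  then obtain m where m: "\<And>x. x \<in> K \<Longrightarrow> \<bar>c * avg w x\<bar> \<le> m"
    using compact_imp_bounded[of "(\<lambda>x. c * avg w x) ` K"] by (auto simp: bounded_iff)
  have "\<bar>c * avg w x\<bar> \<le> \<bar>m\<bar>" for x
    using m[of x] zero[of x] by (cases "x \<in> K") auto
  then show thesis using that[of C K "\<bar>m\<bar>"] lip K K\<Omega> zero by auto
qed

text \<open>
  Write \<open>w = v1 + w2\<close> with \<open>v1\<close> continuous on a large ball and \<open>w2\<close> small at the scale \<open>2 / \<theta>\<close>. On
  \<open>\<Omega>\<close> the averages of \<open>v1\<close> are uniformly close to \<open>v1\<close>; \<open>w2\<close> and its averages are equally small,
  and their pairings are estimated separately.
\<close>

lemma average_pairing_close:
  fixes \<Omega> :: "'a::euclidean_space set" and u w :: "'a \<Rightarrow> real"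
  assumes \<Omega>: "open \<Omega>" "bounded \<Omega>" 
    and u[measurable]: "u \<in> borel_measurable (lebesgue_on \<Omega>)" and u2: "integrable (lebesgue_on \<Omega>) (\<lambda>x. G \<bar>2 * u x\<bar>)"
    and w[measurable]: "w \<in> borel_measurable borel" and w0: "\<And>x. x \<notin> \<Omega> \<Longrightarrow> w x = 0"
    and wfin: "\<And>c. (\<integral>\<^sup>+x. ennreal (G \<bar>c * w x\<bar>) \<partial>lborel) < \<infinity>" and wint: "integrable lborel w"
    and \<epsilon>: "\<epsilon> > 0"
  obtains d where "d > 0" "\<And>e \<Phi> \<rho> B \<eta>. \<lbrakk>averaging G g \<Phi> \<rho> (1 / (1 - e)) (1 + e) B; 0 < e; e \<le> d; e \<le> 1/2; \<eta> \<le> e;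
     \<And>w. norm w \<ge> \<eta> \<Longrightarrow> \<rho> w = 0; \<And>x. norm (\<Phi> x - x) \<le> e\<rbrakk> \<Longrightarrow>
     \<bar>(LINT x|lebesgue_on \<Omega>. young_deriv g (u x) * averaging.avg \<Phi> \<rho> w x) - (LINT x|lebesgue_on \<Omega>. young_deriv g (u x) * w x)\<bar> \<le> \<epsilon>"
proof -
  let ?M = "lebesgue_on \<Omega>" and ?n = "DIM('a)"
  have [measurable]: "\<Omega> \<in> sets borel" using \<Omega> by simp
  have fm: "finite_measure ?M"
    by (rule finite_measureI) (use emeasure_bounded_finite[OF \<Omega>(2)] in \<open>auto simp: emeasure_restrict_space\<close>)
  define A where "A = (LINT x|?M. g \<bar>u x\<bar> * \<bar>u x\<bar>)"
  have iA: "integrable ?M (\<lambda>x. g \<bar>u x\<bar> * \<bar>u x\<bar>)"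
    by (rule young_deriv_pairing(2)[OF u u u2, of 1]) (use u2 in auto)
  have A: "A \<ge> 0" unfolding A_def using g_nonneg by (intro integral_nonneg_AE) auto
  have iH: "integrable ?M (\<lambda>x. \<bar>young_deriv g (u x)\<bar>)" by (rule integrable_g_abs[OF u fm iA])
  have hm[measurable]: "(\<lambda>x. young_deriv g (u x)) \<in> borel_measurable ?M" by measurable
  define H where "H = (LINT x|?M. \<bar>young_deriv g (u x)\<bar>)"
  have H: "H \<ge> 0" unfolding H_def by (intro integral_nonneg_AE) auto
  define S where "S = 2 * A + H + 1 + 2 ^ ?n"
  have S: "S > 0" using A H by (simp add: S_def add_nonneg_pos)
  define \<theta> where "\<theta> = \<epsilon> / S"
  have \<theta>: "\<theta> > 0" "\<theta> * S = \<epsilon>" using \<epsilon> S by (auto simp: \<theta>_def)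
  obtain R where R: "R > 0" "\<Omega> \<subseteq> ball 0 R" using bounded_subset_ballD[OF \<Omega>(2), of 0] by auto
  define D where "D = cball (0::'a) (R + 1)"
  have [measurable]: "D \<in> sets borel" by (simp add: D_def)
  have \<Omega>D: "\<Omega> \<subseteq> D" using R by (auto simp: D_def)
  obtain v where v: "continuous_on UNIV v" and vm: "(\<integral>\<^sup>+x. ennreal (G \<bar>2 / \<theta> * (w x - v x * indicator D x)\<bar>) \<partial>lborel) \<le> 1"
  proof (rule continuous_modular_approximation[OF w, of D "2 / \<theta>"])
    show "bounded D" "D \<in> sets borel" by (auto simp: D_def)
    show "w x = 0" if "x \<notin> D" for x using that w0 \<Omega>D by blast
    show "(\<integral>\<^sup>+x. ennreal (G \<bar>2 * (2 / \<theta>) * w x\<bar>) \<partial>lborel) < \<infinity>" by (rule wfin)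
  qed
  have [measurable]: "v \<in> borel_measurable borel" using v by (rule borel_measurable_continuous_onI)
  have "uniformly_continuous_on D v"
    using v by (intro compact_uniformly_continuous continuous_on_subset[OF v]) (auto simp: D_def)
  then obtain \<delta> where \<delta>: "\<delta> > 0" "\<And>x y. x \<in> D \<Longrightarrow> y \<in> D \<Longrightarrow> dist y x < \<delta> \<Longrightarrow> dist (v y) (v x) < \<theta>"
    unfolding uniformly_continuous_on_def using \<theta>(1) by metis
  define v1 where "v1 x = v x * indicator D x" for x
  define w2 where "w2 x = w x - v1 x" for x
  have [measurable]: "v1 \<in> borel_measurable borel" "w2 \<in> borel_measurable borel" unfolding v1_def w2_def by measurable
  have iv1: "integrable lborel v1"
    using borel_integrable_compact[of D v] continuous_on_subset[OF v] by (simp add: v1_def[abs_def] D_def mult.commute)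
  then have iw2: "integrable lborel w2" unfolding w2_def using wint by simp
  have w2m: "(\<integral>\<^sup>+x. ennreal (G \<bar>2 / \<theta> * w2 x\<bar>) \<partial>lborel) \<le> ennreal 1" using vm by (simp add: w2_def v1_def)
  have pw2: "integrable ?M (\<lambda>x. young_deriv g (u x) * w2 x)" "\<bar>LINT x|?M. young_deriv g (u x) * w2 x\<bar> \<le> \<theta> * A + \<theta> * 1"
  proof -
    note r = restrict_modular[of "\<lambda>x. 2 / \<theta> * w2 x" \<Omega>, OF _ _ w2m]
    have m2: "w2 \<in> borel_measurable ?M" by (intro measurable_restrict_space1 borel_imp_lebesgue) measurable
    note p = young_deriv_pairing[OF u m2 u2 _ \<theta>(1)]
    show "integrable ?M (\<lambda>x. young_deriv g (u x) * w2 x)" by (rule p(1)) (rule r(1), auto)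
    have "\<bar>LINT x|?M. young_deriv g (u x) * w2 x\<bar> \<le> \<theta> * A + \<theta> * (LINT x|?M. G \<bar>2 / \<theta> * w2 x\<bar>)"
      unfolding A_def by (rule p(3)) (rule r(1), auto)
    also have "\<dots> \<le> \<theta> * A + \<theta> * 1" using \<theta> by (intro add_left_mono mult_left_mono r(2)) auto
    finally show "\<bar>LINT x|?M. young_deriv g (u x) * w2 x\<bar> \<le> \<theta> * A + \<theta> * 1" .
  qed
  show thesis
  proof (rule that[of "\<delta> / 4"])
    show "\<delta> / 4 > 0" using \<delta> by simp
    fix e :: real and \<Phi> :: "'a \<Rightarrow> 'a" and \<rho> :: "'a \<Rightarrow> real" and B \<eta> :: real
    assume av: "averaging G g \<Phi> \<rho> (1 / (1 - e)) (1 + e) B" and e: "0 < e" "e \<le> \<delta> / 4" "e \<le> 1/2" "\<eta> \<le> e"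
      and \<rho>: "\<And>w. norm w \<ge> \<eta> \<Longrightarrow> \<rho> w = 0" and \<Phi>: "\<And>x. norm (\<Phi> x - x) \<le> e"
    interpret averaging G g \<Phi> \<rho> "1 / (1 - e)" "1 + e" B by fact
    have m2: "avg w2 \<in> borel_measurable borel" "avg v1 \<in> borel_measurable borel" by (auto intro: avg_measurable)
    then have m2': "avg w2 \<in> borel_measurable ?M" "avg v1 \<in> borel_measurable ?M" "v \<in> borel_measurable ?M"
      by (auto intro!: measurable_restrict_space1 borel_imp_lebesgue)
    have "(\<integral>\<^sup>+x. ennreal (G \<bar>2 / \<theta> * avg w2 x\<bar>) \<partial>lborel) \<le> ennreal ((1 / (1 - e)) ^ ?n) * ennreal 1"
    proof (rule order_trans[OF avg_modular[OF iw2]])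
      show "w2 \<in> borel_measurable borel" by measurable
    qed (rule mult_left_mono[OF w2m], simp)
    also have "\<dots> \<le> ennreal (2 ^ ?n)"
    proof -
      have "(1 / (1 - e)) ^ ?n \<le> 2 ^ ?n" using e by (intro power_mono) (auto simp: field_simps)
      then show ?thesis by (simp add: ennreal_leI del: ennreal_numeral ennreal_power)
    qed
    finally have aw2: "(\<integral>\<^sup>+x. ennreal (G \<bar>2 / \<theta> * avg w2 x\<bar>) \<partial>lborel) \<le> ennreal (2 ^ ?n)" .
    have paw2: "integrable ?M (\<lambda>x. young_deriv g (u x) * avg w2 x)" "\<bar>LINT x|?M. young_deriv g (u x) * avg w2 x\<bar> \<le> \<theta> * A + \<theta> * 2 ^ ?n"
    proof -
      note r = restrict_modular[of "\<lambda>x. 2 / \<theta> * avg w2 x" \<Omega>, OF _ _ aw2]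
      note p = young_deriv_pairing[OF u m2'(1) u2 _ \<theta>(1)]
      show "integrable ?M (\<lambda>x. young_deriv g (u x) * avg w2 x)" by (rule p(1)) (rule r(1), use m2 in auto)
      have "\<bar>LINT x|?M. young_deriv g (u x) * avg w2 x\<bar> \<le> \<theta> * A + \<theta> * (LINT x|?M. G \<bar>2 / \<theta> * avg w2 x\<bar>)"
        unfolding A_def by (rule p(3)) (rule r(1), use m2 in auto)
      also have "\<dots> \<le> \<theta> * A + \<theta> * 2 ^ ?n" using \<theta> m2 by (intro add_left_mono mult_left_mono r(2)) auto
      finally show "\<bar>LINT x|?M. young_deriv g (u x) * avg w2 x\<bar> \<le> \<theta> * A + \<theta> * 2 ^ ?n" .
    qed
    have close: "\<bar>avg v1 x - v x\<bar> \<le> \<theta>" if x: "x \<in> \<Omega>" for x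
    proof (rule avg_close[OF \<rho> iv1])
      fix z :: 'a assume z: "norm z < \<eta>"
      have d: "norm (\<Phi> x + z - x) \<le> 2 * e"
      proof -
        have eq: "\<Phi> x + z - x = (\<Phi> x - x) + z" by simp
        show ?thesis
          unfolding eq using norm_triangle_ineq[of "\<Phi> x - x" z] \<Phi>[of x] z e(4) by linarith
      qed
      have "norm (\<Phi> x + z) \<le> norm x + norm (\<Phi> x + z - x)" using norm_triangle_ineq[of x "\<Phi> x + z - x"] by simp
      then have D: "\<Phi> x + z \<in> D" using x R d e by (auto simp: D_def)
      have "x \<in> D" using x \<Omega>D by blast
      from \<delta>(2)[OF this D] have "\<bar>v (\<Phi> x + z) - v x\<bar> < \<theta>" using d e \<delta>(1) by (simp add: dist_norm)
      then show "\<bar>v1 (\<Phi> x + z) - v x\<bar> \<le> \<theta>" using D by (simp add: v1_def)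
    qed
    have b1: "\<bar>young_deriv g (u x) * (avg v1 x - v x)\<bar> \<le> \<theta> * \<bar>young_deriv g (u x)\<bar>" if "x \<in> space ?M" for x
      using mult_left_mono[OF close[of x], of "\<bar>young_deriv g (u x)\<bar>"] that by (simp add: abs_mult mult.commute)
    have i1: "integrable ?M (\<lambda>x. young_deriv g (u x) * (avg v1 x - v x))"
    proof (rule Bochner_Integration.integrable_bound)
      show "integrable ?M (\<lambda>x. \<theta> * \<bar>young_deriv g (u x)\<bar>)" using iH by simp
      show "AE x in ?M. norm (young_deriv g (u x) * (avg v1 x - v x)) \<le> norm (\<theta> * \<bar>young_deriv g (u x)\<bar>)"
        using b1 \<theta> by (intro AE_I2) (auto simp: abs_mult)
    qed (use m2' in measurable)
    have "\<bar>LINT x|?M. young_deriv g (u x) * (avg v1 x - v x)\<bar> \<le> (LINT x|?M. \<theta> * \<bar>young_deriv g (u x)\<bar>)"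
      by (rule order_trans[OF integral_abs_bound]) (rule integral_mono, use i1 iH b1 in auto)
    then have p1: "\<bar>LINT x|?M. young_deriv g (u x) * (avg v1 x - v x)\<bar> \<le> \<theta> * H" by (simp add: H_def)
    have iw: "integrable ?M (\<lambda>x. young_deriv g (u x) * w x)"
    proof -
      obtain r where r: "(\<integral>\<^sup>+x. ennreal (G \<bar>2 / 1 * w x\<bar>) \<partial>lborel) = ennreal r" "r \<ge> 0"
        using wfin[of "2 / 1"] by (metis enn2real_nonneg ennreal_enn2real infinity_ennreal_def)
      have "w \<in> borel_measurable ?M" by (intro measurable_restrict_space1 borel_imp_lebesgue) measurable
      then show ?thesis using restrict_modular(1)[of "\<lambda>x. 2 / 1 * w x" \<Omega> r] r
        by (intro young_deriv_pairing(1)[OF u _ u2, of _ 1]) auto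
    qed
    have eq: "young_deriv g (u x) * avg w x = young_deriv g (u x) * w x + young_deriv g (u x) * (avg v1 x - v x) + young_deriv g (u x) * avg w2 x - young_deriv g (u x) * w2 x"
      if "x \<in> space ?M" for x
    proof -
      have "avg w2 x = avg w x - avg v1 x" unfolding w2_def by (rule avg_diff[OF wint iv1])
      then have e1: "avg w x = avg v1 x + avg w2 x" by simp
      have e2: "w x = v x + w2 x" using that \<Omega>D by (auto simp: w2_def v1_def)
      show ?thesis unfolding e1 e2 by (simp add: algebra_simps)
    qed
    have "(LINT x|?M. young_deriv g (u x) * avg w x) = (LINT x|?M. young_deriv g (u x) * w x + young_deriv g (u x) * (avg v1 x - v x) + young_deriv g (u x) * avg w2 x - young_deriv g (u x) * w2 x)"
      by (rule Bochner_Integration.integral_cong[OF refl eq])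
    also have "\<dots> = (LINT x|?M. young_deriv g (u x) * w x) + (LINT x|?M. young_deriv g (u x) * (avg v1 x - v x)) + (LINT x|?M. young_deriv g (u x) * avg w2 x) - (LINT x|?M. young_deriv g (u x) * w2 x)"
      using iw i1 paw2(1) pw2(1) by simp
    finally have "\<bar>(LINT x|?M. young_deriv g (u x) * avg w x) - (LINT x|?M. young_deriv g (u x) * w x)\<bar> \<le> \<theta> * H + (\<theta> * A + \<theta> * 2 ^ ?n) + (\<theta> * A + \<theta> * 1)"
      using p1 paw2(2) pw2(2) by linarith
    also have "\<dots> = \<theta> * S" by (simp add: S_def algebra_simps)
    finally show "\<bar>(LINT x|?M. young_deriv g (u x) * avg w x) - (LINT x|?M. young_deriv g (u x) * w x)\<bar> \<le> \<epsilon>"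
      using \<theta> by simp
  qed
qed

end

context young begin

text \<open>
  The average of \<open>u\<close> is multiplied by \<open>c = (1 + e)\<^sup>-\<^sup>s\<close> because the energy estimate holds for this
  multiple; \<open>c\<close> and the volume factors tend to 1 with \<open>e\<close>.
\<close>

lemma lipschitz_recovery:
  fixes \<Omega> :: "'a::euclidean_space set"
  assumes s: "0 < s" "s < 1" and \<Omega>: "open \<Omega>" "bounded \<Omega>" "\<Omega> \<noteq> {}" "lipschitz_boundary \<Omega>"
    and u: "u \<in> frac_WL0 s G \<Omega>" and F: "integrable frac_mu (\<lambda>z. G \<bar>frac_D s u z\<bar>)" and \<epsilon>: "\<epsilon> > 0"
  obtains f C K m where "\<And>x y. \<bar>f x - f y\<bar> \<le> C * norm (x - y)" "compact K" "K \<subseteq> \<Omega>"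
    "\<And>x. x \<notin> K \<Longrightarrow> f x = 0" "\<And>x. \<bar>f x\<bar> \<le> m"
    "(LINT z|frac_mu. G \<bar>frac_D s f z\<bar>) \<le> (LINT z|frac_mu. G \<bar>frac_D s u z\<bar>) + \<epsilon>"
    "\<bar>(LINT x|lebesgue_on \<Omega>. young_deriv g (u x) * f x) - (LINT x|lebesgue_on \<Omega>. young_deriv g (u x) * u x)\<bar> \<le> \<epsilon>"
proof -
  let ?M = "lebesgue_on \<Omega>" and ?n = "DIM('a)"
  obtain w where w[measurable]: "w \<in> borel_measurable borel" and uw: "AE x in lebesgue. u x = w x" and w0: "\<And>x. x \<notin> \<Omega> \<Longrightarrow> w x = 0"
    and wfin: "\<And>c. (\<integral>\<^sup>+x. ennreal (G \<bar>c * w x\<bar>) \<partial>lborel) < \<infinity>" and wint: "integrable lborel w"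
    by (rule frac_WL0_borel_representative[OF s(1) \<Omega>(1-3) u]) (rule that, assumption+)
  have uWL: "u \<in> frac_WL s G \<Omega>" by (rule frac_WL0_subset[OF u])
  have um[measurable]: "u \<in> borel_measurable ?M" using uWL by (auto simp: frac_WL_def intro: measurable_restrict_space1)
  have wm: "w \<in> borel_measurable ?M" by (intro measurable_restrict_space1 borel_imp_lebesgue w)
  have hm[measurable]: "(\<lambda>x. young_deriv g (u x)) \<in> borel_measurable ?M" by measurable
  have u2: "integrable ?M (\<lambda>x. G \<bar>2 * u x\<bar>)" by (rule frac_WL_all_moments[OF uWL s(1) \<Omega>(2)]) (use \<Omega> in simp)
  define E where "E = (LINT z|frac_mu. G \<bar>frac_D s u z\<bar>)"
  have "(\<integral>\<^sup>+z. ennreal (G \<bar>frac_D s w z\<bar>) \<partial>frac_mu) = (\<integral>\<^sup>+z. ennreal (G \<bar>frac_D s u z\<bar>) \<partial>frac_mu)"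
    using frac_D_cong_AE[OF uw, of s] by (intro nn_integral_cong_AE) auto
  also have "\<dots> = ennreal E" unfolding E_def by (rule nn_integral_eq_integral[OF F]) (auto simp: G_nonneg)
  finally have wE: "(\<integral>\<^sup>+z. ennreal (G \<bar>frac_D s w z\<bar>) \<partial>frac_mu) = ennreal E" .
  have E: "E \<ge> 0" unfolding E_def by (intro integral_nonneg_AE) (auto simp: G_nonneg)
  define P where "P = (LINT x|?M. young_deriv g (u x) * u x)"
  have Pw: "(LINT x|?M. young_deriv g (u x) * w x) = P"
    unfolding P_def using AE_lebesgue_onI[OF uw, of \<Omega>] \<Omega>(1) wm by (intro integral_cong_AE) auto
  obtain d where d: "d > 0" "\<And>e \<Phi> \<rho> B \<eta>. \<lbrakk>averaging G g \<Phi> \<rho> (1 / (1 - e)) (1 + e) B; 0 < e; e \<le> d; e \<le> 1/2; \<eta> \<le> e;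
     \<And>w. norm w \<ge> \<eta> \<Longrightarrow> \<rho> w = 0; \<And>x. norm (\<Phi> x - x) \<le> e\<rbrakk> \<Longrightarrow>
     \<bar>(LINT x|?M. young_deriv g (u x) * averaging.avg \<Phi> \<rho> w x) - (LINT x|?M. young_deriv g (u x) * w x)\<bar> \<le> \<epsilon> / 2"
    using average_pairing_close[OF \<Omega>(1,2) um u2 w w0 wfin wint, of "\<epsilon> / 2"] \<epsilon> by auto
  have "\<forall>\<^sub>F e in at_right 0. (1 + e) ^ ?n * (1 / (1 - e)) ^ ?n * (1 / (1 - e)) ^ ?n * E < E + \<epsilon>"
  proof (rule order_tendstoD(2)[where y = E])
    have "((\<lambda>e. (1 + e) ^ ?n * (1 / (1 - e)) ^ ?n * (1 / (1 - e)) ^ ?n * E) \<longlongrightarrow> (1 + 0) ^ ?n * (1 / (1 - 0)) ^ ?n * (1 / (1 - 0)) ^ ?n * E) (at_right 0)"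
      by (intro tendsto_intros) auto
    then show "((\<lambda>e. (1 + e) ^ ?n * (1 / (1 - e)) ^ ?n * (1 / (1 - e)) ^ ?n * E) \<longlongrightarrow> E) (at_right 0)" by simp
  qed (use \<epsilon> in auto)
  moreover have "\<forall>\<^sub>F e in at_right 0. (1 - (1 + e) powr (- s)) * \<bar>P\<bar> < \<epsilon> / 2"
  proof (rule order_tendstoD(2)[where y = 0])
    have "((\<lambda>e. (1 - (1 + e) powr (- s)) * \<bar>P\<bar>) \<longlongrightarrow> (1 - (1 + 0) powr (- s)) * \<bar>P\<bar>) (at_right 0)"
      by (intro tendsto_intros) auto
    then show "((\<lambda>e. (1 - (1 + e) powr (- s)) * \<bar>P\<bar>) \<longlongrightarrow> 0) (at_right 0)" by simp
  qed (use \<epsilon> in auto)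
  moreover have "\<forall>\<^sub>F e in at_right 0. e \<in> {0<..<min d (1/2)}"
    using d(1) by (intro eventually_at_rightI[of _ "min d (1/2)"]) auto
  ultimately have "\<forall>\<^sub>F e in at_right 0. (1 + e) ^ ?n * (1 / (1 - e)) ^ ?n * (1 / (1 - e)) ^ ?n * E < E + \<epsilon> \<and>
     (1 - (1 + e) powr (- s)) * \<bar>P\<bar> < \<epsilon> / 2 \<and> e \<in> {0<..<min d (1/2)}"
    by (intro eventually_conj)
  then obtain e :: real where e: "(1 + e) ^ ?n * (1 / (1 - e)) ^ ?n * (1 / (1 - e)) ^ ?n * E < E + \<epsilon>"
     "(1 - (1 + e) powr (- s)) * \<bar>P\<bar> < \<epsilon> / 2" "0 < e" "e < d" "e < 1/2"
    using eventually_happens'[OF trivial_limit_at_right_real] by fastforce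
  obtain \<Phi> :: "'a \<Rightarrow> 'a" and \<rho> B \<eta> where av: "averaging G g \<Phi> \<rho> (1 / (1 - e)) (1 + e) B" and \<eta>: "0 < \<eta>" "\<eta> \<le> e"
    and \<rho>: "\<And>w. norm w \<ge> \<eta> \<Longrightarrow> \<rho> w = 0" and \<Phi>: "\<And>x. norm (\<Phi> x - x) \<le> e"
    "\<And>x y z. y \<notin> \<Omega> \<Longrightarrow> norm (x - y) \<le> \<eta> \<Longrightarrow> norm (z - \<Phi> x) \<le> \<eta> \<Longrightarrow> z \<notin> \<Omega>"
    by (rule exists_averaging[OF \<Omega>(1,2,4) e(3), OF less_imp_le[OF e(5)]]) (rule that, assumption+)
  interpret averaging G g \<Phi> \<rho> "1 / (1 - e)" "1 + e" B by fact
  define c where "c = (1 + e) powr (- s)"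
  have c: "0 \<le> c" "c \<le> 1"
    using e s by (auto simp: c_def powr_minus intro!: inverse_le_1_iff[THEN iffD2] ge_one_powr_ge_zero)
  define f where "f x = c * avg w x" for x
  obtain C K m where f': "\<And>x y. \<bar>c * avg w x - c * avg w y\<bar> \<le> C * norm (x - y)" "compact K" "K \<subseteq> \<Omega>"
    "\<And>x. x \<notin> K \<Longrightarrow> c * avg w x = 0" "\<And>x. \<bar>c * avg w x\<bar> \<le> m"
    by (rule lipschitz_average[OF av \<Omega>(1,2) \<eta>(1) \<rho> \<Phi>(2) wint w0, where c = c]) (assumption | rule that)+
  note f = f'[folded f_def]
  have "frac_D s f z = c * frac_D s (avg w) z" for z
    using frac_D_linear[of s c "avg w" 0 "avg w" z] by (simp add: f_def[abs_def])
  then have "(\<integral>\<^sup>+z. ennreal (G \<bar>frac_D s f z\<bar>) \<partial>frac_mu) \<le> ennreal ((1 + e) ^ ?n * (1 / (1 - e)) ^ ?n * (1 / (1 - e)) ^ ?n) * ennreal E"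
    using avg_energy[OF wint w s(1)] by (simp add: c_def wE)
  also have "\<dots> = ennreal ((1 + e) ^ ?n * (1 / (1 - e)) ^ ?n * (1 / (1 - e)) ^ ?n * E)"
    using e E by (intro ennreal_mult[symmetric]) auto
  finally have le: "(\<integral>\<^sup>+z. ennreal (G \<bar>frac_D s f z\<bar>) \<partial>frac_mu) \<le> ennreal ((1 + e) ^ ?n * (1 / (1 - e)) ^ ?n * (1 / (1 - e)) ^ ?n * E)" .
  have iF: "integrable frac_mu (\<lambda>z. G \<bar>frac_D s f z\<bar>)"
    using lipschitz_frac_D_integrable[OF s f(1) f(4) f(5) compact_imp_bounded[OF f(2)] borel_compact[OF f(2)], of 1] by simp
  have "ennreal (LINT z|frac_mu. G \<bar>frac_D s f z\<bar>) \<le> ennreal ((1 + e) ^ ?n * (1 / (1 - e)) ^ ?n * (1 / (1 - e)) ^ ?n * E)"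
    using le by (subst (asm) nn_integral_eq_integral[OF iF]) (auto simp: G_nonneg)
  then have "(LINT z|frac_mu. G \<bar>frac_D s f z\<bar>) \<le> (1 + e) ^ ?n * (1 / (1 - e)) ^ ?n * (1 / (1 - e)) ^ ?n * E"
    using e E by (subst (asm) ennreal_le_iff) auto
  then have 1: "(LINT z|frac_mu. G \<bar>frac_D s f z\<bar>) \<le> E + \<epsilon>" using e(1) by linarith
  define a where "a = (LINT x|?M. young_deriv g (u x) * avg w x)"
  have a: "\<bar>a - P\<bar> \<le> \<epsilon> / 2"
    using d(2)[OF av e(3) less_imp_le[OF e(4)] less_imp_le[OF e(5)] \<eta>(2) \<rho> \<Phi>(1)] by (simp add: a_def Pw)
  have "(LINT x|?M. young_deriv g (u x) * f x) = (LINT x|?M. c * (young_deriv g (u x) * avg w x))"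
    by (intro Bochner_Integration.integral_cong) (auto simp: f_def)
  also have "\<dots> = c * a" by (simp add: a_def)
  finally have "\<bar>(LINT x|?M. young_deriv g (u x) * f x) - P\<bar> = \<bar>c * (a - P) - (1 - c) * P\<bar>" by (simp add: algebra_simps)
  also have "\<dots> \<le> \<bar>c * (a - P)\<bar> + \<bar>(1 - c) * P\<bar>" by (rule abs_triangle_ineq4)
  also have "\<bar>c * (a - P)\<bar> \<le> 1 * (\<epsilon> / 2)" unfolding abs_mult using c a by (intro mult_mono) auto
  also have "\<bar>(1 - c) * P\<bar> \<le> \<epsilon> / 2" using e(2) c by (simp add: abs_mult c_def)
  finally have 2: "\<bar>(LINT x|?M. young_deriv g (u x) * f x) - P\<bar> \<le> \<epsilon>" by simp
  show thesis by (rule that[OF f]) (use 1 2 in \<open>simp_all add: E_def P_def\<close>)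
qed

section \<open>The first variation of the energy\<close>

text \<open>
  The difference quotients \<open>Q n\<close> converge to the integrand and lie below the integrable function
  \<open>Y\<close>. Fatou's lemma for \<open>Y - Q n\<close> gives integrability of the limit as well as the sign of its
  integral.
\<close>

lemma variation_nonneg:
  assumes [measurable]: "U \<in> borel_measurable M" "V \<in> borel_measurable M"
    and U: "integrable M (\<lambda>z. G \<bar>U z\<bar>)" and V: "integrable M (\<lambda>z. G \<bar>V z\<bar>)"
    and cont: "AE z in M. U z = 0 \<or> isCont g \<bar>U z\<bar>"
    and min: "\<And>t. 0 < t \<Longrightarrow> t < 1 \<Longrightarrow> (\<integral>z. G \<bar>U z\<bar> \<partial>M) \<le> (\<integral>z. G \<bar>(1 - t) * U z + t * V z\<bar> \<partial>M)"
  shows "integrable M (\<lambda>z. young_deriv g (U z) * (V z - U z))" "0 \<le> (\<integral>z. young_deriv g (U z) * (V z - U z) \<partial>M)"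
proof -
  define t where "t n = 1 / real (Suc (Suc n))" for n
  have t: "0 < t n" "t n < 1" for n by (auto simp: t_def)
  have "(\<lambda>n. 1 / real (Suc n)) \<longlonglongrightarrow> 0" by (rule LIMSEQ_Suc) (rule lim_const_over_n)
  then have t0: "t \<longlonglongrightarrow> 0" unfolding t_def by (rule LIMSEQ_Suc)
  define Y where "Y z = G \<bar>V z\<bar> - G \<bar>U z\<bar>" for z
  define Q where "Q n z = (G \<bar>U z + t n * (V z - U z)\<bar> - G \<bar>U z\<bar>) / t n" for n z
  have iY: "integrable M Y" unfolding Y_def using U V by simp
  have arg: "U z + t n * (V z - U z) = (1 - t n) * U z + t n * V z" for n z by (simp add: algebra_simps)
  have QY: "Q n z \<le> Y z" for n z
  proof -
    have "G \<bar>(1 - t n) * U z + t n * V z\<bar> \<le> (1 - t n) * G \<bar>U z\<bar> + t n * G \<bar>V z\<bar>"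
      using t[of n] by (intro gauge_abs_convex[OF gauge_G]) auto
    then show ?thesis using t[of n] by (simp add: Q_def Y_def arg field_simps)
  qed
  have iG: "integrable M (\<lambda>z. G \<bar>U z + t n * (V z - U z)\<bar>)" for n
  proof (rule Bochner_Integration.integrable_bound[OF Bochner_Integration.integrable_add[OF U V]])
    show "AE z in M. norm (G \<bar>U z + t n * (V z - U z)\<bar>) \<le> norm (G \<bar>U z\<bar> + G \<bar>V z\<bar>)"
    proof (rule AE_I2)
      fix z
      have "G \<bar>(1 - t n) * U z + t n * V z\<bar> \<le> (1 - t n) * G \<bar>U z\<bar> + t n * G \<bar>V z\<bar>"
        using t[of n] by (intro gauge_abs_convex[OF gauge_G]) auto
      also have "\<dots> \<le> 1 * G \<bar>U z\<bar> + 1 * G \<bar>V z\<bar>"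
        using t[of n] by (intro add_mono mult_right_mono G_nonneg) auto
      finally show "norm (G \<bar>U z + t n * (V z - U z)\<bar>) \<le> norm (G \<bar>U z\<bar> + G \<bar>V z\<bar>)"
        by (simp add: arg G_nonneg)
    qed
  qed measurable
  have iQ: "integrable M (Q n)" for n unfolding Q_def using U iG by simp
  have Q0: "0 \<le> (\<integral>z. Q n z \<partial>M)" for n
    using min[of "t n"] t[of n] U iG[of n] by (simp add: Q_def arg)
  let ?H = "\<lambda>z. young_deriv g (U z) * (V z - U z)"
  have HY: "?H z \<le> Y z" for z using G_abs_subgrad[of "U z" "V z"] by (simp add: Y_def)
  have lim: "AE z in M. (\<lambda>n. ennreal (Y z - Q n z)) \<longlonglongrightarrow> ennreal (Y z - ?H z)"
    using cont
  proof eventually_elim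
    case (elim z)
    have "(\<lambda>n. Q n z) \<longlonglongrightarrow> ?H z" unfolding Q_def by (rule G_abs_deriv[OF elim t(1) t0])
    then show ?case by (intro tendsto_ennrealI tendsto_intros)
  qed
  have "(\<integral>\<^sup>+z. ennreal (Y z - ?H z) \<partial>M) = (\<integral>\<^sup>+z. liminf (\<lambda>n. ennreal (Y z - Q n z)) \<partial>M)"
  proof (rule nn_integral_cong_AE)
    show "AE z in M. ennreal (Y z - ?H z) = liminf (\<lambda>n. ennreal (Y z - Q n z))"
      using lim by eventually_elim (simp add: lim_imp_Liminf)
  qed
  also have "\<dots> \<le> liminf (\<lambda>n. \<integral>\<^sup>+z. ennreal (Y z - Q n z) \<partial>M)"
    by (rule nn_integral_liminf) (auto simp: Y_def Q_def)
  also have "\<dots> \<le> limsup (\<lambda>n. \<integral>\<^sup>+z. ennreal (Y z - Q n z) \<partial>M)" by (rule Liminf_le_Limsup) simp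
  also have "\<dots> \<le> ennreal (\<integral>z. Y z \<partial>M)"
  proof (rule Limsup_bounded, rule always_eventually, rule allI)
    fix n
    have "(\<integral>\<^sup>+z. ennreal (Y z - Q n z) \<partial>M) = ennreal (\<integral>z. Y z - Q n z \<partial>M)"
      using iY iQ QY by (intro nn_integral_eq_integral) auto
    also have "\<dots> \<le> ennreal (\<integral>z. Y z \<partial>M)" using iY iQ Q0[of n] by (intro ennreal_leI) simp
    finally show "(\<integral>\<^sup>+z. ennreal (Y z - Q n z) \<partial>M) \<le> ennreal (\<integral>z. Y z \<partial>M)" .
  qed
  finally have le: "(\<integral>\<^sup>+z. ennreal (Y z - ?H z) \<partial>M) \<le> ennreal (\<integral>z. Y z \<partial>M)" .
  have iYH: "integrable M (\<lambda>z. Y z - ?H z)"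
    using le HY by (subst integrable_nonneg_iff) (auto simp: Y_def order_le_less_trans)
  from Bochner_Integration.integrable_diff[OF iY this] show iH: "integrable M ?H" by simp
  have "0 \<le> (\<integral>z. Y z \<partial>M)"
    using Q0[of 0] integral_mono[OF iQ iY QY, of 0] by linarith
  moreover have "ennreal (\<integral>z. Y z - ?H z \<partial>M) \<le> ennreal (\<integral>z. Y z \<partial>M)"
    using le HY by (subst (asm) nn_integral_eq_integral[OF iYH]) auto
  ultimately have "(\<integral>z. Y z - ?H z \<partial>M) \<le> (\<integral>z. Y z \<partial>M)" by simp
  then show "0 \<le> (\<integral>z. ?H z \<partial>M)" using iY iH by simp
qed

text \<open>
  The mixed term is at most half of the term to be estimated plus a value of \<open>G\<close> at \<open>4 V\<close>.
\<close>

lemma variation_integrable: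
  assumes [measurable]: "U \<in> borel_measurable M" "V \<in> borel_measurable M"
    and V: "integrable M (\<lambda>z. G \<bar>4 * V z\<bar>)"
    and H: "integrable M (\<lambda>z. young_deriv g (U z) * (V z - U z))"
  shows "integrable M (\<lambda>z. g \<bar>U z\<bar> * \<bar>U z\<bar>)"
proof (rule Bochner_Integration.integrable_bound)
  have eq: "g \<bar>U z\<bar> * \<bar>U z\<bar> = young_deriv g (U z) * U z" for z by (simp add: young_deriv_mult_self)
  show "(\<lambda>z. g \<bar>U z\<bar> * \<bar>U z\<bar>) \<in> borel_measurable M" unfolding eq by measurable
  show "integrable M (\<lambda>z. G \<bar>4 * V z\<bar> + 2 * \<bar>young_deriv g (U z) * (V z - U z)\<bar>)" using V H by simp
  show "AE z in M. norm (g \<bar>U z\<bar> * \<bar>U z\<bar>) \<le> norm (G \<bar>4 * V z\<bar> + 2 * \<bar>young_deriv g (U z) * (V z - U z)\<bar>)"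
  proof (rule AE_I2)
    fix z
    have n: "0 \<le> g \<bar>U z\<bar> * \<bar>U z\<bar>" by (intro mult_nonneg_nonneg g_nonneg) auto
    have "\<bar>young_deriv g (U z) * V z\<bar> \<le> 1/2 * (g \<bar>U z\<bar> * \<bar>U z\<bar>) + 1/2 * G (2 / (1/2) * \<bar>V z\<bar>)"
      by (rule young_deriv_young) simp
    moreover have "2 / (1/2) * \<bar>V z\<bar> = \<bar>4 * V z\<bar>" by (simp add: abs_mult)
    moreover have "young_deriv g (U z) * (V z - U z) = young_deriv g (U z) * V z - g \<bar>U z\<bar> * \<bar>U z\<bar>"
      by (simp add: right_diff_distrib eq)
    moreover have "n \<le> k + 2 * \<bar>h\<bar>" if "\<bar>x\<bar> \<le> 1/2 * n + 1/2 * k" "h = x - n" for n k h x :: real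
      using that by linarith
    ultimately have "g \<bar>U z\<bar> * \<bar>U z\<bar> \<le> G \<bar>4 * V z\<bar> + 2 * \<bar>young_deriv g (U z) * (V z - U z)\<bar>"
      by metis
    then show "norm (g \<bar>U z\<bar> * \<bar>U z\<bar>) \<le> norm (G \<bar>4 * V z\<bar> + 2 * \<bar>young_deriv g (U z) * (V z - U z)\<bar>)"
      using n by simp
  qed
qed

end

section \<open>The constrained minimizer\<close>

text \<open>
  In this context \<open>p\<close> is integration against a subgradient of \<open>J\<close> at \<open>u\<close>, and \<open>L\<close> is the
  derivative of \<open>F\<close> at \<open>u\<close>. All multiples of a nice function have finite energy; without a
  doubling condition this is stronger than \<open>fin\<close>, and \<open>u\<close> itself may fail to be nice.
\<close>

locale constrained_minimizer = young G g for G g :: "real \<Rightarrow> real" +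
  fixes s \<alpha> :: real and \<Omega> :: "'a::euclidean_space set" and u :: "'a \<Rightarrow> real"
  assumes \<Omega>: "open \<Omega>" "bounded \<Omega>" "\<Omega> \<noteq> {}" "lipschitz_boundary \<Omega>" and s: "0 < s" "s < 1" and \<alpha>: "\<alpha> > 0"
    and u: "u \<in> frac_WL0 s G \<Omega>" and Ju: "energy_J G \<Omega> u = ennreal \<alpha>"
    and min: "\<And>w. w \<in> frac_WL0 s G \<Omega> \<Longrightarrow> energy_J G \<Omega> w = ennreal \<alpha> \<Longrightarrow> energy_F s G u \<le> energy_F s G w"
begin

abbreviation "W0 \<equiv> frac_WL0 s G \<Omega>"
abbreviation "M\<^sub>\<Omega> \<equiv> lebesgue_on \<Omega>"

definition J :: "('a \<Rightarrow> real) \<Rightarrow> real" where "J v = (LINT x|M\<^sub>\<Omega>. G \<bar>v x\<bar>)"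
definition F :: "('a \<Rightarrow> real) \<Rightarrow> real" where "F v = (LINT z|frac_mu. G \<bar>frac_D s v z\<bar>)"
definition fin :: "('a \<Rightarrow> real) \<Rightarrow> bool" where "fin v \<longleftrightarrow> v \<in> W0 \<and> integrable frac_mu (\<lambda>z. G \<bar>frac_D s v z\<bar>)"
definition p :: "('a \<Rightarrow> real) \<Rightarrow> real" where "p v = (LINT x|M\<^sub>\<Omega>. young_deriv g (u x) * v x)"
definition L :: "('a \<Rightarrow> real) \<Rightarrow> real" where "L v = (LINT z|frac_mu. young_deriv g (frac_D s u z) * frac_D s v z)"
definition nice :: "('a \<Rightarrow> real) \<Rightarrow> bool" where "nice v \<longleftrightarrow> (\<forall>c. fin (\<lambda>x. c * v x))"

lemma \<Omega>_borel [measurable]: "\<Omega> \<in> sets borel" using \<Omega> by simp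

lemma W0_WL: "v \<in> W0 \<Longrightarrow> v \<in> frac_WL s G \<Omega>" by (rule frac_WL0_subset)

lemma W0_measurable:
  assumes "v \<in> W0"
  shows "v \<in> borel_measurable M\<^sub>\<Omega>" "frac_D s v \<in> borel_measurable frac_mu"
  using W0_WL[OF assms] orlicz_L_measurable[OF gauge_G]
  by (auto simp: frac_WL_def)

lemma W0_moments: "v \<in> W0 \<Longrightarrow> integrable M\<^sub>\<Omega> (\<lambda>x. G \<bar>c * v x\<bar>)"
  using frac_WL_all_moments[OF W0_WL s(1) \<Omega>(2) \<Omega>_borel] .

lemma W0_moment1: "v \<in> W0 \<Longrightarrow> integrable M\<^sub>\<Omega> (\<lambda>x. G \<bar>v x\<bar>)"
  using W0_moments[of v 1] by simp

lemma energy_J_eq: "v \<in> W0 \<Longrightarrow> energy_J G \<Omega> v = ennreal (J v)"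
  unfolding energy_J_def J_def by (rule nn_integral_eq_integral[OF W0_moment1]) (auto simp: G_nonneg)

lemma energy_F_eq: "fin v \<Longrightarrow> energy_F s G v = ennreal (F v)"
  unfolding energy_F_def F_def fin_def by (elim conjE, rule nn_integral_eq_integral) (auto simp: G_nonneg)

lemma J_nonneg: "J v \<ge> 0" and F_nonneg: "F v \<ge> 0"
  unfolding J_def F_def by (intro integral_nonneg_AE AE_I2 G_nonneg; simp)+

lemma Ju_eq: "J u = \<alpha>"
  using Ju energy_J_eq[OF u] \<alpha> J_nonneg[of u] by simp

lemma fin_lincomb:
  assumes "fin v" "fin w" "0 \<le> t" "t \<le> 1"
  shows "fin (\<lambda>x. (1 - t) * v x + t * w x)"
  unfolding fin_def
proof (intro conjI)
  show W: "(\<lambda>x. (1 - t) * v x + t * w x) \<in> W0" using assms by (intro frac_WL0_lincomb) (auto simp: fin_def)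
  have i: "integrable frac_mu (\<lambda>z. (1 - t) * G \<bar>frac_D s v z\<bar> + t * G \<bar>frac_D s w z\<bar>)"
    using assms by (simp add: fin_def)
  show "integrable frac_mu (\<lambda>z. G \<bar>frac_D s (\<lambda>x. (1 - t) * v x + t * w x) z\<bar>)"
  proof (rule Bochner_Integration.integrable_bound[OF i])
    show "(\<lambda>z. G \<bar>frac_D s (\<lambda>x. (1 - t) * v x + t * w x) z\<bar>) \<in> borel_measurable frac_mu"
      using W0_measurable[OF W] by (intro gauge_measurable[OF gauge_G])
    show "AE z in frac_mu. norm (G \<bar>frac_D s (\<lambda>x. (1 - t) * v x + t * w x) z\<bar>) \<le> norm ((1 - t) * G \<bar>frac_D s v z\<bar> + t * G \<bar>frac_D s w z\<bar>)"
    proof (rule AE_I2)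
      fix z
      have "G \<bar>frac_D s (\<lambda>x. (1 - t) * v x + t * w x) z\<bar> \<le> (1 - t) * G \<bar>frac_D s v z\<bar> + t * G \<bar>frac_D s w z\<bar>"
        unfolding frac_D_linear using assms by (intro gauge_abs_convex[OF gauge_G])
      then show "norm (G \<bar>frac_D s (\<lambda>x. (1 - t) * v x + t * w x) z\<bar>) \<le> norm ((1 - t) * G \<bar>frac_D s v z\<bar> + t * G \<bar>frac_D s w z\<bar>)"
        using G_nonneg by simp
    qed
  qed
qed

lemma scale_W0: "v \<in> W0 \<Longrightarrow> (\<lambda>x. c * v x) \<in> W0"
  using frac_WL0_lincomb[of v s \<Omega> v c 0] by simp

lemma zero_W0: "(\<lambda>x. 0) \<in> W0" using scale_W0[OF u, of 0] by simp

lemma frac_D_scale: "frac_D s (\<lambda>x. c * v x) z = c * frac_D s v z"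
  using frac_D_linear[of s c v 0 v z] by simp

lemma fin_zero: "fin (\<lambda>x. 0)"
  using zero_W0 frac_D_scale[of 0 u] by (simp add: fin_def G_zero)

lemma fin_shrink:
  assumes "fin v" "0 \<le> t" "t \<le> 1" shows "fin (\<lambda>x. t * v x)" "F (\<lambda>x. t * v x) \<le> F v"
proof -
  show f: "fin (\<lambda>x. t * v x)" using fin_lincomb[OF fin_zero assms] by simp
  show "F (\<lambda>x. t * v x) \<le> F v" unfolding F_def
  proof (rule integral_mono)
    fix z
    show "G \<bar>frac_D s (\<lambda>x. t * v x) z\<bar> \<le> G \<bar>frac_D s v z\<bar>"
      unfolding frac_D_scale using assms by (intro G_mono) (auto simp: abs_mult intro: mult_left_le_one_le)
  qed (use f assms in \<open>auto simp: fin_def\<close>)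
qed

text \<open>
  By dominated convergence \<open>J (t v)\<close> is continuous in \<open>t\<close>; the intermediate value theorem applies.
\<close>

lemma exists_level:
  assumes v: "v \<in> W0" and J: "J v \<ge> \<alpha>"
  obtains t where "0 \<le> t" "t \<le> 1" "J (\<lambda>x. t * v x) = \<alpha>"
proof -
  have cont: "continuous_on {0..1} (\<lambda>t. J (\<lambda>x. t * v x))"
    unfolding continuous_on_sequentially
  proof (intro allI ballI impI)
    fix r :: "nat \<Rightarrow> real" and a assume a: "a \<in> {0..1}" and r: "(\<forall>n. r n \<in> {0..1}) \<and> r \<longlonglongrightarrow> a"
    have [measurable]: "v \<in> borel_measurable M\<^sub>\<Omega>" by (rule W0_measurable[OF v])
    show "((\<lambda>t. J (\<lambda>x. t * v x)) \<circ> r) \<longlonglongrightarrow> J (\<lambda>x. a * v x)"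
      unfolding J_def o_def
    proof (rule integral_dominated_convergence[where w = "\<lambda>x. G \<bar>v x\<bar>"])
      show "(\<lambda>x. G \<bar>r n * v x\<bar>) \<in> borel_measurable M\<^sub>\<Omega>" "(\<lambda>x. G \<bar>a * v x\<bar>) \<in> borel_measurable M\<^sub>\<Omega>" for n
        by (intro gauge_measurable[OF gauge_G]; simp)+
      show "AE x in M\<^sub>\<Omega>. (\<lambda>n. G \<bar>r n * v x\<bar>) \<longlonglongrightarrow> G \<bar>a * v x\<bar>"
      proof (rule AE_I2)
        fix x
        have "(\<lambda>n. r n * v x) \<longlonglongrightarrow> a * v x" using r by (intro tendsto_intros) auto
        then show "(\<lambda>n. G \<bar>r n * v x\<bar>) \<longlonglongrightarrow> G \<bar>a * v x\<bar>"
          by (rule continuous_on_tendsto_compose[OF G_abs_continuous]) auto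
      qed
      show "AE x in M\<^sub>\<Omega>. norm (G \<bar>r n * v x\<bar>) \<le> G \<bar>v x\<bar>" for n
      proof (rule AE_I2)
        fix x
        have "\<bar>r n * v x\<bar> \<le> \<bar>v x\<bar>" using r by (auto simp: abs_mult intro: mult_left_le_one_le)
        then show "norm (G \<bar>r n * v x\<bar>) \<le> G \<bar>v x\<bar>" using G_mono[of "\<bar>r n * v x\<bar>" "\<bar>v x\<bar>"] by (simp add: G_nonneg)
      qed
    qed (rule W0_moment1[OF v])
  qed
  have "J (\<lambda>x. 0 * v x) \<le> \<alpha>" "\<alpha> \<le> J (\<lambda>x. 1 * v x)" using \<alpha> J by (auto simp: J_def G_zero)
  from IVT'[of "\<lambda>t. J (\<lambda>x. t * v x)", OF this _ cont] show thesis using that by auto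
qed

lemma energy_bound:
  assumes v: "fin v" and J: "J v \<ge> \<alpha>"
  shows "energy_F s G u \<le> ennreal (F v)"
proof -
  have W: "v \<in> W0" using v by (simp add: fin_def)
  obtain t where t: "0 \<le> t" "t \<le> 1" "J (\<lambda>x. t * v x) = \<alpha>" using exists_level[OF W J] .
  have "energy_F s G u \<le> energy_F s G (\<lambda>x. t * v x)"
    using t by (intro min scale_W0 W) (simp add: energy_J_eq[OF scale_W0[OF W]])
  also have "\<dots> = ennreal (F (\<lambda>x. t * v x))" by (rule energy_F_eq[OF fin_shrink(1)[OF v t(1,2)]])
  also have "\<dots> \<le> ennreal (F v)" by (intro ennreal_leI fin_shrink v t)
  finally show ?thesis .
qed

text \<open>
  If all test functions were 0, then the pairing of \<open>u\<close> with its own sign would be 0, contrary to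
  \<open>J u > 0\<close>.
\<close>

lemma exists_test_function: "\<exists>\<phi> x. \<phi> \<in> Cc_infinity \<Omega> \<and> \<phi> x \<noteq> 0"
proof (rule ccontr)
  assume "\<not> ?thesis"
  then have zero: "\<phi> = (\<lambda>x. 0)" if "\<phi> \<in> Cc_infinity \<Omega>" for \<phi> using that by auto
  have um[measurable]: "u \<in> borel_measurable M\<^sub>\<Omega>" by (rule W0_measurable[OF u])
  define q where "q = (\<lambda>x. sgn (u x), \<lambda>z :: 'a \<times> 'a. 0 :: real)"
  have q: "q \<in> predual G \<Omega>"
    unfolding q_def predual_def
  proof (intro SigmaI bounded_fin_supp_orlicz_E gauge_compl)
    show "(\<lambda>z :: 'a \<times> 'a. 0) \<in> bounded_fin_supp frac_mu" by (auto simp: bounded_fin_supp_def)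
    have "emeasure M\<^sub>\<Omega> {x \<in> space M\<^sub>\<Omega>. sgn (u x) \<noteq> 0} \<le> emeasure M\<^sub>\<Omega> (space M\<^sub>\<Omega>)" by (rule emeasure_space)
    also have "\<dots> = emeasure lborel \<Omega>" by (simp add: emeasure_restrict_space)
    also have "\<dots> < \<infinity>" using emeasure_bounded_finite[OF \<Omega>(2)] .
    finally show "(\<lambda>x. sgn (u x)) \<in> bounded_fin_supp M\<^sub>\<Omega>"
      by (auto simp: bounded_fin_supp_def abs_sgn_eq intro!: exI[of _ 1])
  qed
  have "\<bar>pairing s \<Omega> u q\<bar> < \<epsilon>" if "\<epsilon> > 0" for \<epsilon>
  proof -
    have "\<exists>\<phi>\<in>Cc_infinity \<Omega> \<inter> frac_WL s G \<Omega>. \<forall>r\<in>{q}. \<bar>pairing s \<Omega> \<phi> r - pairing s \<Omega> u r\<bar> < \<epsilon>"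
      by (rule u[unfolded frac_WL0_iff, THEN conjunct2, rule_format]) (use q that in auto)
    then obtain \<phi> where \<phi>: "\<phi> \<in> Cc_infinity \<Omega>" "\<bar>pairing s \<Omega> \<phi> q - pairing s \<Omega> u q\<bar> < \<epsilon>" by auto
    have "pairing s \<Omega> \<phi> q = 0" unfolding zero[OF \<phi>(1)] by (simp add: pairing_def q_def)
    then show ?thesis using \<phi>(2) by simp
  qed
  then have "pairing s \<Omega> u q = 0" by (metis abs_0_eq less_irrefl zero_less_abs_iff)
  then have "(LINT x|M\<^sub>\<Omega>. u x * sgn (u x)) = 0" by (simp add: pairing_def q_def)
  moreover have "integrable M\<^sub>\<Omega> (\<lambda>x. u x * sgn (u x))"
    using integrable_mult_orlicz[of u M\<^sub>\<Omega> "\<lambda>x. sgn (u x)"] W0_WL[OF u] q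
    by (auto simp: frac_WL_def q_def predual_def orlicz_E_def)
  moreover have "u x * sgn (u x) \<ge> 0" for x by (simp add: sgn_if)
  ultimately have "AE x in M\<^sub>\<Omega>. u x * sgn (u x) = 0" by (subst (asm) integral_nonneg_eq_0_iff_AE) auto
  then have "AE x in M\<^sub>\<Omega>. G \<bar>u x\<bar> = 0" by eventually_elim (auto simp: sgn_if G_zero split: if_splits)
  then have "J u = 0" unfolding J_def by (rule integral_eq_zero_AE)
  then show False using Ju_eq \<alpha> by simp
qed

lemma lipschitz_nice:
  assumes f: "\<And>x y. \<bar>f x - f y\<bar> \<le> C * norm (x - y)" "\<And>x. x \<notin> K \<Longrightarrow> f x = 0" "\<And>x. \<bar>f x\<bar> \<le> m"
    and K: "compact K" "K \<subseteq> \<Omega>"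
  shows "nice f"
proof -
  obtain \<phi> x0 where \<phi>: "\<phi> \<in> Cc_infinity \<Omega>" "\<phi> x0 \<noteq> 0" using exists_test_function by blast
  have "f \<in> W0" by (rule lipschitz_frac_WL0[OF s \<Omega>(2,1) \<phi> f K])
  then show ?thesis
    unfolding nice_def fin_def frac_D_scale
    using lipschitz_frac_D_integrable[OF s f compact_imp_bounded[OF K(1)] borel_compact[OF K(1)]] scale_W0 by blast
qed

lemma nice_lincomb:
  assumes "nice v" "nice w" shows "nice (\<lambda>x. a * v x + b * w x)"
  unfolding nice_def
proof
  fix c
  have "fin (\<lambda>x. (1 - 1/2) * ((2 * c * a) * v x) + 1/2 * ((2 * c * b) * w x))"
    using assms by (intro fin_lincomb) (auto simp: nice_def)
  then show "fin (\<lambda>x. c * (a * v x + b * w x))" by (simp add: algebra_simps)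
qed

lemma nice_fin: "nice v \<Longrightarrow> fin v"
  unfolding nice_def by (drule spec[of _ 1]) simp

text \<open>
  A large multiple of a tent function exceeds the level \<open>\<alpha>\<close> and has finite energy.
\<close>

lemma fin_u: "fin u"
proof -
  obtain x0 r where r: "r > 0" "cball x0 r \<subseteq> \<Omega>" using \<Omega>(1,3) open_contains_cball by blast
  define b where "b = measure lborel (ball x0 (r/2))"
  have b: "b > 0" using r by (simp add: b_def content_ball_pos)
  \<comment> \<open>chosen so that the linear lower bound for \<open>G\<close> gives \<open>G x * b \<ge> \<alpha>\<close>\<close>
  define x where "x = \<alpha> / (b * g 1) + 1"
  have g1: "g 1 > 0" by (rule g_pos) simp
  have x: "x > 0" using b g1 \<alpha> by (simp add: x_def add_pos_pos)
  have Gx: "\<alpha> \<le> G x * b"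
  proof -
    have "x - 1 \<le> G x / g 1" using G_linear_lower[of x] x by simp
    then have "\<alpha> / (b * g 1) \<le> G x / g 1" by (simp add: x_def)
    then show ?thesis using b g1 by (simp add: field_simps)
  qed
  define f where "f y = (2 * x / r) * max 0 (r - norm (y - x0))" for y
  have "nice (\<lambda>y. max 0 (r - norm (y - x0)))"
  proof (rule lipschitz_nice[of _ 1 "cball x0 r" r])
    show "\<bar>max 0 (r - norm (y - x0)) - max 0 (r - norm (z - x0))\<bar> \<le> 1 * norm (y - z)" for y z
      using norm_triangle_ineq3[of "y - x0" "z - x0"] by simp
  qed (use r in \<open>auto simp: dist_norm norm_minus_commute\<close>)
  then have f: "fin f" unfolding nice_def f_def by blast
  have "\<alpha> \<le> (LINT y|M\<^sub>\<Omega>. G x * indicator (ball x0 (r/2)) y)"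
  proof -
    have "ball x0 (r/2) \<inter> \<Omega> = ball x0 (r/2)" using r by auto
    then have "measure M\<^sub>\<Omega> (ball x0 (r/2)) = b" using r by (subst measure_restrict_space) (auto simp: b_def)
    then show ?thesis using Gx \<open>ball x0 (r/2) \<inter> \<Omega> = ball x0 (r/2)\<close> by simp
  qed
  also have "\<dots> \<le> J f" unfolding J_def
  proof (rule integral_mono)
    show "integrable M\<^sub>\<Omega> (\<lambda>y. G x * indicator (ball x0 (r/2)) y)"
    proof (intro integrable_mult_right integrable_real_indicator)
      show B: "ball x0 (r/2) \<in> sets M\<^sub>\<Omega>" using r by (auto simp: sets_restrict_space_iff)
      then show "emeasure M\<^sub>\<Omega> (ball x0 (r/2)) < \<infinity>"
        using r emeasure_bounded_finite[OF bounded_ball, of x0 "r/2"] by (subst emeasure_restrict_space) (auto simp: less_top)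
    qed
    show "integrable M\<^sub>\<Omega> (\<lambda>y. G \<bar>f y\<bar>)" using f by (intro W0_moment1) (simp add: fin_def)
    fix y
    show "G x * indicator (ball x0 (r/2)) y \<le> G \<bar>f y\<bar>"
    proof (cases "y \<in> ball x0 (r/2)")
      case True
      then have "r / 2 \<le> r - norm (y - x0)" by (simp add: dist_norm norm_minus_commute)
      then have "(2 * x / r) * (r / 2) \<le> f y" unfolding f_def using x r by (intro mult_left_mono) auto
      then have "x \<le> \<bar>f y\<bar>" using r by simp
      then show ?thesis using True x by (simp add: G_mono)
    qed (simp add: G_nonneg)
  qed
  finally have "energy_F s G u \<le> ennreal (F f)" by (intro energy_bound f)
  then have "energy_F s G u < \<infinity>" by (simp add: order_le_less_trans)
  then show ?thesis unfolding fin_def energy_F_def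
    using u W0_measurable[OF u] gauge_measurable[OF gauge_G, of "frac_D s u"]
    by (subst integrable_nonneg_iff) (auto simp: G_nonneg)
qed

lemma p_integrable:
  assumes "v \<in> W0" shows "integrable M\<^sub>\<Omega> (\<lambda>x. young_deriv g (u x) * v x)"
  by (rule young_deriv_pairing(1)[OF W0_measurable(1)[OF u] W0_measurable(1)[OF assms] W0_moments[OF u] W0_moments[OF assms] zero_less_one])

lemma p_linear: "v \<in> W0 \<Longrightarrow> w \<in> W0 \<Longrightarrow> p (\<lambda>x. a * v x + b * w x) = a * p v + b * p w"
  using p_integrable[of v] p_integrable[of w] by (simp add: p_def distrib_left mult.left_commute)

lemma J_subgrad:
  assumes "v \<in> W0" shows "J v \<ge> J u + (p v - p u)"
proof -
  have "J u + (p v - p u) = (LINT x|M\<^sub>\<Omega>. G \<bar>u x\<bar> + (young_deriv g (u x) * v x - young_deriv g (u x) * u x))"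
    using W0_moment1[OF u] p_integrable[OF assms] p_integrable[OF u] by (simp add: J_def p_def)
  also have "\<dots> \<le> J v" unfolding J_def
  proof (rule integral_mono)
    show "G \<bar>u x\<bar> + (young_deriv g (u x) * v x - young_deriv g (u x) * u x) \<le> G \<bar>v x\<bar>" for x
      using G_abs_subgrad[of "u x" "v x"] by (simp add: right_diff_distrib)
  qed (use W0_moment1[OF u] W0_moment1[OF assms] p_integrable[OF assms] p_integrable[OF u] in auto)
  finally show ?thesis .
qed

text \<open>
  The subgradient inequality between \<open>u\<close> and 0 gives \<open>p u \<ge> \<alpha>\<close>.
\<close>

lemma p_u_pos: "p u > 0"
  using J_subgrad[OF zero_W0] Ju_eq \<alpha> by (simp add: J_def p_def G_zero)

text \<open>
  The subgradient inequality turns \<open>p v \<ge> p u\<close> into \<open>J v \<ge> \<alpha>\<close>.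
\<close>

lemma minimal_on_halfspace:
  assumes "fin v" "p v \<ge> p u" shows "F u \<le> F v"
proof -
  have "J v \<ge> \<alpha>" using J_subgrad[of v] assms Ju_eq by (simp add: fin_def)
  from energy_bound[OF assms(1) this] show ?thesis by (simp add: energy_F_eq[OF fin_u] F_nonneg)
qed

lemma variation:
  assumes v: "fin v" "p v \<ge> p u"
  shows "integrable frac_mu (\<lambda>z. young_deriv g (frac_D s u z) * (frac_D s v z - frac_D s u z))"
    "0 \<le> (LINT z|frac_mu. young_deriv g (frac_D s u z) * (frac_D s v z - frac_D s u z))"
proof -
  have W: "v \<in> W0" using v by (simp add: fin_def)
  have cont: "AE z in frac_mu. frac_D s u z = 0 \<or> isCont g \<bar>frac_D s u z\<bar>"
  proof -
    have "AE z in frac_mu. \<bar>frac_D s u z\<bar> \<notin> {a. 0 < a \<and> \<not> isCont g a}"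
      using W0_WL[OF u] by (intro AE_frac_D_not_countable s countable_jumps) (auto simp: frac_WL_def)
    then show ?thesis by eventually_elim auto
  qed
  have min: "(LINT z|frac_mu. G \<bar>frac_D s u z\<bar>) \<le> (LINT z|frac_mu. G \<bar>(1 - t) * frac_D s u z + t * frac_D s v z\<bar>)"
    if t: "0 < t" "t < 1" for t
  proof -
    have "p u \<le> p (\<lambda>x. (1 - t) * u x + t * v x)"
      unfolding p_linear[OF u W] using mult_left_mono[OF v(2), of t] t by (simp add: algebra_simps)
    then have "F u \<le> F (\<lambda>x. (1 - t) * u x + t * v x)"
      using t by (intro minimal_on_halfspace fin_lincomb fin_u v) auto
    then show ?thesis by (simp add: F_def frac_D_linear)
  qed
  have iu: "integrable frac_mu (\<lambda>z. G \<bar>frac_D s u z\<bar>)" "integrable frac_mu (\<lambda>z. G \<bar>frac_D s v z\<bar>)"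
    using fin_u v by (auto simp: fin_def)
  note var = variation_nonneg[OF W0_measurable(2)[OF u] W0_measurable(2)[OF W] iu cont]
  show "integrable frac_mu (\<lambda>z. young_deriv g (frac_D s u z) * (frac_D s v z - frac_D s u z))"
    by (rule var(1)) (rule min)
  show "0 \<le> (LINT z|frac_mu. young_deriv g (frac_D s u z) * (frac_D s v z - frac_D s u z))"
    by (rule var(2)) (rule min)
qed

lemma nice_recovery:
  assumes "\<epsilon> > 0"
  obtains f where "nice f" "F f \<le> F u + \<epsilon>" "\<bar>p f - p u\<bar> \<le> \<epsilon>"
proof -
  have iu: "integrable frac_mu (\<lambda>z. G \<bar>frac_D s u z\<bar>)" using fin_u by (simp add: fin_def)
  show thesis
  proof (rule lipschitz_recovery[OF s \<Omega> u iu assms], goal_cases)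
    case (1 f C K m)
    from 1(1-5) have "nice f" by (intro lipschitz_nice[of f C K m])
    then show ?case using 1(6,7) by (intro that[of f]) (auto simp: F_def p_def)
  qed
qed

lemma exists_normalized_nice:
  obtains f0 where "nice f0" "p f0 = p u"
proof -
  obtain f where f: "nice f" "\<bar>p f - p u\<bar> \<le> p u / 2" using nice_recovery[of "p u / 2"] p_u_pos by auto
  have pf: "p f > 0" using f(2) p_u_pos by linarith
  have W: "f \<in> W0" using nice_fin[OF f(1)] by (simp add: fin_def)
  define f0 where "f0 = (\<lambda>x. (p u / p f) * f x + 0 * f x)"
  have "nice f0" unfolding f0_def by (rule nice_lincomb[OF f(1) f(1)])
  moreover have "p f0 = p u" unfolding f0_def p_linear[OF W W] using pf by simp
  ultimately show thesis by (rule that)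
qed

text \<open>
  Varying \<open>u\<close> towards a nice function shows that \<open>g |D| |D|\<close>, with \<open>D\<close> the difference quotient of
  \<open>u\<close>, is integrable, although \<open>G |2 D|\<close> need not be.
\<close>

lemma self_energy_integrable: "integrable frac_mu (\<lambda>z. g \<bar>frac_D s u z\<bar> * \<bar>frac_D s u z\<bar>)"
proof -
  obtain f where f: "nice f" "p f = p u" by (rule exists_normalized_nice)
  have W: "f \<in> W0" using nice_fin[OF f(1)] by (simp add: fin_def)
  have "fin (\<lambda>x. 4 * f x)" using f(1) by (simp add: nice_def)
  then have "integrable frac_mu (\<lambda>z. G \<bar>4 * frac_D s f z\<bar>)" unfolding fin_def frac_D_scale by simp
  from variation_integrable[OF W0_measurable(2)[OF u] W0_measurable(2)[OF W] this variation(1)[OF nice_fin[OF f(1)]]] f(2)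
  show ?thesis by simp
qed

lemma L_integrable:
  assumes v: "v \<in> W0"
  shows "integrable frac_mu (\<lambda>z. young_deriv g (frac_D s u z) * frac_D s v z)"
proof -
  obtain l where l: "l > 0" "integrable frac_mu (\<lambda>z. G \<bar>frac_D s v z / l\<bar>)"
    using orlicz_L_scaled[OF gauge_G, of "frac_D s v" frac_mu] W0_WL[OF v] by (auto simp: frac_WL_def)
  have [measurable]: "frac_D s u \<in> borel_measurable frac_mu" "frac_D s v \<in> borel_measurable frac_mu"
    by (fact W0_measurable(2)[OF u] W0_measurable(2)[OF v])+
  have b: "\<bar>young_deriv g (frac_D s u z) * (frac_D s v z / (2 * l))\<bar> \<le> g \<bar>frac_D s u z\<bar> * \<bar>frac_D s u z\<bar> + G \<bar>frac_D s v z / l\<bar>" for z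
    using young_deriv_young[of 1 "frac_D s u z" "frac_D s v z / (2 * l)"] l(1) by (simp add: abs_mult)
  have "integrable frac_mu (\<lambda>z. young_deriv g (frac_D s u z) * (frac_D s v z / (2 * l)))"
  proof (rule Bochner_Integration.integrable_bound[OF Bochner_Integration.integrable_add[OF self_energy_integrable l(2)]])
    show "AE z in frac_mu. norm (young_deriv g (frac_D s u z) * (frac_D s v z / (2 * l))) \<le> norm (g \<bar>frac_D s u z\<bar> * \<bar>frac_D s u z\<bar> + G \<bar>frac_D s v z / l\<bar>)"
      unfolding real_norm_def by (rule AE_I2) (rule order_trans[OF b abs_ge_self])
  qed measurable
  then have "integrable frac_mu (\<lambda>z. (2 * l) * (young_deriv g (frac_D s u z) * (frac_D s v z / (2 * l))))" by (rule integrable_mult_right)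
  then show ?thesis using l(1) by simp
qed

lemma L_linear: "v \<in> W0 \<Longrightarrow> w \<in> W0 \<Longrightarrow> L (\<lambda>x. a * v x + b * w x) = a * L v + b * L w"
  using L_integrable[of v] L_integrable[of w] by (simp add: L_def frac_D_linear distrib_left mult.left_commute)

lemma L_ge:
  assumes "fin v" "p v \<ge> p u" shows "L v \<ge> L u"
  using variation(2)[OF assms] L_integrable[of v] L_integrable[OF u] assms(1)
  by (simp add: L_def right_diff_distrib fin_def)

lemma F_subgrad:
  assumes "fin v" shows "L v \<le> L u + (F v - F u)"
proof -
  have W: "v \<in> W0" using assms by (simp add: fin_def)
  have "L v - L u = (LINT z|frac_mu. young_deriv g (frac_D s u z) * frac_D s v z - young_deriv g (frac_D s u z) * frac_D s u z)"
    using L_integrable[OF W] L_integrable[OF u] by (simp add: L_def)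
  also have "\<dots> \<le> (LINT z|frac_mu. G \<bar>frac_D s v z\<bar> - G \<bar>frac_D s u z\<bar>)"
  proof (rule integral_mono)
    show "young_deriv g (frac_D s u z) * frac_D s v z - young_deriv g (frac_D s u z) * frac_D s u z \<le> G \<bar>frac_D s v z\<bar> - G \<bar>frac_D s u z\<bar>" for z
      using G_abs_subgrad[of "frac_D s u z" "frac_D s v z"] by (simp add: right_diff_distrib)
  qed (use L_integrable[OF W] L_integrable[OF u] assms fin_u in \<open>auto simp: fin_def\<close>)
  also have "\<dots> = F v - F u" using assms fin_u by (simp add: F_def fin_def)
  finally show ?thesis by simp
qed

text \<open>
  As \<open>L u \<ge> F u\<close>, it is enough that \<open>F u \<noteq> 0\<close>. If \<open>F u\<close> were 0, then \<open>u\<close> would be constant almost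
  everywhere, hence 0, since it vanishes outside the bounded set \<open>\<Omega>\<close>.
\<close>

lemma L_u_pos: "L u > 0"
proof -
  have "L u \<ge> F u" using F_subgrad[OF fin_zero] fin_zero frac_D_scale[of 0 u] by (simp add: F_def L_def G_zero)
  moreover have "F u \<noteq> 0"
  proof
    assume F0: "F u = 0"
    obtain w where w[measurable]: "w \<in> borel_measurable borel" and uw: "AE x in lebesgue. u x = w x" and w0: "\<And>x. x \<notin> \<Omega> \<Longrightarrow> w x = 0"
      by (rule frac_WL0_borel_representative[OF s(1) \<Omega>(1-3) u]) (rule that)
    have D[measurable]: "frac_D s w \<in> borel_measurable (borel \<Otimes>\<^sub>M borel)"
      using frac_D_borel[OF w, of s] by (simp add: borel_prod)
    have "(\<integral>\<^sup>+z. ennreal (G \<bar>frac_D s w z\<bar>) \<partial>frac_mu) = energy_F s G u"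
      unfolding energy_F_def using frac_D_cong_AE[OF uw, of s] by (intro nn_integral_cong_AE) auto
    also have "\<dots> = 0" using F0 by (simp add: energy_F_eq[OF fin_u])
    finally have "(\<integral>\<^sup>+x. \<integral>\<^sup>+y. ennreal (1 / norm (x - y) ^ DIM('a)) * ennreal (G \<bar>frac_D s w (x, y)\<bar>) \<partial>lborel \<partial>lborel) = 0"
      by (subst (asm) nn_integral_frac_mu) (auto simp: borel_prod[symmetric])
    then have "AE x in lborel. (\<integral>\<^sup>+y. ennreal (1 / norm (x - y) ^ DIM('a)) * ennreal (G \<bar>frac_D s w (x, y)\<bar>) \<partial>lborel) = 0"
      by (subst (asm) nn_integral_0_iff_AE) measurable
    then have "AE x in lborel. w x = 0"
    proof eventually_elim
      case (elim x)
      then have "AE y in lborel. ennreal (1 / norm (x - y) ^ DIM('a)) * ennreal (G \<bar>frac_D s w (x, y)\<bar>) = 0"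
        by (subst (asm) nn_integral_0_iff_AE) measurable
      then have ae: "AE y in lborel. w y = w x"
        using AE_lborel_singleton[of x]
      proof eventually_elim
        case (elim y)
        then have "\<not> 1 / norm (x - y) ^ DIM('a) \<le> 0" by (simp add: not_le)
        then have "G \<bar>frac_D s w (x, y)\<bar> \<le> 0" using elim by (auto simp: ennreal_eq_0_iff)
        then have "G \<bar>frac_D s w (x, y)\<bar> = 0" using G_nonneg[of "\<bar>frac_D s w (x, y)\<bar>"] by simp
        then have "frac_D s w (x, y) = 0" using G_pos[of "\<bar>frac_D s w (x, y)\<bar>"] by (metis less_irrefl zero_less_abs_iff)
        then show ?case using elim by (auto simp: frac_D_def)
      qed
      show ?case
      proof (rule ccontr)
        assume wx: "w x \<noteq> 0"
        have "AE y in lborel. y \<notin> - \<Omega>" using ae by eventually_elim (metis ComplD w0 wx)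
        then have "- \<Omega> \<in> null_sets lborel" by (subst AE_iff_null_sets) auto
        then have "emeasure lborel (UNIV :: 'a set) \<le> emeasure lborel \<Omega> + 0"
          using emeasure_subadditive[of \<Omega> lborel "- \<Omega>"] by (auto simp: Compl_partition)
        then show False using emeasure_bounded_finite[OF \<Omega>(2)] by (simp add: emeasure_lborel_UNIV)
      qed
    qed
    then have "AE x in lebesgue. w x = 0" by (rule AE_completion)
    then have "AE x in lebesgue. u x = 0" using uw by eventually_elim simp
    then have "AE x in M\<^sub>\<Omega>. G \<bar>u x\<bar> = 0" using AE_lebesgue_onI[of "\<lambda>x. u x = 0" \<Omega>] by (auto simp: G_zero)
    then have "J u = 0" unfolding J_def by (rule integral_eq_zero_AE)
    then show False using Ju_eq \<alpha> by simp
  qed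
  ultimately show ?thesis using F_nonneg[of u] by linarith
qed

text \<open>
  On nice functions \<open>h\<close> with \<open>p h = 0\<close> the functional \<open>L\<close> vanishes, because \<open>f0 + k h\<close> is a
  competitor for every real \<open>k\<close>.
\<close>

lemma L_nice:
  assumes f0: "nice f0" "p f0 = p u" and f: "nice f"
  shows "L f = L f0 / p u * p f"
proof -
  have W: "f0 \<in> W0" "f \<in> W0" using nice_fin f0 f by (auto simp: fin_def)
  define h where "h = (\<lambda>x. 1 * f x + (- p f / p u) * f0 x)"
  have h: "nice h" unfolding h_def by (rule nice_lincomb[OF f f0(1)])
  have Wh: "h \<in> W0" using nice_fin[OF h] by (simp add: fin_def)
  have ph: "p h = 0" unfolding h_def p_linear[OF W(2,1)] using f0 p_u_pos by simp
  have Lh: "L h = L f - p f / p u * L f0" unfolding h_def L_linear[OF W(2,1)] by simp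
  have ge: "L f0 + k * L h \<ge> L u" for k
  proof -
    have "fin (\<lambda>x. 1 * f0 x + k * h x)" by (intro nice_fin nice_lincomb f0 h)
    from L_ge[OF this] show ?thesis by (simp only: p_linear[OF W(1) Wh] L_linear[OF W(1) Wh] ph f0) simp
  qed
  have "L h = 0"
  proof (rule ccontr)
    assume "L h \<noteq> 0"
    \<comment> \<open>this choice of \<open>k\<close> makes \<open>L (f0 + k h)\<close> equal to \<open>L u - 1\<close>\<close>
    then have "(- (L f0 - L u + 1) / L h) * L h = - (L f0 - L u + 1)" by simp
    then show False using ge[of "- (L f0 - L u + 1) / L h"] by linarith
  qed
  then show ?thesis using Lh by simp
qed

text \<open>
  For a nice \<open>f\<close> with energy and \<open>p\<close> close to those of \<open>u\<close>, convexity gives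
  \<open>L f \<le> L u + (F f - F u)\<close>, while \<open>L f\<close> is proportional to \<open>p f\<close>.
\<close>

lemma L_nice_eq_L_u:
  assumes f0: "nice f0" "p f0 = p u" shows "L f0 = L u"
proof (rule antisym)
  show "L u \<le> L f0" using L_ge[OF nice_fin[OF f0(1)]] f0(2) by simp
  define \<kappa> where "\<kappa> = L f0 / p u"
  have \<kappa>: "\<kappa> \<ge> 0" using \<open>L u \<le> L f0\<close> L_u_pos p_u_pos by (simp add: \<kappa>_def)
  show "L f0 \<le> L u"
  proof (rule field_le_epsilon)
    fix e :: real assume e: "e > 0"
    define \<epsilon> where "\<epsilon> = e / (1 + \<kappa>)"
    have \<epsilon>: "\<epsilon> > 0" "\<epsilon> * (1 + \<kappa>) = e" using e \<kappa> by (auto simp: \<epsilon>_def)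
    obtain f where f: "nice f" "F f \<le> F u + \<epsilon>" "\<bar>p f - p u\<bar> \<le> \<epsilon>" using nice_recovery[OF \<epsilon>(1)] .
    have "L f \<le> L u + \<epsilon>" using F_subgrad[OF nice_fin[OF f(1)]] f(2) by simp
    moreover have "L f = \<kappa> * p f" using L_nice[OF f0 f(1)] by (simp add: \<kappa>_def)
    moreover have "\<kappa> * (p u - \<epsilon>) \<le> \<kappa> * p f" using \<kappa> f(3) by (intro mult_left_mono) auto
    ultimately have "\<kappa> * p u \<le> L u + \<epsilon> * (1 + \<kappa>)" by (simp add: algebra_simps)
    then show "L f0 \<le> L u + e" using p_u_pos \<epsilon> by (simp add: \<kappa>_def)
  qed
qed

text \<open>
  Small positive and negative multiples \<open>c v\<close>, corrected by a multiple of the nice \<open>f0\<close> so that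
  \<open>p\<close> takes the value \<open>p u\<close>, are competitors of finite energy.
\<close>

theorem euler_lagrange:
  assumes v: "v \<in> W0"
  shows "L v = L u / p u * p v"
proof -
  obtain f0 where f0: "nice f0" "p f0 = p u" by (rule exists_normalized_nice)
  have Lf0: "L f0 = L u" by (rule L_nice_eq_L_u[OF f0])
  have W0: "f0 \<in> W0" using nice_fin[OF f0(1)] by (simp add: fin_def)
  obtain l where l: "l > 0" "integrable frac_mu (\<lambda>z. G \<bar>frac_D s v z / l\<bar>)"
    using orlicz_L_scaled[OF gauge_G, of "frac_D s v" frac_mu] W0_WL[OF v] by (auto simp: frac_WL_def)
  \<comment> \<open>at \<open>|c| = 1 / (2 l)\<close> the function \<open>2 c v\<close> still has finite energy\<close>
  have ge: "c * L v \<ge> c * (L u / p u * p v)" if c: "\<bar>c\<bar> * (2 * l) = 1" for c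
  proof -
    define k where "k = 1 - c * p v / p u"
    define h where "h = (\<lambda>x. (1 - 1/2) * ((2 * c) * v x) + 1/2 * ((2 * k) * f0 x))"
    have "fin (\<lambda>x. (2 * c) * v x)"
      unfolding fin_def frac_D_scale
    proof (intro conjI scale_W0 v)
      have "\<bar>2 * c\<bar> = 1 / l" using c l(1) by (simp add: abs_mult field_simps)
      then have "G \<bar>2 * c * frac_D s v z\<bar> = G \<bar>frac_D s v z / l\<bar>" for z using l(1) by (simp add: abs_mult)
      then show "integrable frac_mu (\<lambda>z. G \<bar>2 * c * frac_D s v z\<bar>)" using l(2) by simp
    qed
    then have h: "fin h" unfolding h_def using f0(1) by (intro fin_lincomb) (auto simp: nice_def)
    have heq: "h = (\<lambda>x. c * v x + k * f0 x)" by (auto simp: h_def)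
    have "p h = p u" unfolding heq p_linear[OF v W0] f0(2) using p_u_pos by (simp add: k_def field_simps)
    then have "L u \<le> L h" using L_ge[OF h] by simp
    also have "L h = c * L v + k * L u" unfolding heq L_linear[OF v W0] Lf0 by simp
    finally show ?thesis using p_u_pos by (simp add: k_def field_simps)
  qed
  have "1 / (2 * l) * (L u / p u * p v) \<le> 1 / (2 * l) * L v" using ge[of "1 / (2 * l)"] l(1) by simp
  moreover have "- (1 / (2 * l)) * (L u / p u * p v) \<le> - (1 / (2 * l)) * L v" by (rule ge) (use l(1) in simp)
  ultimately have "1 / (2 * l) * (L u / p u * p v) = 1 / (2 * l) * L v" by linarith
  then have "L u / p u * p v = L v" by (rule mult_left_cancel[THEN iffD1, rotated]) (use l(1) in simp)
  then show ?thesis by simp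
qed

end

theorem theorem1p2:
  fixes \<Omega> :: "(real ^ 'n) set"
    and s \<alpha> :: real
    and G g :: "real \<Rightarrow> real"
    and u :: "real ^ 'n \<Rightarrow> real"
  assumes "open \<Omega>" and "connected \<Omega>" and "\<Omega> \<noteq> {}" and "bounded \<Omega>" and "lipschitz_boundary \<Omega>"
    and "0 < s" and "s < 1"
    and "young_function G g"
    and "(\<integral>\<^sup>+t\<in>{1..}. ennreal ((t / G t) powr (s / (real CARD('n) - s))) \<partial>lborel) = \<infinity>"
    and "(\<integral>\<^sup>+t\<in>{0..1}. ennreal ((t / G t) powr (s / (real CARD('n) - s))) \<partial>lborel) < \<infinity>"
    and "\<alpha> > 0"
    and "u \<in> frac_WL0 s G \<Omega>" and "energy_J G \<Omega> u = ennreal \<alpha>"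
    and "\<And>w. w \<in> frac_WL0 s G \<Omega> \<Longrightarrow> energy_J G \<Omega> w = ennreal \<alpha> \<Longrightarrow> energy_F s G u \<le> energy_F s G w"
  shows "\<exists>\<mu>>0. \<forall>v\<in>frac_WL0 s G \<Omega>.
    integrable frac_mu
      (\<lambda>z. g \<bar>frac_D s u z\<bar> * (frac_D s u z / \<bar>frac_D s u z\<bar>) * frac_D s v z) \<and>
    integrable (lebesgue_on \<Omega>) (\<lambda>x. g \<bar>u x\<bar> * (u x / \<bar>u x\<bar>) * v x) \<and>
    (LINT z|frac_mu. g \<bar>frac_D s u z\<bar> * (frac_D s u z / \<bar>frac_D s u z\<bar>) * frac_D s v z)
      = \<mu> * (LINT x|lebesgue_on \<Omega>. g \<bar>u x\<bar> * (u x / \<bar>u x\<bar>) * v x)"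
proof -
  interpret constrained_minimizer G g s \<alpha> \<Omega> u
    by unfold_locales (use assms in auto)
  show ?thesis
    unfolding young_deriv_def[symmetric]
  proof (intro exI conjI ballI)
    show "0 < L u / p u" using L_u_pos p_u_pos by simp
    fix v assume v: "v \<in> frac_WL0 s G \<Omega>"
    show "integrable frac_mu (\<lambda>z. young_deriv g (frac_D s u z) * frac_D s v z)" by (rule L_integrable[OF v])
    show "integrable (lebesgue_on \<Omega>) (\<lambda>x. young_deriv g (u x) * v x)" by (rule p_integrable[OF v])
    show "(LINT z|frac_mu. young_deriv g (frac_D s u z) * frac_D s v z) = L u / p u * (LINT x|lebesgue_on \<Omega>. young_deriv g (u x) * v x)"
      using euler_lagrange[OF v] by (simp only: L_def[of v] p_def[of v])
  qed
qed

end
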